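(* Let $a,b,c,e,f,g$ be positive integers and $\mu:=((e+f+g)^a,(e+f)^b,e^c)$, a partition of $n-1:=a(e+f+g)+b(e+f)+ce$. Then $\mu$ is an isoclinic partition if and only if \[c=\frac{2af}{b+g}+f\qquad\text{and}\qquad e=\frac{(a+g)f}{b}-c.\]
   Context: Notation $(l_1^{a_1},\dots)$ means $l_1$ repeated $a_1$ times, etc. For $\lambda\vdash n$, $\operatorname{Tab}(\lambda)$ is the set of standard Young tableaux, $d_\lambda=|\operatorname{Tab}(\lambda)|$, $V_\lambda$ the real Hilbert space with orthonormal basis $\{v_T\}$, and $\pi_\lambda\colon S_n\to\operatorname{U}(V_\lambda)$ Young's orthogonal form, $\pi_\lambda(s_k)v_T=\frac1{D_T(k+1,k)}v_T+\sqrt{1-\frac1{D_T(k+1,k)^2}}v_{s_kT}$, where $s_k=(k\ k{+}1)$ acts on entries, and $D_T(a,b)=(j-i)-(j'-i')$ for $a$ in box $(i,j)$, $b$ in box $(i',j')$ (second term absent if $s_kT$ not standard). For $\mu\vdash n-1$, $\mu^\uparrow$ is the set of $\lambda\vdash n$ obtained by adding one box to $\mu$'s Young diagram; for $R\in\operatorname{Tab}(\mu)$, $R^\lambda$ places $n$ in the added box; $\Psi_{\lambda,\mu}v_R=v_{R^\lambda}$. For $L\subseteq\mu^\uparrow$: $V_L=\bigoplus_{\lambda\in L}V_\lambda$, $\pi_L=\bigoplus\pi_\lambda$, $d_L=\sum d_\lambda$, $W_L=\operatorname{im}\Psi_L$ where $\Psi_L(v)=\{\sqrt{d_\lambda/d_L}\Psi_{\lambda,\mu}v\}_{\lambda\in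 L}$, and $\mathcal{W}_L=\{\pi_L(t_k)W_L\}_{k\in[n]}$ for $t_k\in S_n$ with $t_k(n)=k$. $\mu$ is isoclinic if there is a nonempty proper $L\subset\mu^\uparrow$ such that $\mathcal{W}_L$ is equi-isoclinic: for isometries $\Phi_k$ onto its members there is $\alpha$ with $(\Phi_k^*\Phi_\ell)^*(\Phi_k^*\Phi_\ell)=\alpha I$ for all $k\ne\ell$. *)

theory Defs
  imports Complex_Main "HOL-Combinatorics.Permutations"
begin

section \<open>Operators between finite-dimensional real Hilbert spaces\<close>

text \<open>
  The Hilbert space with orthonormal basis indexed by a finite set \<open>X\<close> consists of the functions
  to the reals vanishing outside \<open>X\<close>. An operator is identified with its matrix in the given
  orthonormal bases: \<open>A y x\<close> is the coefficient of the \<open>y\<close>-th basis vector in the image of the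
  \<open>x\<close>-th one. As the index sets are not types, they are passed explicitly.
\<close>

type_synonym ('y, 'x) opr = "'y \<Rightarrow> 'x \<Rightarrow> real"

definition op_apply :: "'x set \<Rightarrow> ('y, 'x) opr \<Rightarrow> ('x \<Rightarrow> real) \<Rightarrow> ('y \<Rightarrow> real)" where
  "op_apply X A v = (\<lambda>y. \<Sum>x\<in>X. A y x * v x)"

definition op_comp :: "'y set \<Rightarrow> ('z, 'y) opr \<Rightarrow> ('y, 'x) opr \<Rightarrow> ('z, 'x) opr" where
  "op_comp Y A B = (\<lambda>z x. \<Sum>y\<in>Y. A z y * B y x)"

definition op_adj :: "('y, 'x) opr \<Rightarrow> ('x, 'y) opr" where
  "op_adj A = (\<lambda>x y. A y x)"

definition op_scalar :: "'x set \<Rightarrow> real \<Rightarrow> ('x, 'x) opr" where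
  "op_scalar X c = (\<lambda>y x. if x \<in> X \<and> y = x then c else 0)"

definition op_eq :: "'y set \<Rightarrow> 'x set \<Rightarrow> ('y, 'x) opr \<Rightarrow> ('y, 'x) opr \<Rightarrow> bool" where
  "op_eq Y X A B \<longleftrightarrow> (\<forall>y\<in>Y. \<forall>x\<in>X. A y x = B y x)"

definition op_image :: "'x set \<Rightarrow> ('y, 'x) opr \<Rightarrow> ('y \<Rightarrow> real) set" where
  "op_image X A = range (op_apply X A)"

definition is_isometry :: "'y set \<Rightarrow> 'x set \<Rightarrow> ('y, 'x) opr \<Rightarrow> bool" where
  "is_isometry Y X A \<longleftrightarrow> op_eq X X (op_comp Y (op_adj A) A) (op_scalar X 1)"

text \<open>
  A family of subspaces \<open>W k\<close>, \<open>k \<in> K\<close>, of the Hilbert space over \<open>X\<close>. Replacing \<open>\<Phi> k\<close> by another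
  isometry onto \<open>W k\<close> multiplies it on the right by an orthogonal matrix, which does not affect the
  condition, so it is immaterial that the isometries are quantified existentially.
\<close>

definition equi_isoclinic :: "'k set \<Rightarrow> 'y set \<Rightarrow> ('k \<Rightarrow> ('y \<Rightarrow> real) set) \<Rightarrow> bool" where
  "equi_isoclinic K X W \<longleftrightarrow>
     (\<exists>(r::nat) (\<Phi> :: 'k \<Rightarrow> ('y, nat) opr) (\<alpha>::real).
        (\<forall>k\<in>K. is_isometry X {..<r} (\<Phi> k) \<and> op_image {..<r} (\<Phi> k) = W k) \<and>
        (\<forall>k\<in>K. \<forall>l\<in>K. k \<noteq> l \<longrightarrow>
           (let C = op_comp X (op_adj (\<Phi> k)) (\<Phi> l)
            in op_eq {..<r} {..<r} (op_comp {..<r} (op_adj C) C) (op_scalar {..<r} \<alpha>))))"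


section \<open>Partitions and standard Young tableaux\<close>

definition partition_of :: "nat \<Rightarrow> nat list \<Rightarrow> bool" where
  "partition_of n \<nu> \<longleftrightarrow> sorted_wrt (\<ge>) \<nu> \<and> 0 \<notin> set \<nu> \<and> sum_list \<nu> = n"

text \<open>Boxes are (row, column) pairs counted from 0; contents do not depend on this choice.\<close>

definition diagram :: "nat list \<Rightarrow> (nat \<times> nat) set" where
  "diagram \<nu> = {(i, j). i < length \<nu> \<and> j < \<nu> ! i}"

text \<open>A tableau maps boxes to entries and is 0 outside the diagram, so that equality of tableaux
  is equality of functions.\<close>

type_synonym tableau = "nat \<times> nat \<Rightarrow> nat"

definition Tab :: "nat list \<Rightarrow> tableau set" where
  "Tab \<nu> = {T. bij_betw T (diagram \<nu>) {1..sum_list \<nu>} \<and>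
               (\<forall>x. x \<notin> diagram \<nu> \<longrightarrow> T x = 0) \<and>
               (\<forall>i j j'. j < j' \<and> (i, j') \<in> diagram \<nu> \<longrightarrow> T (i, j) < T (i, j')) \<and>
               (\<forall>i i' j. i < i' \<and> (i', j) \<in> diagram \<nu> \<longrightarrow> T (i, j) < T (i', j))}"

definition content :: "nat \<times> nat \<Rightarrow> int" where
  "content x = int (snd x) - int (fst x)"

definition box_of :: "nat list \<Rightarrow> tableau \<Rightarrow> nat \<Rightarrow> nat \<times> nat" where
  "box_of \<nu> T a = inv_into (diagram \<nu>) T a"

definition axial_dist :: "nat list \<Rightarrow> tableau \<Rightarrow> nat \<Rightarrow> nat \<Rightarrow> int" where
  "axial_dist \<nu> T a b = content (box_of \<nu> T a) - content (box_of \<nu> T b)"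


section \<open>Young's orthogonal form\<close>

definition adj_transp :: "nat \<Rightarrow> nat \<Rightarrow> nat" where
  "adj_transp k = Transposition.transpose k (Suc k)"

definition young_gen :: "nat list \<Rightarrow> nat \<Rightarrow> (tableau, tableau) opr" where
  "young_gen \<nu> k = (\<lambda>S T.
     if S \<in> Tab \<nu> \<and> T \<in> Tab \<nu> then
       (let D = real_of_int (axial_dist \<nu> T (Suc k) k) in
         if S = T then 1 / D
         else if S = adj_transp k \<circ> T then sqrt (1 - 1 / D\<^sup>2)
         else 0)
     else 0)"

definition word_perm :: "nat list \<Rightarrow> nat \<Rightarrow> nat" where
  "word_perm ks = foldr (\<lambda>k \<sigma>. adj_transp k \<circ> \<sigma>) ks id"

definition word_op :: "nat list \<Rightarrow> nat list \<Rightarrow> (tableau, tableau) opr" where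
  "word_op \<nu> ks = foldr (\<lambda>k A. op_comp (Tab \<nu>) (young_gen \<nu> k) A) ks (op_scalar (Tab \<nu>) 1)"

text \<open>
  The representation is multiplicative with the prescribed values on adjacent transpositions, hence
  its value at \<open>\<sigma>\<close> is the product of generators along any word for \<open>\<sigma>\<close>. The product does not depend
  on the word, since the generators satisfy the Coxeter relations of the symmetric group.
\<close>

definition young_rep :: "nat list \<Rightarrow> (nat \<Rightarrow> nat) \<Rightarrow> (tableau, tableau) opr" where
  "young_rep \<nu> \<sigma> = word_op \<nu> (SOME ks. set ks \<subseteq> {1..<sum_list \<nu>} \<and> word_perm ks = \<sigma>)"


section \<open>Isoclinic partitions\<close>

definition up_set :: "nat list \<Rightarrow> nat list set" where
  "up_set \<mu> = {\<nu>. partition_of (sum_list \<mu> + 1) \<nu> \<and>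
                  (\<exists>x. x \<notin> diagram \<mu> \<and> diagram \<nu> = insert x (diagram \<mu>))}"

definition extend_tab :: "nat list \<Rightarrow> nat list \<Rightarrow> tableau \<Rightarrow> tableau" where
  "extend_tab \<nu> \<mu> R = (\<lambda>x. if x \<in> diagram \<nu> - diagram \<mu> then sum_list \<nu> else R x)"

definition Psi1 :: "nat list \<Rightarrow> nat list \<Rightarrow> (tableau, tableau) opr" where
  "Psi1 \<nu> \<mu> = (\<lambda>S R. if R \<in> Tab \<mu> \<and> S = extend_tab \<nu> \<mu> R then 1 else 0)"

text \<open>The direct sum over \<open>L\<close> has an orthonormal basis indexed by the disjoint union of the
  sets of standard tableaux.\<close>

definition TabL :: "nat list set \<Rightarrow> (nat list \<times> tableau) set" where
  "TabL L = Sigma L Tab"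

definition dimL :: "nat list set \<Rightarrow> nat" where
  "dimL L = (\<Sum>\<nu>\<in>L. card (Tab \<nu>))"

definition repL :: "nat list set \<Rightarrow> (nat \<Rightarrow> nat) \<Rightarrow> (nat list \<times> tableau, nat list \<times> tableau) opr" where
  "repL L \<sigma> = (\<lambda>(\<nu>, S) (\<nu>', T). if \<nu> \<in> L \<and> \<nu> = \<nu>' then young_rep \<nu> \<sigma> S T else 0)"

definition PsiL :: "nat list set \<Rightarrow> nat list \<Rightarrow> (nat list \<times> tableau, tableau) opr" where
  "PsiL L \<mu> = (\<lambda>(\<nu>, S) R.
     if \<nu> \<in> L then sqrt (real (card (Tab \<nu>)) / real (dimL L)) * Psi1 \<nu> \<mu> S R else 0)"

definition subspL :: "nat list set \<Rightarrow> nat list \<Rightarrow> (nat list \<times> tableau \<Rightarrow> real) set" where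
  "subspL L \<mu> = op_image (Tab \<mu>) (PsiL L \<mu>)"

definition orbitL ::
  "nat list set \<Rightarrow> nat list \<Rightarrow> (nat \<Rightarrow> nat \<Rightarrow> nat) \<Rightarrow> nat \<Rightarrow> (nat list \<times> tableau \<Rightarrow> real) set" where
  "orbitL L \<mu> t k = op_apply (TabL L) (repL L (t k)) ` subspL L \<mu>"

definition coset_reps :: "nat \<Rightarrow> (nat \<Rightarrow> nat \<Rightarrow> nat) \<Rightarrow> bool" where
  "coset_reps n t \<longleftrightarrow> (\<forall>k\<in>{1..n}. t k permutes {1..n} \<and> t k n = k)"

text \<open>The orbit of subspaces does not depend on the choice of the permutations \<open>t k\<close>, because
  \<open>subspL L \<mu>\<close> is invariant under the stabilizer of \<open>n\<close>.\<close>

definition isoclinic :: "nat list \<Rightarrow> bool" where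
  "isoclinic \<mu> \<longleftrightarrow>
     (let n = sum_list \<mu> + 1 in
      \<exists>L. L \<noteq> {} \<and> L \<subset> up_set \<mu> \<and>
          (\<forall>t. coset_reps n t \<longrightarrow> equi_isoclinic {1..n} (TabL L) (orbitL L \<mu> t)))"

definition three_step :: "nat \<Rightarrow> nat \<Rightarrow> nat \<Rightarrow> nat \<Rightarrow> nat \<Rightarrow> nat \<Rightarrow> nat list" where
  "three_step a b c e f g = replicate a (e + f + g) @ replicate b (e + f) @ replicate c e"

lemma partition_of_three_step:
  assumes "e > 0"
  shows "partition_of (a * (e + f + g) + b * (e + f) + c * e) (three_step a b c e f g)"
  using assms
  by (auto simp: partition_of_def three_step_def sorted_wrt_append sum_list_replicate
                 sorted_wrt_iff_nth_less nth_append)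

end

theory Submission
  imports "HOL-Computational_Algebra.Polynomial" Defs
begin

text \<open>
  Every permutation moving \<open>n\<close> factors through the last generator up to the stabilizer of \<open>n\<close>, so all
  products \<open>\<Phi>\<^sub>k\<^sup>* \<Phi>\<^sub>l\<close> with \<open>k \<noteq> l\<close> agree, up to orthogonal factors, with one diagonal matrix. Its entry
  at a tableau with \<open>n - 1\<close> in the removable corner \<open>x\<close> of \<open>\<mu>\<close> is proportional to
  \<open>\<Sum>\<^sub>z d\<^sub>\<mu>\<^sub>+\<^sub>z / (c(z) - c(x))\<close>, where \<open>z\<close> ranges over the addable corners given by \<open>L\<close> and \<open>c\<close> is the
  content. Hence \<open>\<mu>\<close> is isoclinic iff, for some \<open>L\<close>, these sums have the same absolute value for all \<open>x\<close>.

  If \<open>L\<close> consists of all addable corners, the sums vanish. This is shown by induction on \<open>\<mu>\<close>, removing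
  one corner at a time, and it determines the dimensions \<open>d\<^sub>\<mu>\<^sub>+\<^sub>z\<close> up to a common factor by a partial
  fraction argument. For a partition with three steps there are four addable and three removable
  corners, whose contents interlace; monotonicity excludes all choices of \<open>L\<close> except the alternating
  ones \<open>{z\<^sub>1, z\<^sub>3}\<close> and \<open>{z\<^sub>2, z\<^sub>4}\<close>, for which the condition amounts to the two equations.
\<close>

section \<open>Young diagrams and their corners\<close>

text \<open>A permutation reaches \<open>young_rep\<close> only through a word picked by
  \<open>SOME\<close>. Hence the detour through words: the orthogonal form is shown to respect the
  Coxeter relations, and these relations alone bring the word of any permutation moving n to the
  required shape. For \<open>L\<close> = \<open>up_set \<mu>\<close> the representation is induced
  from \<mu> and the translates of W are mutually orthogonal, which is what the vanishing of the
  full sums expresses. There is one such equation for each removable corner and one more addable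
  corner than removable ones, so the weights are fixed up to scale. The obstacle in the induction is
  that a removed corner x becomes addable, so the sum for the smaller diagram has a pole at the
  content of x; its finite part comes from the derivative of the numerator. Complementary choices of
  \<open>L\<close> have opposite sums, so the two alternating ones give a single condition. With S1,
  S2, S3 the sums for {z1, z3} at the three removable corners it reads S1 = S3 and S1 = - S2. The
  first means b (c + e) = (a + g) f, and under it the second means c (b + g) = (2 a + b + g) f;
  these are the two formulas of the theorem.\<close>

definition young_diagram :: "(nat \<times> nat) set \<Rightarrow> bool" where
  "young_diagram D \<longleftrightarrow> finite D \<and> (\<forall>i j i' j'. (i, j) \<in> D \<and> i' \<le> i \<and> j' \<le> j \<longrightarrow> (i', j') \<in> D)"

definition addable :: "(nat \<times> nat) set \<Rightarrow> (nat \<times> nat) set" where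
  "addable D = {x. x \<notin> D \<and> young_diagram (insert x D)}"

definition removable :: "(nat \<times> nat) set \<Rightarrow> (nat \<times> nat) set" where
  "removable D = {x \<in> D. young_diagram (D - {x})}"

text \<open>\<open>Tab\<close> over an arbitrary set of boxes, see \<open>Tab_eq_syt\<close>. With
  sets, adding and removing a corner are \<open>insert\<close> and set difference, whereas on lists
  of row lengths the number of rows may change.\<close>

definition syt :: "(nat \<times> nat) set \<Rightarrow> tableau set" where
  "syt D = {T. bij_betw T D {1..card D} \<and> (\<forall>x. x \<notin> D \<longrightarrow> T x = 0) \<and>
               (\<forall>i j j'. j < j' \<and> (i, j') \<in> D \<longrightarrow> T (i, j) < T (i, j')) \<and>
               (\<forall>i i' j. i < i' \<and> (i', j) \<in> D \<longrightarrow> T (i, j) < T (i', j))}"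

definition num_syt :: "(nat \<times> nat) set \<Rightarrow> nat" where
  "num_syt D = card (syt D)"

lemma young_diagramD: "young_diagram D \<Longrightarrow> (i, j) \<in> D \<Longrightarrow> i' \<le> i \<Longrightarrow> j' \<le> j \<Longrightarrow> (i', j') \<in> D"
  unfolding young_diagram_def by blast

lemma young_diagram_finite: "young_diagram D \<Longrightarrow> finite D"
  unfolding young_diagram_def by blast

lemma young_diagram_Un: "young_diagram D \<Longrightarrow> young_diagram E \<Longrightarrow> young_diagram (D \<union> E)"
  unfolding young_diagram_def by blast

lemma young_diagram_Int: "young_diagram D \<Longrightarrow> young_diagram E \<Longrightarrow> young_diagram (D \<inter> E)"
  unfolding young_diagram_def by blast

lemma addable_iff:
  assumes "young_diagram D"
  shows "(i, j) \<in> addable D \<longleftrightarrow>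
    (i, j) \<notin> D \<and> (i = 0 \<or> (i - 1, j) \<in> D) \<and> (j = 0 \<or> (i, j - 1) \<in> D)"
proof
  assume "(i, j) \<in> addable D"
  then have n: "(i, j) \<notin> D" and y: "young_diagram (insert (i, j) D)"
    by (auto simp: addable_def)
  have "(i - 1, j) \<in> insert (i, j) D" "(i, j - 1) \<in> insert (i, j) D"
    using young_diagramD[OF y, of i j "i - 1" j] young_diagramD[OF y, of i j i "j - 1"] by auto
  then show "(i, j) \<notin> D \<and> (i = 0 \<or> (i - 1, j) \<in> D) \<and> (j = 0 \<or> (i, j - 1) \<in> D)"
    using n by auto
next
  assume *: "(i, j) \<notin> D \<and> (i = 0 \<or> (i - 1, j) \<in> D) \<and> (j = 0 \<or> (i, j - 1) \<in> D)"
  have "young_diagram (insert (i, j) D)"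
    unfolding young_diagram_def
  proof (intro conjI allI impI)
    show "finite (insert (i, j) D)" using young_diagram_finite[OF assms] by simp
    fix p q p' q'
    assume h: "(p, q) \<in> insert (i, j) D \<and> p' \<le> p \<and> q' \<le> q"
    consider "(p, q) \<in> D" | "p = i" "q = j" "p' = i" "q' = j"
      | "p = i" "q = j" "p' < i" | "p = i" "q = j" "q' < j"
      using h by fastforce
    then show "(p', q') \<in> insert (i, j) D"
    proof cases
      case 1 then show ?thesis using h young_diagramD[OF assms] by blast
    next
      case 3 then have "(i - 1, j) \<in> D" using * by auto
      moreover have "p' \<le> i - 1" "q' \<le> j" using 3 h by auto
      ultimately show ?thesis using young_diagramD[OF assms] by blast
    next
      case 4 then have "(i, j - 1) \<in> D" using * by auto
      moreover have "p' \<le> i" "q' \<le> j - 1" using 4 h by auto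
      ultimately show ?thesis using young_diagramD[OF assms] by blast
    qed auto
  qed
  then show "(i, j) \<in> addable D" using * by (auto simp: addable_def)
qed

lemma removable_iff:
  assumes "young_diagram D"
  shows "(i, j) \<in> removable D \<longleftrightarrow> (i, j) \<in> D \<and> (Suc i, j) \<notin> D \<and> (i, Suc j) \<notin> D"
proof
  assume "(i, j) \<in> removable D"
  then have n: "(i, j) \<in> D" and y: "young_diagram (D - {(i, j)})"
    by (auto simp: removable_def)
  show "(i, j) \<in> D \<and> (Suc i, j) \<notin> D \<and> (i, Suc j) \<notin> D"
    using n young_diagramD[OF y, of "Suc i" j i j] young_diagramD[OF y, of i "Suc j" i j] by auto
next
  assume *: "(i, j) \<in> D \<and> (Suc i, j) \<notin> D \<and> (i, Suc j) \<notin> D"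
  have "young_diagram (D - {(i, j)})"
    unfolding young_diagram_def
  proof (intro conjI allI impI)
    show "finite (D - {(i, j)})" using young_diagram_finite[OF assms] by simp
    fix p q p' q'
    assume h: "(p, q) \<in> D - {(i, j)} \<and> p' \<le> p \<and> q' \<le> q"
    then have "(p', q') \<in> D" using young_diagramD[OF assms] by blast
    moreover have "(p', q') \<noteq> (i, j)"
    proof
      assume "(p', q') = (i, j)"
      then have "Suc i \<le> p \<and> j \<le> q \<or> i \<le> p \<and> Suc j \<le> q" using h by auto
      then show False using h * young_diagramD[OF assms] by blast
    qed
    ultimately show "(p', q') \<in> D - {(i, j)}" by blast
  qed
  then show "(i, j) \<in> removable D" using * by (auto simp: removable_def)
qed

lemma finite_removable: "young_diagram D \<Longrightarrow> finite (removable D)"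
  by (auto simp: removable_def dest: young_diagram_finite)

lemma finite_addable:
  assumes "young_diagram D"
  shows "finite (addable D)"
proof (rule finite_subset)
  show "addable D \<subseteq> insert (0, 0)
     ((\<lambda>(i, j). (Suc i, j)) ` D \<union> (\<lambda>(i, j). (i, Suc j)) ` D)"
  proof (rule subsetI)
    fix x assume "x \<in> addable D"
    moreover obtain i j where x: "x = (i, j)" by force
    ultimately have h: "(i, j) \<in> addable D" by simp
    show "x \<in> insert (0, 0) ((\<lambda>(i, j). (Suc i, j)) ` D \<union> (\<lambda>(i, j). (i, Suc j)) ` D)"
    proof (cases i)
      case (Suc p)
      then have "(p, j) \<in> D" using h addable_iff[OF assms, of i j] by auto
      then show ?thesis using Suc x by force
    next
      case 0
      show ?thesis
      proof (cases j)
        case (Suc q)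
        then have "(i, q) \<in> D" using h addable_iff[OF assms, of i j] by auto
        then show ?thesis using Suc x by force
      qed (simp add: 0 x)
    qed
  qed
  show "finite (insert (0, 0) ((\<lambda>(i, j). (Suc i, j)) ` D \<union> (\<lambda>(i, j). (i, Suc j)) ` D))"
    using young_diagram_finite[OF assms] by simp
qed

lemma young_diagram_removable: "x \<in> removable D \<Longrightarrow> young_diagram (D - {x})"
  by (auto simp: removable_def)

lemma young_diagram_addable: "x \<in> addable D \<Longrightarrow> young_diagram (insert x D)"
  by (auto simp: addable_def)

lemma addable_Diff_removable:
  assumes "young_diagram D" "x \<in> removable D"
  shows "x \<in> addable (D - {x})"
  using assms by (auto simp: addable_def removable_def insert_absorb)

text \<open>Of two corners on one diagonal, the upper left one lies in \<open>D\<close> together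
  with its right neighbour, so it is neither addable nor removable. This keeps the denominators of
  the corner sums nonzero.\<close>

lemma inj_on_content_corners:
  assumes D: "young_diagram D"
  shows "inj_on content (addable D \<union> removable D)"
proof -
  have below: "(i, j) \<in> D" if "(p, q) \<in> addable D \<union> removable D" "i \<le> p" "j \<le> q" "(i, j) \<noteq> (p, q)"
    for i j p q
    using that young_diagramD[OF D, of p q i j]
      young_diagramD[OF young_diagram_addable, of "(p, q)" D p q i j]
    by (auto simp: removable_def)
  have key: False if h: "(i, j) \<in> addable D \<union> removable D"
      "(p, q) \<in> addable D \<union> removable D" "i < p" "content (i, j) = content (p, q)" for i j p q
  proof -
    have "j < q" using h by (auto simp: content_def)
    then have "(i, j) \<in> D" "(i, Suc j) \<in> D" using h below[OF h(2)] by auto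
    then show False using h(1) removable_iff[OF D] by (auto simp: addable_def)
  qed
  show ?thesis
  proof (rule inj_onI, clarify)
    fix i j p q
    assume h: "(i, j) \<in> addable D \<union> removable D" "(p, q) \<in> addable D \<union> removable D"
      "content (i, j) = content (p, q)"
    have "i = p" using key[OF h(1,2)] key[OF h(2,1)] h(3) by (metis linorder_neqE_nat)
    then show "i = p \<and> j = q" using h(3) by (auto simp: content_def)
  qed
qed

lemma addable_removable_disjoint: "addable D \<inter> removable D = {}"
  by (auto simp: addable_def removable_def)

text \<open>Removing x turns it from removable to addable, which accounts for twice
  \<open>h (content x)\<close>. The boxes to the right of x and above x share the content
  \<open>content x + 1\<close>: either the former is addable in \<open>D\<close> or the latter is
  removable in \<open>E\<close>, never both, and either way the difference changes by the value of
  \<open>h\<close> there. The boxes below x and to its left behave alike. The result is a discrete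
  second derivative of \<open>h\<close>.\<close>

lemma corner_sum_remove:
  fixes h :: "int \<Rightarrow> real"
  assumes D: "young_diagram D" and x: "x \<in> removable D"
  defines "E \<equiv> D - {x}"
  shows "(\<Sum>z\<in>addable D. h (content z)) - (\<Sum>y\<in>removable D. h (content y)) =
    (\<Sum>z\<in>addable E. h (content z)) - (\<Sum>y\<in>removable E. h (content y))
     - 2 * h (content x) + h (content x + 1) + h (content x - 1)"
proof -
  obtain i j where xij: "x = (i, j)" by force
  have E: "young_diagram E" using x by (simp add: E_def young_diagram_removable)
  have xD: "(i, j) \<in> D" "(Suc i, j) \<notin> D" "(i, Suc j) \<notin> D"
    using x removable_iff[OF D] xij by auto
  let ?r = "(i, Suc j)" and ?b = "(Suc i, j)"
  have aD: "addable D - {?r, ?b} = addable E - {x}"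
  proof (rule set_eqI)
    fix y :: "nat \<times> nat"
    obtain p q where y: "y = (p, q)" by force
    show "y \<in> addable D - {?r, ?b} \<longleftrightarrow> y \<in> addable E - {x}"
      unfolding y using addable_iff[OF E, of p q] addable_iff[OF D, of p q] xD
      by (auto simp: E_def xij)
  qed
  let ?U = "if i > 0 then {(i - 1, j)} else {}" and ?L = "if j > 0 then {(i, j - 1)} else {}"
  have rE: "removable E - (?U \<union> ?L) = removable D - {x}"
  proof (rule set_eqI)
    fix y :: "nat \<times> nat"
    obtain p q where y: "y = (p, q)" by force
    show "y \<in> removable E - (?U \<union> ?L) \<longleftrightarrow> y \<in> removable D - {x}"
      unfolding y using removable_iff[OF E, of p q] removable_iff[OF D, of p q] xD
      by (cases i; cases j) (auto simp: E_def xij intro!: gr0I)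
  qed
  have finA: "finite (addable D)" "finite (addable E)" "finite (removable D)" "finite (removable E)"
    using D E finite_addable finite_removable by auto
  have i1: "?r \<in> addable D \<longleftrightarrow> \<not> (i > 0 \<and> (i - 1, j) \<in> removable E)"
    unfolding addable_iff[OF D] removable_iff[OF E] using xD young_diagramD[OF D xD(1)]
    by (auto simp: E_def xij)
  have i2: "?b \<in> addable D \<longleftrightarrow> \<not> (j > 0 \<and> (i, j - 1) \<in> removable E)"
    unfolding addable_iff[OF D] removable_iff[OF E] using xD young_diagramD[OF D xD(1)]
    by (auto simp: E_def xij)
  let ?H = "\<lambda>S. \<Sum>z\<in>S. h (content z)"
  have "?H (addable D) = ?H (addable D - {?r, ?b}) + ?H (addable D \<inter> {?r, ?b})"
    using sum.Int_Diff[OF finA(1), of "\<lambda>z. h (content z)" "{?r, ?b}"] by simp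
  also have "?H (addable D \<inter> {?r, ?b}) =
    (if ?r \<in> addable D then h (content x + 1) else 0) + (if ?b \<in> addable D then h (content x - 1) else 0)"
    by (auto simp: xij content_def Int_insert_right algebra_simps)
  finally have 1: "?H (addable D) = ?H (addable E - {x}) +
    (if ?r \<in> addable D then h (content x + 1) else 0) + (if ?b \<in> addable D then h (content x - 1) else 0)"
    using aD by simp
  have "?H (removable E) = ?H (removable E - (?U \<union> ?L)) + ?H (removable E \<inter> (?U \<union> ?L))"
    using sum.Int_Diff[OF finA(4), of "\<lambda>z. h (content z)" "?U \<union> ?L"] by simp
  also have "?H (removable E \<inter> (?U \<union> ?L)) =
    (if i > 0 \<and> (i - 1, j) \<in> removable E then h (content x + 1) else 0)
    + (if j > 0 \<and> (i, j - 1) \<in> removable E then h (content x - 1) else 0)"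
    by (auto simp: xij content_def Int_insert_right algebra_simps of_nat_diff)
  finally have 2: "?H (removable E) = ?H (removable D - {x}) +
    (if i > 0 \<and> (i - 1, j) \<in> removable E then h (content x + 1) else 0)
    + (if j > 0 \<and> (i, j - 1) \<in> removable E then h (content x - 1) else 0)"
    using rE by simp
  have 3: "?H (addable E) = ?H (addable E - {x}) + h (content x)"
    using addable_Diff_removable[OF D x] finA by (subst sum.remove[of _ x]) (auto simp: E_def)
  have 4: "?H (removable D) = ?H (removable D - {x}) + h (content x)"
    using x finA by (subst sum.remove[of _ x]) auto
  show ?thesis using 1 2 3 4 i1 i2 by auto
qed

lemma ex_removable:
  assumes D: "young_diagram D" and ne: "D \<noteq> {}"
  shows "removable D \<noteq> {}"
proof -
  have fin: "finite D" by (rule young_diagram_finite[OF D])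
  obtain m where m: "m \<in> D" "\<forall>y\<in>D. fst y + snd y \<le> fst m + snd m"
    using Max_in[of "(\<lambda>y. fst y + snd y) ` D"] Max_ge[of "(\<lambda>y. fst y + snd y) ` D"] fin ne by fastforce
  have "(fst m, snd m) \<in> removable D"
    unfolding removable_iff[OF D] using m by force
  then show ?thesis by blast
qed

text \<open>The hypothesis covers all removable corners at once, as the sum over corners in the
  recursion for \<open>num_syt\<close> requires.\<close>

lemma young_diagram_induct [consumes 1, case_names empty remove]:
  assumes "young_diagram D" and "P {}"
    and "\<And>D. young_diagram D \<Longrightarrow> D \<noteq> {} \<Longrightarrow> (\<And>x. x \<in> removable D \<Longrightarrow> P (D - {x})) \<Longrightarrow> P D"
  shows "P D"
  using assms(1)
proof (induction "card D" arbitrary: D)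
  case 0
  then show ?case using assms(2) by (simp add: young_diagram_finite)
next
  case (Suc n)
  have "P (D - {x})" if "x \<in> removable D" for x
    using Suc(1)[of "D - {x}"] Suc(2) that young_diagram_removable[OF that]
    by (simp add: removable_def)
  then show ?case using assms(3)[OF Suc(3)] Suc(2) by fastforce
qed

lemma addable_empty: "addable {} = {(0, 0)}"
proof -
  have y: "young_diagram {}" by (simp add: young_diagram_def)
  show ?thesis using addable_iff[OF y] by auto
qed

text \<open>For constant \<open>h\<close> the second difference in \<open>corner_sum_remove\<close>
  is zero, so the difference of the two counts keeps the value 1 that it has for the empty
  diagram.\<close>

lemma card_addable:
  assumes "young_diagram D"
  shows "card (addable D) = Suc (card (removable D))"
  using assms
proof (induction rule: young_diagram_induct)
  case empty
  then show ?case by (simp add: addable_empty removable_def)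
next
  case (remove D)
  obtain x where x: "x \<in> removable D" using ex_removable remove by blast
  have "real (card (addable D)) - real (card (removable D)) =
        real (card (addable (D - {x}))) - real (card (removable (D - {x})))"
    using corner_sum_remove[OF remove(1) x, of "\<lambda>_. 1"] by simp
  then show ?case using remove(3)[OF x] by simp
qed

section \<open>Counting standard tableaux\<close>

text \<open>The polynomial on the left is the numerator, over the common denominator, of the
  rational function with poles \<open>u z\<close> and residues \<open>w z\<close>. It has degree at
  most \<open>card R\<close> and vanishes at the \<open>card R\<close> distinct points
  \<open>u r\<close>, hence is a multiple of the monic polynomial with these roots.\<close>

lemma cauchy_kernel_numerator:
  fixes u w :: "'i \<Rightarrow> real"
  assumes fin: "finite A" "finite R" and card: "card A = Suc (card R)"
    and inj: "inj_on u (A \<union> R)" and disj: "A \<inter> R = {}"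
    and eq: "\<And>r. r \<in> R \<Longrightarrow> (\<Sum>z\<in>A. w z / (u z - u r)) = 0"
  obtains C where
    "(\<Sum>z\<in>A. smult (w z) (\<Prod>y\<in>A - {z}. [:- u y, 1:])) = smult C (\<Prod>r\<in>R. [:- u r, 1:])"
proof -
  let ?N = "\<Sum>z\<in>A. smult (w z) (\<Prod>y\<in>A - {z}. [:- u y, 1:])"
  let ?P = "\<Prod>r\<in>R. [:- u r, 1:]"
  have degprod: "degree (\<Prod>y\<in>B. [:- u y, 1:]) = card B" if "finite B" for B :: "'i set"
    using degree_linear_power by (subst degree_prod_eq_sum_degree) auto
  have leadP: "coeff ?P (card R) = 1"
    using lead_coeff_prod[of "\<lambda>r. [:- u r, 1:]" R] degprod[OF fin(2)] by simp
  have degN: "degree ?N \<le> card R"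
  proof (rule degree_sum_le[OF fin(1)])
    fix z assume "z \<in> A"
    then show "degree (smult (w z) (\<Prod>y\<in>A - {z}. [:- u y, 1:])) \<le> card R"
      using degprod[of "A - {z}"] fin card by (intro order.trans[OF degree_smult_le]) simp
  qed
  \<comment> \<open>With this \<open>C\<close> the coefficients of degree \<open>card R\<close>
    cancel in \<open>q\<close>, so a nonzero \<open>q\<close> would have more roots than its degree
    allows.\<close>
  define C where "C = coeff ?N (card R)"
  define q where "q = ?N - smult C ?P"
  have "q = 0"
  proof (rule ccontr)
    assume q0: "q \<noteq> 0"
    have "degree q \<le> card R" unfolding q_def
      using degN degprod[OF fin(2)] by (intro degree_diff_le order.trans[OF degree_smult_le]) auto
    moreover have "coeff q (card R) = 0" unfolding q_def by (simp add: leadP C_def)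
    ultimately have dq: "degree q < card R" using q0
      by (metis leading_coeff_0_iff nless_le)
    have "poly q (u r) = 0" if r: "r \<in> R" for r
    proof -
      have ne: "u y \<noteq> u r" if "y \<in> A" for y
        using inj_onD[OF inj, of y r] that r disj by auto
      have "poly ?N (u r) = (\<Sum>z\<in>A. w z * (\<Prod>y\<in>A - {z}. u r - u y))"
        by (simp add: poly_sum poly_prod)
      also have "\<dots> = (\<Sum>z\<in>A. - (\<Prod>y\<in>A. u r - u y) * (w z / (u z - u r)))"
      proof (rule sum.cong[OF refl])
        fix z assume z: "z \<in> A"
        have *: "(\<Prod>y\<in>A. u r - u y) = (u r - u z) * (\<Prod>y\<in>A - {z}. u r - u y)"
          using z fin by (simp add: prod.remove)
        show "w z * (\<Prod>y\<in>A - {z}. u r - u y) = - (\<Prod>y\<in>A. u r - u y) * (w z / (u z - u r))"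
          unfolding * using ne[OF z] by (simp add: divide_simps) (simp add: algebra_simps)
      qed
      also have "\<dots> = - (\<Prod>y\<in>A. u r - u y) * (\<Sum>z\<in>A. w z / (u z - u r))"
        by (rule sum_distrib_left[symmetric])
      also have "\<dots> = 0" using eq[OF r] by simp
      finally have "poly ?N (u r) = 0" .
      moreover have "poly ?P (u r) = 0" using r fin by (auto simp: poly_prod)
      ultimately show ?thesis by (simp add: q_def)
    qed
    then have "u ` R \<subseteq> {x. poly q x = 0}" by auto
    then have "card (u ` R) \<le> degree q"
      using card_poly_roots_bound[OF q0] poly_roots_finite[OF q0] card_mono order.trans by blast
    moreover have "card (u ` R) = card R" by (rule card_image) (rule inj_on_subset[OF inj], simp)
    ultimately show False using dq by simp
  qed
  then show ?thesis using that[of C] by (simp add: q_def)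
qed

lemma cauchy_kernel_numerator_at:
  fixes u w :: "'i \<Rightarrow> real"
  assumes fin: "finite A" and x: "x \<in> A"
  shows "poly (\<Sum>z\<in>A. smult (w z) (\<Prod>y\<in>A - {z}. [:- u y, 1:])) (u x)
     = w x * (\<Prod>y\<in>A - {x}. u x - u y)"
proof -
  have "poly (\<Sum>z\<in>A. smult (w z) (\<Prod>y\<in>A - {z}. [:- u y, 1:])) (u x)
      = (\<Sum>z\<in>A. w z * (\<Prod>y\<in>A - {z}. u x - u y))"
    by (simp add: poly_prod poly_sum)
  also have "\<dots> = w x * (\<Prod>y\<in>A - {x}. u x - u y) + (\<Sum>z\<in>A - {x}. w z * (\<Prod>y\<in>A - {z}. u x - u y))"
    using x fin by (simp add: sum.remove)
  also have "(\<Sum>z\<in>A - {x}. w z * (\<Prod>y\<in>A - {z}. u x - u y)) = 0"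
    using x fin by (intro sum.neutral ballI) auto
  finally show ?thesis by simp
qed

text \<open>Evaluating both forms of the numerator at a pole isolates one weight. For dimensions as
  weights this is the product formula for the transition probabilities of Young diagrams, up to the
  factor \<open>C\<close>.\<close>

lemma cauchy_weights:
  fixes u w :: "'i \<Rightarrow> real"
  assumes fin: "finite A" "finite R" and card: "card A = Suc (card R)"
    and inj: "inj_on u (A \<union> R)" and disj: "A \<inter> R = {}"
    and eq: "\<And>r. r \<in> R \<Longrightarrow> (\<Sum>z\<in>A. w z / (u z - u r)) = 0"
  obtains C where
    "\<And>x. x \<in> A \<Longrightarrow> w x * (\<Prod>y\<in>A - {x}. u x - u y) = C * (\<Prod>r\<in>R. u x - u r)"
proof -
  obtain C where C: "(\<Sum>z\<in>A. smult (w z) (\<Prod>y\<in>A - {z}. [:- u y, 1:])) = smult C (\<Prod>r\<in>R. [:- u r, 1:])"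
    using cauchy_kernel_numerator[OF assms] by blast
  show ?thesis
  proof (rule that)
    fix x assume x: "x \<in> A"
    have "C * (\<Prod>r\<in>R. u x - u r) = poly (smult C (\<Prod>r\<in>R. [:- u r, 1:])) (u x)"
      by (simp add: poly_prod)
    then show "w x * (\<Prod>y\<in>A - {x}. u x - u y) = C * (\<Prod>r\<in>R. u x - u r)"
      using cauchy_kernel_numerator_at[OF fin(1) x, of w u] by (simp only: C)
  qed
qed

lemma pderiv_sum: "pderiv (\<Sum>i\<in>A. p i) = (\<Sum>i\<in>A. pderiv (p i))"
  using higher_pderiv_sum[of 1 p A] by simp

lemma prod_diff_sum:
  fixes u :: "'i \<Rightarrow> real"
  assumes "finite B" "\<And>y. y \<in> B \<Longrightarrow> t \<noteq> u y"
  shows "(\<Sum>y\<in>B. \<Prod>z\<in>B - {y}. t - u z) = (\<Prod>y\<in>B. t - u y) * (\<Sum>y\<in>B. 1 / (t - u y))"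
  unfolding sum_distrib_left
proof (rule sum.cong[OF refl])
  fix y assume y: "y \<in> B"
  have "(\<Prod>y\<in>B. t - u y) = (t - u y) * (\<Prod>z\<in>B - {y}. t - u z)"
    using y assms by (simp add: prod.remove)
  then show "(\<Prod>z\<in>B - {y}. t - u z) = (\<Prod>y\<in>B. t - u y) * (1 / (t - u y))"
    using assms(2)[OF y] by simp
qed

text \<open>Compares the constant terms at the pole \<open>u x\<close> of the two expressions for the rational function
  \<open>\<Sum>z. w z / (t - u z)\<close>. The terms for \<open>z = x\<close> vanish, since division by zero yields zero.\<close>

lemma cauchy_finite_part:
  fixes u w :: "'i \<Rightarrow> real"
  assumes fin: "finite A" "finite R" and card: "card A = Suc (card R)"
    and inj: "inj_on u (A \<union> R)" and disj: "A \<inter> R = {}"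
    and eq: "\<And>r. r \<in> R \<Longrightarrow> (\<Sum>z\<in>A. w z / (u z - u r)) = 0"
    and x: "x \<in> A"
  shows "(\<Sum>z\<in>A. w z / (u z - u x)) =
     w x * ((\<Sum>r\<in>R. 1 / (u r - u x)) - (\<Sum>z\<in>A. 1 / (u z - u x)))"
proof -
  obtain C where C: "(\<Sum>z\<in>A. smult (w z) (\<Prod>y\<in>A - {z}. [:- u y, 1:])) = smult C (\<Prod>r\<in>R. [:- u r, 1:])"
    using cauchy_kernel_numerator[OF fin card inj disj eq] by blast
  have neR: "u x \<noteq> u r" if "r \<in> R" for r
    using inj_onD[OF inj, of x r] that x disj by auto
  have neA: "u x \<noteq> u z" if "z \<in> A - {x}" for z
    using inj_onD[OF inj, of x z] that x by auto
  let ?Q = "\<Prod>y\<in>A - {x}. u x - u y"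
  have Q0: "?Q \<noteq> 0" using fin neA by simp
  have pd: "poly (pderiv (\<Prod>y\<in>B. [:- u y, 1:])) t = (\<Sum>y\<in>B. \<Prod>z\<in>B - {y}. t - u z)" for B t
    by (simp add: pderiv_prod poly_sum poly_prod pderiv_pCons)
  have val: "C * (\<Prod>r\<in>R. u x - u r) = w x * ?Q"
    using cauchy_kernel_numerator_at[OF fin(1) x, of w u] by (simp add: C poly_prod)
  \<comment> \<open>The derivative of the numerator at the pole is computed from both of its forms;
    the constant term of the expansion there depends on it.\<close>
  have "C * (\<Sum>r\<in>R. \<Prod>z\<in>R - {r}. u x - u z)
      = poly (pderiv (smult C (\<Prod>r\<in>R. [:- u r, 1:]))) (u x)"
    by (simp add: pd pderiv_smult)
  also have "\<dots> = (\<Sum>z\<in>A. w z * (\<Sum>y\<in>A - {z}. \<Prod>v\<in>A - {z} - {y}. u x - u v))"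
    unfolding C[symmetric] by (simp add: pderiv_sum poly_sum pderiv_smult pd)
  also have "\<dots> = w x * (\<Sum>y\<in>A - {x}. \<Prod>v\<in>A - {x} - {y}. u x - u v)
      + (\<Sum>z\<in>A - {x}. w z * (\<Sum>y\<in>A - {z}. \<Prod>v\<in>A - {z} - {y}. u x - u v))"
    using x fin by (simp add: sum.remove)
  also have "(\<Sum>z\<in>A - {x}. w z * (\<Sum>y\<in>A - {z}. \<Prod>v\<in>A - {z} - {y}. u x - u v))
      = ?Q * (\<Sum>z\<in>A - {x}. w z / (u x - u z))"
    unfolding sum_distrib_left[of ?Q]
  proof (rule sum.cong[OF refl])
    fix z assume z: "z \<in> A - {x}"
    have "(\<Sum>y\<in>A - {z}. \<Prod>v\<in>A - {z} - {y}. u x - u v)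
       = (\<Prod>v\<in>A - {z} - {x}. u x - u v) + (\<Sum>y\<in>A - {z} - {x}. \<Prod>v\<in>A - {z} - {y}. u x - u v)"
      using x z fin by (intro sum.remove) auto
    \<comment> \<open>For y other than x the product keeps the factor at v = x, which is
      zero.\<close>
    also have "(\<Sum>y\<in>A - {z} - {x}. \<Prod>v\<in>A - {z} - {y}. u x - u v) = 0"
      using x z fin by (intro sum.neutral ballI) auto
    also have "(\<Prod>v\<in>A - {z} - {x}. u x - u v) = (\<Prod>v\<in>A - {x} - {z}. u x - u v)"
      by (simp add: Diff_insert2[symmetric] insert_commute)
    also have "\<dots> = ?Q / (u x - u z)"
      using z fin neA[OF z] prod.remove[of "A - {x}" z "\<lambda>v. u x - u v"] by simp
    finally show "w z * (\<Sum>y\<in>A - {z}. \<Prod>v\<in>A - {z} - {y}. u x - u v) = ?Q * (w z / (u x - u z))"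
      by simp
  qed
  also have "(\<Sum>y\<in>A - {x}. \<Prod>v\<in>A - {x} - {y}. u x - u v) = ?Q * (\<Sum>y\<in>A - {x}. 1 / (u x - u y))"
    using fin neA by (intro prod_diff_sum) auto
  also have "(\<Sum>r\<in>R. \<Prod>z\<in>R - {r}. u x - u z) = (\<Prod>r\<in>R. u x - u r) * (\<Sum>r\<in>R. 1 / (u x - u r))"
    using fin neR by (intro prod_diff_sum) auto
  finally have deriv: "C * ((\<Prod>r\<in>R. u x - u r) * (\<Sum>r\<in>R. 1 / (u x - u r))) =
    w x * (?Q * (\<Sum>y\<in>A - {x}. 1 / (u x - u y))) + ?Q * (\<Sum>z\<in>A - {x}. w z / (u x - u z))" .
  \<comment> \<open>\<open>val\<close> trades the product over \<open>R\<close> for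
    \<open>w x\<close> times \<open>?Q\<close>, after which the nonzero \<open>?Q\<close> is
    cancelled.\<close>
  have cancel: "v * s = v * t + r" if "k * (p * s) = v * (q * t) + q * r" "k * p = v * q" "q \<noteq> 0"
    for v s t r k p q :: real
  proof -
    have "q * (v * s) = q * (v * t + r)" using that(1,2) by algebra
    then show ?thesis using that(3) by simp
  qed
  have main: "w x * (\<Sum>r\<in>R. 1 / (u x - u r)) =
     w x * (\<Sum>y\<in>A - {x}. 1 / (u x - u y)) + (\<Sum>z\<in>A - {x}. w z / (u x - u z))"
    by (rule cancel[OF deriv val Q0])
  have neg: "(\<Sum>i\<in>B. v i / (u i - u x)) = - (\<Sum>i\<in>B. v i / (u x - u i))" for v and B :: "'i set"
    unfolding sum_negf[symmetric]
    by (rule sum.cong) (auto simp: minus_divide_right)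
  have rem: "(\<Sum>i\<in>A. v i / (u x - u i)) = (\<Sum>i\<in>A - {x}. v i / (u x - u i))" for v
    using x fin by (simp add: sum.remove)
  show ?thesis
    unfolding neg rem using main by (simp add: algebra_simps)
qed

section \<open>Standard tableaux of a diagram and the branching recursion for their number\<close>

lemma finite_syt:
  assumes "finite D"
  shows "finite (syt D)"
proof (rule finite_subset)
  show "syt D \<subseteq> {T. \<forall>x. (x \<in> D \<longrightarrow> T x \<in> {1..card D}) \<and> (x \<notin> D \<longrightarrow> T x = 0)}"
    by (auto simp: syt_def bij_betw_def)
  show "finite {T. \<forall>x. (x \<in> D \<longrightarrow> T x \<in> {1..card D}) \<and> (x \<notin> D \<longrightarrow> T x = (0::nat))}"
    using assms by (intro finite_set_of_finite_funs) auto
qed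

lemma syt_zero: "T \<in> syt D \<Longrightarrow> x \<notin> D \<Longrightarrow> T x = 0"
  unfolding syt_def by blast

lemma syt_inj: "T \<in> syt D \<Longrightarrow> inj_on T D"
  by (simp add: syt_def bij_betw_def)

lemma syt_mono:
  assumes D: "young_diagram D" and T: "T \<in> syt D" and h: "(p, q) \<in> D" "i \<le> p" "j \<le> q" "(i, j) \<noteq> (p, q)"
  shows "T (i, j) < T (p, q)"
proof -
  have r: "T (i, j) < T (i, q)" if "j < q"
    using T that young_diagramD[OF D h(1) h(2) order_refl] by (auto simp: syt_def)
  have c: "T (i, q) < T (p, q)" if "i < p"
    using T that h by (auto simp: syt_def)
  show ?thesis using r c h by (metis le_neq_implies_less order.strict_trans)
qed

lemma syt_extend:
  assumes x: "x \<in> addable D" and D: "young_diagram D" and R: "R \<in> syt D"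
  shows "R(x := Suc (card D)) \<in> syt (insert x D)"
proof -
  have xD: "x \<notin> D" "finite D" using x D by (auto simp: addable_def young_diagram_finite)
  have bij: "bij_betw R D {1..card D}" and z: "\<And>y. y \<notin> D \<Longrightarrow> R y = 0" using R by (auto simp: syt_def)
  have le: "R y \<le> card D" for y using bij z[of y] by (cases "y \<in> D") (auto simp: bij_betw_def)
  have "bij_betw (R(x := Suc (card D))) D {1..card D}"
    using bij xD by (subst bij_betw_cong[of D _ R]) auto
  then have b: "bij_betw (R(x := Suc (card D))) (insert x D) {1..Suc (card D)}"
    using bij_betw_combine[of "R(x := Suc (card D))" D "{1..card D}" "{x}" "{Suc (card D)}"]
    by (auto simp: atLeastAtMostSuc_conv)
  have ins: "young_diagram (insert x D)" using x by (rule young_diagram_addable)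
  have order: "(R(x := Suc (card D))) (i, j) < (R(x := Suc (card D))) (p, q)"
    if "(p, q) \<in> insert x D" "i \<le> p" "j \<le> q" "(i, j) \<noteq> (p, q)" for i j p q
  proof (cases "(p, q) = x")
    case True
    then show ?thesis using that le[of "(i, j)"] by auto
  next
    case False
    then have pq: "(p, q) \<in> D" using that by auto
    then have "(i, j) \<in> D" using young_diagramD[OF D] that by blast
    then show ?thesis using False syt_mono[OF D R pq that(2-)] xD by auto
  qed
  show ?thesis
    unfolding syt_def using b xD z order by auto
qed

lemma syt_remove:
  assumes D: "young_diagram D" and T: "T \<in> syt D" and x: "x \<in> D" "T x = card D"
  shows "x \<in> removable D" "T(x := 0) \<in> syt (D - {x})"
proof -
  have bij: "bij_betw T D {1..card D}" and z: "\<And>y. y \<notin> D \<Longrightarrow> T y = 0" using T by (auto simp: syt_def)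
  have fin: "finite D" by (rule young_diagram_finite[OF D])
  have le: "T y \<le> card D" for y using bij z[of y] by (cases "y \<in> D") (auto simp: bij_betw_def)
  obtain i j where xij: "x = (i, j)" by force
  show rx: "x \<in> removable D"
    unfolding xij removable_iff[OF D]
    using x syt_mono[OF D T, of "Suc i" j i j] syt_mono[OF D T, of i "Suc j" i j]
      le[of "(Suc i, j)"] le[of "(i, Suc j)"]
    by (auto simp: xij)
  have c: "card (D - {x}) = card D - 1" using x fin by simp
  have pos: "card D > 0" using x fin by (auto simp: card_gt_0_iff)
  have "bij_betw T (D - {x}) ({1..card D} - {T x})"
    using bij x by (auto simp: bij_betw_def inj_on_def)
  also have "{1..card D} - {T x} = {1..card (D - {x})}" using x c pos by auto
  finally have "bij_betw (T(x := 0)) (D - {x}) {1..card (D - {x})}"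
    by (subst bij_betw_cong[of _ _ T]) auto
  moreover have "(T(x := 0)) (i, j) < (T(x := 0)) (p, q)"
    if h: "(p, q) \<in> D - {x}" "i \<le> p" "j \<le> q" "(i, j) \<noteq> (p, q)" for i j p q
    using young_diagramD[OF young_diagram_removable[OF rx] h(1-3)] h syt_mono[OF D T, of p q i j] by auto
  ultimately show "T(x := 0) \<in> syt (D - {x})"
    unfolding syt_def using z by auto
qed

text \<open>The largest entry sits in a removable corner, and erasing it is a bijection onto the
  tableaux of the smaller diagram.\<close>

lemma num_syt_recurrence:
  assumes D: "young_diagram D" and ne: "D \<noteq> {}"
  shows "num_syt D = (\<Sum>x\<in>removable D. num_syt (D - {x}))"
proof -
  have fin: "finite D" by (rule young_diagram_finite[OF D])
  have pos: "card D > 0" using ne fin by (simp add: card_gt_0_iff)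
  define ext where "ext x R = R(x := card D)" for x :: "nat \<times> nat" and R :: tableau
  have c: "Suc (card (D - {x})) = card D" if "x \<in> removable D" for x
    using that fin pos by (simp add: removable_def)
  have sub: "ext x ` syt (D - {x}) \<subseteq> {T \<in> syt D. T x = card D}" if x: "x \<in> removable D" for x
    using syt_extend[OF addable_Diff_removable[OF D x] young_diagram_removable[OF x]] c[OF x] x
    by (auto simp: ext_def removable_def insert_absorb)
  have img: "ext x ` syt (D - {x}) = {T \<in> syt D. T x = card D}" if x: "x \<in> removable D" for x
  proof
    show "{T \<in> syt D. T x = card D} \<subseteq> ext x ` syt (D - {x})"
    proof safe
      fix T assume T: "T \<in> syt D" "T x = card D"
      then have "T(x := 0) \<in> syt (D - {x})" using syt_remove[OF D] x by (auto simp: removable_def)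
      moreover have "T = ext x (T(x := 0))" using T by (auto simp: ext_def)
      ultimately show "T \<in> ext x ` syt (D - {x})" by blast
    qed
  qed (rule sub[OF x])
  have inj: "inj_on (ext x) (syt (D - {x}))" for x
  proof (rule inj_onI)
    fix R R' assume h: "R \<in> syt (D - {x})" "R' \<in> syt (D - {x})" "ext x R = ext x R'"
    then have "R x = 0" "R' x = 0" using syt_zero by blast+
    then show "R = R'" using h(3) by (metis ext_def fun_upd_triv fun_upd_upd)
  qed
  have "syt D = (\<Union>x\<in>removable D. {T \<in> syt D. T x = card D})"
  proof safe
    fix T assume T: "T \<in> syt D"
    then have "card D \<in> T ` D" using pos by (auto simp: syt_def bij_betw_def)
    then obtain x where "x \<in> D" "T x = card D" by auto
    then show "T \<in> (\<Union>x\<in>removable D. {T \<in> syt D. T x = card D})"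
      using syt_remove(1)[OF D T] T by blast
  qed
  then have "num_syt D = card (\<Union>x\<in>removable D. {T \<in> syt D. T x = card D})"
    unfolding num_syt_def by (rule arg_cong)
  also have "\<dots> = (\<Sum>x\<in>removable D. card {T \<in> syt D. T x = card D})"
  proof (rule card_UN_disjoint)
    show "\<forall>x\<in>removable D. \<forall>y\<in>removable D. x \<noteq> y \<longrightarrow>
      {T \<in> syt D. T x = card D} \<inter> {T \<in> syt D. T y = card D} = {}"
    proof (intro ballI impI equals0I)
      fix x y T assume "x \<in> removable D" "y \<in> removable D" "x \<noteq> y"
        "T \<in> {T \<in> syt D. T x = card D} \<inter> {T \<in> syt D. T y = card D}"
      then show False using inj_onD[OF syt_inj, of T D x y] by (simp add: removable_def)
    qed
  next
    show "\<forall>x\<in>removable D. finite {T \<in> syt D. T x = card D}"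
      using finite_syt[OF fin] by simp
  qed (rule finite_removable[OF D])
  also have "\<dots> = (\<Sum>x\<in>removable D. num_syt (D - {x}))"
  proof (rule sum.cong[OF refl])
    fix x assume "x \<in> removable D"
    then show "card {T \<in> syt D. T x = card D} = num_syt (D - {x})"
      using card_image[OF inj, of x] img[of x] by (simp add: num_syt_def)
  qed
  finally show ?thesis .
qed

lemma num_syt_pos: "young_diagram D \<Longrightarrow> num_syt D > 0"
proof (induction rule: young_diagram_induct)
  case empty
  have "(\<lambda>_. 0) \<in> syt {}" by (simp add: syt_def bij_betw_def)
  then show ?case using finite_syt[of "{}"] by (auto simp: num_syt_def card_gt_0_iff)
next
  case (remove D)
  then show ?case
    unfolding num_syt_recurrence[OF remove(1,2)]
    using ex_removable[OF remove(1,2)] finite_removable[OF remove(1)]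
    by (intro sum_pos) auto
qed

text \<open>In the square formed by \<open>D - {y}\<close>, \<open>D\<close>,
  \<open>insert z (D - {y})\<close> and \<open>insert z D\<close>, the first is the intersection and
  the last the union of the other two, and diagrams are closed under both operations. Excluding y =
  z leaves out the pairs that lead straight back to \<open>D\<close>.\<close>

lemma add_remove_commute:
  assumes D: "young_diagram D"
  shows "z \<in> addable D \<and> y \<in> removable (insert z D) - {z} \<longleftrightarrow>
         y \<in> removable D \<and> z \<in> addable (D - {y}) - {y}"
proof safe
  assume h: "z \<in> addable D" "y \<in> removable (insert z D)" "y \<noteq> z"
  have e: "D - {y} = (insert z D - {y}) \<inter> D" by auto
  have "young_diagram (D - {y})"
    unfolding e using h D by (intro young_diagram_Int) (auto simp: removable_def)
  then show "y \<in> removable D" using h by (auto simp: removable_def)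
  show "z \<in> addable (D - {y})" using h by (auto simp: addable_def removable_def insert_Diff_if)
next
  assume h: "y \<in> removable D" "z \<in> addable (D - {y})" "z \<noteq> y"
  have e: "insert z D = insert z (D - {y}) \<union> D" by auto
  have "young_diagram (insert z D)"
    unfolding e using h D by (intro young_diagram_Un) (auto simp: addable_def)
  then show "z \<in> addable D" using h by (auto simp: addable_def)
  show "y \<in> removable (insert z D)" using h by (auto simp: addable_def removable_def insert_Diff_if)
qed

text \<open>Apply the recursion for \<open>num_syt\<close> to every \<open>insert z D\<close> and
  exchange the addition of z with the removal of y. By induction only y = x survives, where
  \<open>cauchy_finite_part\<close> gives the finite part at the pole; by
  \<open>corner_sum_remove\<close> it cancels the terms in which y and z coincide.\<close>

theorem transition_weights_orthogonal:
  assumes "young_diagram D" and "x \<in> removable D"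
  shows "(\<Sum>z\<in>addable D. real (num_syt (insert z D)) /
           (real_of_int (content z) - real_of_int (content x))) = 0"
  using assms
proof (induction arbitrary: x rule: young_diagram_induct)
  case empty
  then show ?case by (simp add: removable_def)
next
  case (remove D)
  note D = remove(1) and x = remove(4)
  \<comment> \<open>Division by zero makes this 0 at \<open>content x\<close>; the terms at x below
    rely on it.\<close>
  define h where "h = (\<lambda>c. 1 / (real_of_int c - real_of_int (content x)))"
  let ?d = "\<lambda>D. real (num_syt D)"
  have fa: "finite (addable D)" and fr: "finite (removable D)"
    using D finite_addable finite_removable by auto
  have dz: "?d (insert z D) = ?d D + (\<Sum>y\<in>removable (insert z D) - {z}. ?d (insert z D - {y}))"
    if z: "z \<in> addable D" for z
  proof -
    have y: "young_diagram (insert z D)" by (rule young_diagram_addable[OF z])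
    have zr: "z \<in> removable (insert z D)" "insert z D - {z} = D"
      using z D by (auto simp: removable_def addable_def)
    have "?d (insert z D) = (\<Sum>y\<in>removable (insert z D). ?d (insert z D - {y}))"
      using num_syt_recurrence[OF y] by simp
    also have "\<dots> = ?d D + (\<Sum>y\<in>removable (insert z D) - {z}. ?d (insert z D - {y}))"
      using zr finite_removable[OF y] by (simp add: sum.remove)
    finally show ?thesis .
  qed
  have "(\<Sum>z\<in>addable D. ?d (insert z D) * h (content z)) =
    ?d D * (\<Sum>z\<in>addable D. h (content z)) +
    (\<Sum>z\<in>addable D. \<Sum>y\<in>removable (insert z D) - {z}. ?d (insert z D - {y}) * h (content z))"
    by (simp add: dz sum.distrib sum_distrib_left sum_distrib_right distrib_right cong: sum.cong)
  also have "(\<Sum>z\<in>addable D. \<Sum>y\<in>removable (insert z D) - {z}. ?d (insert z D - {y}) * h (content z))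
     = (\<Sum>y\<in>removable D. \<Sum>z\<in>addable (D - {y}) - {y}. ?d (insert z (D - {y})) * h (content z))"
  proof -
    have "(\<Sum>z\<in>addable D. \<Sum>y\<in>removable (insert z D) - {z}. ?d (insert z D - {y}) * h (content z))
      = (\<Sum>(z, y)\<in>Sigma (addable D) (\<lambda>z. removable (insert z D) - {z}). ?d (insert z D - {y}) * h (content z))"
      using fa by (intro sum.Sigma) (auto intro: finite_removable young_diagram_addable)
    also have "\<dots> = (\<Sum>(y, z)\<in>Sigma (removable D) (\<lambda>y. addable (D - {y}) - {y}).
        ?d (insert z (D - {y})) * h (content z))"
    proof (rule sum.reindex_bij_witness[where i = "\<lambda>(y, z). (z, y)" and j = "\<lambda>(z, y). (y, z)"])
      fix p assume "p \<in> Sigma (addable D) (\<lambda>z. removable (insert z D) - {z})"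
      then obtain z y where p: "p = (z, y)" "z \<in> addable D" "y \<in> removable (insert z D) - {z}" by auto
      then show "(case p of (z, y) \<Rightarrow> (y, z)) \<in> Sigma (removable D) (\<lambda>y. addable (D - {y}) - {y})"
        using add_remove_commute[OF D, of z y] by auto
      show "(case case p of (z, y) \<Rightarrow> (y, z) of (y, z) \<Rightarrow> ?d (insert z (D - {y})) * h (content z)) =
          (case p of (z, y) \<Rightarrow> ?d (insert z D - {y}) * h (content z))"
        using p by (auto simp: insert_Diff_if)
    next
      fix p assume "p \<in> Sigma (removable D) (\<lambda>y. addable (D - {y}) - {y})"
      then obtain y z where p: "p = (y, z)" "y \<in> removable D" "z \<in> addable (D - {y}) - {y}" by auto
      then show "(case p of (y, z) \<Rightarrow> (z, y)) \<in> Sigma (addable D) (\<lambda>z. removable (insert z D) - {z})"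
        using add_remove_commute[OF D, of z y] by auto
    qed auto
    also have "\<dots> = (\<Sum>y\<in>removable D. \<Sum>z\<in>addable (D - {y}) - {y}. ?d (insert z (D - {y})) * h (content z))"
      using fr by (intro sum.Sigma[symmetric]) (auto intro: finite_addable young_diagram_removable)
    finally show ?thesis .
  qed
  \<comment> \<open>The missing term z = y would be \<open>?d D * h (content y)\<close>, since
    inserting y gives \<open>D\<close> back.\<close>
  also have "\<dots> = (\<Sum>y\<in>removable D. (\<Sum>z\<in>addable (D - {y}). ?d (insert z (D - {y})) * h (content z)) - ?d D * h (content y))"
  proof (rule sum.cong[OF refl])
    fix y assume y: "y \<in> removable D"
    have "finite (addable (D - {y}))" using y by (intro finite_addable young_diagram_removable)
    moreover have "insert y (D - {y}) = D" using y by (auto simp: removable_def)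
    ultimately show "(\<Sum>z\<in>addable (D - {y}) - {y}. ?d (insert z (D - {y})) * h (content z)) =
      (\<Sum>z\<in>addable (D - {y}). ?d (insert z (D - {y})) * h (content z)) - ?d D * h (content y)"
      using addable_Diff_removable[OF D y] by (simp add: sum.remove)
  qed
  also have "\<dots> = (\<Sum>y\<in>removable D. \<Sum>z\<in>addable (D - {y}). ?d (insert z (D - {y})) * h (content z))
      - ?d D * (\<Sum>y\<in>removable D. h (content y))"
    by (simp add: sum_subtractf sum_distrib_left)
  also have "(\<Sum>y\<in>removable D. \<Sum>z\<in>addable (D - {y}). ?d (insert z (D - {y})) * h (content z))
     = (\<Sum>z\<in>addable (D - {x}). ?d (insert z (D - {x})) * h (content z))"
  proof -
    \<comment> \<open>The corner x stays removable after the removal of y, so the induction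
      hypothesis applies to \<open>D - {y}\<close>.\<close>
    have "(\<Sum>z\<in>addable (D - {y}). ?d (insert z (D - {y})) * h (content z)) = 0"
      if "y \<in> removable D - {x}" for y
    proof -
      have y: "y \<in> removable D" "y \<noteq> x" using that by auto
      have "D - {y} - {x} = (D - {y}) \<inter> (D - {x})" by auto
      then have "young_diagram (D - {y} - {x})"
        using young_diagram_Int[OF young_diagram_removable[OF y(1)] young_diagram_removable[OF x]] by simp
      then have "x \<in> removable (D - {y})" using x y by (auto simp: removable_def)
      from remove(3)[OF y(1) this] show ?thesis by (simp add: h_def)
    qed
    then show ?thesis using x fr by (simp add: sum.remove)
  qed
  \<comment> \<open>Now x is addable in the smaller diagram with weight \<open>?d D\<close>, so the
    sum is a finite part at its pole.\<close>
  also have "\<dots> = ?d D * ((\<Sum>y\<in>removable (D - {x}). h (content y)) - (\<Sum>z\<in>addable (D - {x}). h (content z)))"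
  proof -
    let ?E = "D - {x}"
    have E: "young_diagram ?E" by (rule young_diagram_removable[OF x])
    have "insert x ?E = D" using x by (auto simp: removable_def)
    moreover have "inj_on (\<lambda>z. real_of_int (content z)) (addable ?E \<union> removable ?E)"
      using inj_on_content_corners[OF E] by (simp add: inj_on_def)
    ultimately show ?thesis
      using cauchy_finite_part[OF finite_addable[OF E] finite_removable[OF E] card_addable[OF E] _
         addable_removable_disjoint, of "\<lambda>z. real_of_int (content z)" "\<lambda>z. ?d (insert z ?E)" x]
        remove(3)[OF x] addable_Diff_removable[OF D x]
      by (simp add: h_def)
  qed
  \<comment> \<open>The second difference of \<open>h\<close> at \<open>content x\<close> is - 2 * 0
    + 1 - 1.\<close>
  also have "(\<Sum>y\<in>removable (D - {x}). h (content y)) - (\<Sum>z\<in>addable (D - {x}). h (content z))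
      = (\<Sum>y\<in>removable D. h (content y)) - (\<Sum>z\<in>addable D. h (content z))"
    using corner_sum_remove[OF D x, of h] by (simp add: h_def)
  finally show ?case by (simp add: h_def algebra_simps)
qed

section \<open>Equi-isoclinic families\<close>

lemma op_comp_assoc: "op_comp Y (op_comp Z A B) C = op_comp Z A (op_comp Y B C)"
proof (intro ext)
  fix w x
  have "(\<Sum>y\<in>Y. (\<Sum>z\<in>Z. A w z * B z y) * C y x) = (\<Sum>y\<in>Y. \<Sum>z\<in>Z. A w z * (B z y * C y x))"
    by (simp add: sum_distrib_right mult.assoc)
  also have "\<dots> = (\<Sum>z\<in>Z. \<Sum>y\<in>Y. A w z * (B z y * C y x))" by (rule sum.swap)
  finally show "op_comp Y (op_comp Z A B) C w x = op_comp Z A (op_comp Y B C) w x"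
    by (simp add: op_comp_def sum_distrib_left)
qed

lemma op_adj_comp: "op_adj (op_comp Y A B) = op_comp Y (op_adj B) (op_adj A)"
  by (simp add: op_adj_def op_comp_def mult.commute)

lemma op_adj_adj [simp]: "op_adj (op_adj A) = A"
  by (simp add: op_adj_def)

lemma op_apply_comp: "op_apply X (op_comp Y A B) v = op_apply Y A (op_apply X B v)"
proof (rule ext)
  fix w
  have "(\<Sum>x\<in>X. (\<Sum>y\<in>Y. A w y * B y x) * v x) = (\<Sum>x\<in>X. \<Sum>y\<in>Y. A w y * (B y x * v x))"
    by (simp add: sum_distrib_right mult.assoc)
  also have "\<dots> = (\<Sum>y\<in>Y. \<Sum>x\<in>X. A w y * (B y x * v x))" by (rule sum.swap)
  finally show "op_apply X (op_comp Y A B) v w = op_apply Y A (op_apply X B v) w"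
    by (simp add: op_apply_def op_comp_def sum_distrib_left)
qed

lemma op_comp_cong_right:
  "(\<And>y. y \<in> Y \<Longrightarrow> B y x = B' y x') \<Longrightarrow> op_comp Y A B z x = op_comp Y A B' z x'"
  unfolding op_comp_def by (rule sum.cong) auto

lemma op_comp_cong_left:
  "(\<And>y. y \<in> Y \<Longrightarrow> A z y = A' z' y) \<Longrightarrow> op_comp Y A B z x = op_comp Y A' B z' x"
  unfolding op_comp_def by (rule sum.cong) auto

lemma op_comp_scalar_left: "finite X \<Longrightarrow> x \<in> X \<Longrightarrow> op_comp X (op_scalar X c) B x y = c * B x y"
proof -
  assume fin: "finite X" and x: "x \<in> X"
  have "op_comp X (op_scalar X c) B x y = (\<Sum>z\<in>X. if z = x then c * B x y else 0)"
    unfolding op_comp_def op_scalar_def by (rule sum.cong) auto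
  then show ?thesis using fin x by simp
qed

lemma op_adj_scalar: "op_adj (op_scalar X c) = op_scalar X c"
  by (auto simp: op_adj_def op_scalar_def fun_eq_iff)

text \<open>The columns of \<open>A\<close> are the images of basis vectors.\<close>

lemma op_image_factor:
  assumes fin: "finite J" and sub: "op_image J A \<subseteq> op_image I B"
  obtains U where "\<And>y j. j \<in> J \<Longrightarrow> A y j = op_comp I B U y j"
proof -
  have "\<exists>u. \<forall>y. A y j = (\<Sum>i\<in>I. B y i * u i)" if j: "j \<in> J" for j
  proof -
    have "op_apply J A (\<lambda>i. if i = j then 1 else 0) = (\<lambda>y. A y j)"
      unfolding op_apply_def using fin j by (simp add: if_distrib cong: if_cong)
    then have "(\<lambda>y. A y j) \<in> op_image J A" unfolding op_image_def by (metis rangeI)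
    then obtain u where "(\<lambda>y. A y j) = op_apply I B u" using sub unfolding op_image_def by blast
    then show ?thesis by (auto simp: op_apply_def fun_eq_iff)
  qed
  then obtain U where "\<And>j y. j \<in> J \<Longrightarrow> A y j = (\<Sum>i\<in>I. B y i * U j i)" by metis
  then show ?thesis using that[of "\<lambda>i j. U j i"] by (simp add: op_comp_def)
qed

text \<open>Both sides are the orthogonal projection onto the common image. With \<open>B\<close> =
  \<open>A\<close> \<open>U\<close> and \<open>A\<close> = \<open>B\<close> \<open>V\<close> on
  columns, \<open>U\<close> and \<open>V\<close> are the two cross-Gram matrices, hence transposes
  of each other.\<close>

lemma isometry_projection_eq:
  assumes fin: "finite I" "finite J"
    and iso: "is_isometry X I A" "is_isometry X J B" and im: "op_image I A = op_image J B"
  shows "op_comp I A (op_adj A) = op_comp J B (op_adj B)"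
proof -
  obtain U where U: "\<And>y j. j \<in> J \<Longrightarrow> B y j = op_comp I A U y j"
    using op_image_factor[OF fin(2)] im by blast
  obtain V where V: "\<And>y i. i \<in> I \<Longrightarrow> A y i = op_comp J B V y i"
    using op_image_factor[OF fin(1)] im by blast
  have U': "op_comp X (op_adj A) B i j = U i j" if "i \<in> I" "j \<in> J" for i j
  proof -
    have "op_comp X (op_adj A) B i j = op_comp I (op_comp X (op_adj A) A) U i j"
      unfolding op_comp_assoc using U[OF that(2)] by (intro op_comp_cong_right)
    also have "\<dots> = op_comp I (op_scalar I 1) U i j"
      using iso(1) that by (intro op_comp_cong_left) (auto simp: is_isometry_def op_eq_def)
    also have "\<dots> = U i j" by (simp add: op_comp_scalar_left[OF fin(1) that(1)])
    finally show ?thesis .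
  qed
  have V': "op_comp X (op_adj B) A j i = V j i" if "i \<in> I" "j \<in> J" for i j
  proof -
    have "op_comp X (op_adj B) A j i = op_comp J (op_comp X (op_adj B) B) V j i"
      unfolding op_comp_assoc using V[OF that(1)] by (intro op_comp_cong_right)
    also have "\<dots> = op_comp J (op_scalar J 1) V j i"
      using iso(2) that by (intro op_comp_cong_left) (auto simp: is_isometry_def op_eq_def)
    also have "\<dots> = V j i" by (simp add: op_comp_scalar_left[OF fin(2) that(2)])
    finally show ?thesis .
  qed
  have UV: "U i j = V j i" if "i \<in> I" "j \<in> J" for i j
    unfolding U'[OF that, symmetric] V'[OF that, symmetric]
    by (simp add: op_comp_def op_adj_def mult.commute)
  show ?thesis
  proof (intro ext)
    fix y y'
    have "op_comp J B (op_adj B) y y' = op_comp J (op_comp I A U) (op_adj B) y y'"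
      using U by (intro op_comp_cong_left)
    also have "\<dots> = op_comp I A (op_comp J U (op_adj B)) y y'" by (simp add: op_comp_assoc)
    also have "\<dots> = op_comp I A (op_adj A) y y'"
    proof (rule op_comp_cong_right)
      fix i assume i: "i \<in> I"
      have "op_comp J U (op_adj B) i y' = op_comp J B V y' i"
        unfolding op_comp_def op_adj_def using UV[OF i] by (intro sum.cong) auto
      then show "op_comp J U (op_adj B) i y' = op_adj A i y'" using V[OF i] by (simp add: op_adj_def)
    qed
    finally show "op_comp I A (op_adj A) y y' = op_comp J B (op_adj B) y y'" by simp
  qed
qed

text \<open>The condition of \<open>equi_isoclinic\<close> for one pair, over an arbitrary index set
  instead of an initial segment of the naturals.\<close>

definition isoclinic_pair :: "'y set \<Rightarrow> 'j set \<Rightarrow> ('y, 'j) opr \<Rightarrow> ('y, 'j) opr \<Rightarrow> real \<Rightarrow> bool" where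
  "isoclinic_pair X J A B \<alpha> \<longleftrightarrow>
     (let C = op_comp X (op_adj A) B in op_eq J J (op_comp J (op_adj C) C) (op_scalar J \<alpha>))"

text \<open>The first operator enters only through \<open>F\<close> times its adjoint, which for an
  isometry is the projection onto its image.\<close>

lemma cross_gram_eq: "op_comp K (op_adj (op_comp X (op_adj F) G)) (op_comp X (op_adj F) G)
     = op_comp X (op_adj G) (op_comp X (op_comp K F (op_adj F)) G)"
  by (simp add: op_adj_comp op_comp_assoc)

text \<open>After \<open>cross_gram_eq\<close> the change from \<open>A\<close> to \<open>A'\<close>
  is invisible, and passing from \<open>B\<close> to \<open>B'\<close> = \<open>B\<close>
  \<open>U\<close> conjugates by \<open>U\<close>, whose columns are orthonormal. The index sets may
  have different types, so tableaux can replace natural numbers.\<close>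

lemma isoclinic_pair_transfer:
  assumes fin: "finite I" "finite J"
    and iso: "is_isometry X I A" "is_isometry X I B" "is_isometry X J A'" "is_isometry X J B'"
    and im: "op_image I A = op_image J A'" "op_image I B = op_image J B'"
    and pair: "isoclinic_pair X I A B \<alpha>"
  shows "isoclinic_pair X J A' B' \<alpha>"
proof -
  let ?P = "op_comp I A (op_adj A)"
  have P: "?P = op_comp J A' (op_adj A')" by (rule isometry_projection_eq[OF fin iso(1,3) im(1)])
  obtain U where U: "\<And>y j. j \<in> J \<Longrightarrow> B' y j = op_comp I B U y j"
    using op_image_factor[OF fin(2)] im(2) by blast
  have conj: "op_comp X (op_adj B') (op_comp X Q B') j j' =
      op_comp I (op_adj U) (op_comp I (op_comp X (op_adj B) (op_comp X Q B)) U) j j'"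
    if "j \<in> J" "j' \<in> J" for Q and j j'
  proof -
    have "op_comp X (op_adj B') (op_comp X Q B') j j'
        = op_comp X (op_adj B') (op_comp X Q (op_comp I B U)) j j'"
      using U[OF that(2)] by (intro op_comp_cong_right)
    also have "\<dots> = op_comp X (op_adj (op_comp I B U)) (op_comp X Q (op_comp I B U)) j j'"
      using U[OF that(1)] by (intro op_comp_cong_left) (simp add: op_adj_def)
    finally show ?thesis by (simp add: op_adj_comp op_comp_assoc)
  qed
  have scal: "op_comp I (op_adj U) (op_comp I M U) j j' = c * op_comp I (op_adj U) U j j'"
    if "op_eq I I M (op_scalar I c)" for M c j j'
  proof -
    have "op_comp I M U i j' = c * U i j'" if "i \<in> I" for i
      using op_comp_scalar_left[OF fin(1) that, of c U j'] \<open>op_eq I I M _\<close> that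
        op_comp_cong_left[of I M i "op_scalar I c" i U j']
      by (auto simp: op_eq_def)
    then show ?thesis
      unfolding op_comp_def[of I "op_adj U"] sum_distrib_left by (intro sum.cong) auto
  qed
  have UU: "op_comp I (op_adj U) U j j' = op_scalar J 1 j j'" if "j \<in> J" "j' \<in> J" for j j'
  proof -
    have "op_comp X (op_adj B') B' j j' = op_comp X (op_adj B') (op_comp I B U) j j'"
      using U[OF that(2)] by (intro op_comp_cong_right)
    also have "\<dots> = op_comp X (op_adj (op_comp I B U)) (op_comp I B U) j j'"
      using U[OF that(1)] by (intro op_comp_cong_left) (simp add: op_adj_def)
    also have "\<dots> = op_comp I (op_adj U) (op_comp I (op_comp X (op_adj B) B) U) j j'"
      by (simp add: op_adj_comp op_comp_assoc)
    also have "\<dots> = op_comp I (op_adj U) U j j'" using scal iso(2) by (simp add: is_isometry_def)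
    finally show ?thesis using iso(4) that by (auto simp: is_isometry_def op_eq_def)
  qed
  show ?thesis
    unfolding isoclinic_pair_def Let_def cross_gram_eq P[symmetric] op_eq_def
  proof (intro ballI)
    fix j j' assume j: "j \<in> J" "j' \<in> J"
    have "op_comp X (op_adj B') (op_comp X ?P B') j j' = \<alpha> * op_scalar J 1 j j'"
      using conj[OF j] scal pair UU[OF j] unfolding isoclinic_pair_def Let_def cross_gram_eq by metis
    then show "op_comp X (op_adj B') (op_comp X ?P B') j j' = op_scalar J \<alpha> j j'"
      by (simp add: op_scalar_def)
  qed
qed

text \<open>Allows any convenient isometries, here those indexed by tableaux, in place of the rank
  and the isometries hidden in the definition.\<close>

lemma equi_isoclinic_iff:
  fixes \<Theta> :: "'k \<Rightarrow> ('y, 'j) opr"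
  assumes fin: "finite J"
    and iso: "\<And>k. k \<in> K \<Longrightarrow> is_isometry X J (\<Theta> k)"
    and im: "\<And>k. k \<in> K \<Longrightarrow> op_image J (\<Theta> k) = W k"
  shows "equi_isoclinic K X W \<longleftrightarrow>
    (\<exists>\<alpha>. \<forall>k\<in>K. \<forall>l\<in>K. k \<noteq> l \<longrightarrow> isoclinic_pair X J (\<Theta> k) (\<Theta> l) \<alpha>)"
proof
  assume "equi_isoclinic K X W"
  then obtain r \<Phi> \<alpha> where \<Phi>: "\<And>k. k \<in> K \<Longrightarrow> is_isometry X {..<r::nat} (\<Phi> k)"
      "\<And>k. k \<in> K \<Longrightarrow> op_image {..<r} (\<Phi> k) = W k"
      "\<And>k l. k \<in> K \<Longrightarrow> l \<in> K \<Longrightarrow> k \<noteq> l \<Longrightarrow> isoclinic_pair X {..<r} (\<Phi> k) (\<Phi> l) \<alpha>"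
    unfolding equi_isoclinic_def isoclinic_pair_def by metis
  have "isoclinic_pair X J (\<Theta> k) (\<Theta> l) \<alpha>" if "k \<in> K" "l \<in> K" "k \<noteq> l" for k l
    using isoclinic_pair_transfer[OF finite_lessThan fin \<Phi>(1)[OF that(1)] \<Phi>(1)[OF that(2)]
      iso[OF that(1)] iso[OF that(2)] _ _ \<Phi>(3)[OF that]] \<Phi>(2) im that by simp
  then show "\<exists>\<alpha>. \<forall>k\<in>K. \<forall>l\<in>K. k \<noteq> l \<longrightarrow> isoclinic_pair X J (\<Theta> k) (\<Theta> l) \<alpha>" by blast
next
  assume "\<exists>\<alpha>. \<forall>k\<in>K. \<forall>l\<in>K. k \<noteq> l \<longrightarrow> isoclinic_pair X J (\<Theta> k) (\<Theta> l) \<alpha>"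
  then obtain \<alpha> where \<alpha>: "\<And>k l. k \<in> K \<Longrightarrow> l \<in> K \<Longrightarrow> k \<noteq> l \<Longrightarrow> isoclinic_pair X J (\<Theta> k) (\<Theta> l) \<alpha>"
    by blast
  obtain \<beta> where \<beta>: "bij_betw \<beta> {..<card J} J"
    using ex_bij_betw_nat_finite[OF fin] by (auto simp: atLeast0LessThan)
  define \<Phi> where "\<Phi> k = (\<lambda>y i. \<Theta> k y (\<beta> i))" for k
  let ?I = "{..<card J}"
  have iso': "is_isometry X ?I (\<Phi> k)" if k: "k \<in> K" for k
    unfolding is_isometry_def op_eq_def
  proof (intro ballI)
    fix i i' assume i: "i \<in> ?I" "i' \<in> ?I"
    then have "\<beta> i \<in> J" "\<beta> i' \<in> J" "\<beta> i = \<beta> i' \<longleftrightarrow> i = i'"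
      using \<beta> by (auto simp: bij_betw_def inj_on_def)
    then show "op_comp X (op_adj (\<Phi> k)) (\<Phi> k) i i' = op_scalar ?I 1 i i'"
      using iso[OF k] i by (auto simp: is_isometry_def op_eq_def \<Phi>_def op_comp_def op_adj_def op_scalar_def)
  qed
  have im': "op_image ?I (\<Phi> k) = op_image J (\<Theta> k)" for k
  proof -
    have 1: "op_apply ?I (\<Phi> k) (v \<circ> \<beta>) = op_apply J (\<Theta> k) v" for v
      unfolding op_apply_def \<Phi>_def using sum.reindex_bij_betw[OF \<beta>, of "\<lambda>x. \<Theta> k _ x * v x"] by simp
    have 2: "op_apply ?I (\<Phi> k) v = op_apply J (\<Theta> k) (v \<circ> inv_into ?I \<beta>)" for v
    proof -
      have "op_apply ?I (\<Phi> k) v = op_apply ?I (\<Phi> k) (v \<circ> inv_into ?I \<beta> \<circ> \<beta>)"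
        unfolding op_apply_def using \<beta> by (intro ext sum.cong) (auto simp: bij_betw_def)
      then show ?thesis using 1 by simp
    qed
    show ?thesis unfolding op_image_def using 1 2 by (metis (no_types, lifting) equalityI image_subsetI rangeI)
  qed
  have "isoclinic_pair X ?I (\<Phi> k) (\<Phi> l) \<alpha>" if "k \<in> K" "l \<in> K" "k \<noteq> l" for k l
    using isoclinic_pair_transfer[OF fin finite_lessThan iso[OF that(1)] iso[OF that(2)]
      iso'[OF that(1)] iso'[OF that(2)] _ _ \<alpha>[OF that]] im' by simp
  then show "equi_isoclinic K X W"
    unfolding equi_isoclinic_def using iso' im' im
    by (intro exI[of _ "card J"] exI[of _ \<Phi>] exI[of _ \<alpha>]) (auto simp: isoclinic_pair_def)
qed

section \<open>Young's orthogonal form\<close>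

lemma diagram_eq_Sigma: "diagram \<nu> = Sigma {..<length \<nu>} (\<lambda>i. {..<\<nu> ! i})"
  by (auto simp: diagram_def)

lemma card_diagram: "card (diagram \<nu>) = sum_list \<nu>"
  by (simp add: diagram_eq_Sigma sum_list_sum_nth atLeast0LessThan)

lemma finite_diagram: "finite (diagram \<nu>)"
  by (simp add: diagram_eq_Sigma)

lemma Tab_eq_syt: "Tab \<nu> = syt (diagram \<nu>)"
  by (simp add: Tab_def syt_def card_diagram)

lemma young_diagram_diagram:
  assumes "partition_of n \<nu>"
  shows "young_diagram (diagram \<nu>)"
proof -
  have "\<nu> ! i \<le> \<nu> ! i'" if "i' \<le> i" "i < length \<nu>" for i i'
    using assms that sorted_wrt_nth_less[of "(\<ge>)" \<nu> i' i]
    by (cases "i = i'") (auto simp: partition_of_def)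
  then show ?thesis
    unfolding young_diagram_def using finite_diagram by (fastforce simp: diagram_def)
qed

section \<open>Contents of entries and the relations between the generators\<close>

definition entry_content :: "(nat \<times> nat) set \<Rightarrow> tableau \<Rightarrow> nat \<Rightarrow> int" where
  "entry_content D T k = content (inv_into D T k)"

lemma adj_transp_simps [simp]:
  "adj_transp k k = Suc k" "adj_transp k (Suc k) = k"
  "adj_transp k (adj_transp k m) = m" "adj_transp k \<circ> (adj_transp k \<circ> T) = T"
  "\<lbrakk>m \<noteq> k; m \<noteq> Suc k\<rbrakk> \<Longrightarrow> adj_transp k m = m"
  by (auto simp: adj_transp_def fun_eq_iff transpose_def)

lemma adj_transp_eq: "adj_transp k m = (if m = k then Suc k else if m = Suc k then k else m)"
  by (auto simp: adj_transp_def transpose_def)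

lemma adj_transp_bij: "bij_betw (adj_transp k) {1..n} {1..n}" if "k \<in> {1..<n}"
  by (rule bij_betw_byWitness[where f' = "adj_transp k"]) (use that in \<open>auto simp: adj_transp_eq\<close>)

lemma bij_adj_transp_comp:
  assumes "bij_betw T D {1..card D}" "k \<in> {1..<card D}"
  shows "bij_betw (adj_transp k \<circ> T) D {1..card D}"
  using bij_betw_trans[OF assms(1) adj_transp_bij[OF assms(2)]] by simp

text \<open>Assumes a bijection and not a standard tableau, because the intermediate fillings in the
  braid relation may be non-standard.\<close>

lemma entry_content_transp:
  assumes T: "bij_betw T D {1..card D}" and k: "k \<in> {1..<card D}" and m: "m \<in> {1..card D}"
  shows "entry_content D (adj_transp k \<circ> T) m = entry_content D T (adj_transp k m)"
proof -
  have sm: "adj_transp k m \<in> {1..card D}"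
    using adj_transp_bij[OF k] m by (auto simp: bij_betw_def)
  define x where "x = inv_into D T (adj_transp k m)"
  have x: "x \<in> D" "T x = adj_transp k m"
    using sm T unfolding x_def by (auto simp: bij_betw_def inv_into_into f_inv_into_f)
  have "inv_into D (adj_transp k \<circ> T) m = x"
    using bij_adj_transp_comp[OF T k] x
    by (intro inv_into_f_eq) (auto simp: bij_betw_def)
  then show ?thesis by (simp add: entry_content_def x_def)
qed

lemma syt_bij: "T \<in> syt D \<Longrightarrow> bij_betw T D {1..card D}"
  by (simp add: syt_def)

lemma syt_box:
  assumes "T \<in> syt D" "m \<in> {1..card D}"
  shows "inv_into D T m \<in> D" "T (inv_into D T m) = m"
  using assms by (auto simp: syt_def bij_betw_def inv_into_into f_inv_into_f)

text \<open>Between (i, j) and its lower right neighbour lie two boxes with distinct entries, so a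
  step down the diagonal raises the entry by at least 3.\<close>

lemma syt_same_diagonal:
  assumes D: "young_diagram D" and T: "T \<in> syt D" and y: "(p, q) \<in> D" and ij: "i < p"
    and c: "content (i, j) = content (p, q)"
  shows "T (i, j) + 3 \<le> T (p, q)"
proof -
  have jq: "j < q" using ij c by (auto simp: content_def)
  have in_D: "(Suc i, Suc j) \<in> D" "(i, Suc j) \<in> D" "(Suc i, j) \<in> D"
    using young_diagramD[OF D y] ij jq by auto
  have "T (i, j) < T (i, Suc j)" "T (i, j) < T (Suc i, j)"
    "T (i, Suc j) < T (Suc i, Suc j)" "T (Suc i, j) < T (Suc i, Suc j)"
    using syt_mono[OF D T] in_D by auto
  moreover have "T (i, Suc j) \<noteq> T (Suc i, j)"
    using inj_onD[OF syt_inj[OF T] _ in_D(2,3)] by auto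
  moreover have "T (Suc i, Suc j) \<le> T (p, q)"
    using syt_mono[OF D T y, of "Suc i" "Suc j"] ij jq by (cases "(Suc i, Suc j) = (p, q)") auto
  ultimately show ?thesis by linarith
qed

text \<open>The differences 1 and 2 of the entries give the denominators that occur in the square
  and braid relations.\<close>

lemma entry_content_neq:
  assumes D: "young_diagram D" and T: "T \<in> syt D"
    and h: "k \<in> {1..card D}" "m \<in> {1..card D}" "k < m" "m \<le> k + 2"
  shows "entry_content D T k \<noteq> entry_content D T m"
proof
  assume eq: "entry_content D T k = entry_content D T m"
  obtain i j where x: "inv_into D T k = (i, j)" by force
  obtain p q where y: "inv_into D T m = (p, q)" by force
  have *: "(i, j) \<in> D" "T (i, j) = k" "(p, q) \<in> D" "T (p, q) = m"
    using syt_box[OF T h(1)] syt_box[OF T h(2)] x y by auto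
  have c: "content (i, j) = content (p, q)" using eq x y by (simp add: entry_content_def)
  have "i \<noteq> p" using c * h by (auto simp: content_def)
  then show False
    using syt_same_diagonal[OF D T *(3) _ c] syt_same_diagonal[OF D T *(1) _ c[symmetric]] * h
    by (cases "i < p") auto
qed

text \<open>Exchanging \<open>k\<close> and \<open>Suc k\<close> spoils standardness only if they
  are neighbours in a row or column. The axial distance is then 1 or - 1, where the square root in
  Young's form vanishes.\<close>

lemma syt_transp_or_adjacent:
  assumes D: "young_diagram D" and T: "T \<in> syt D" and k: "k \<in> {1..<card D}"
    and nT: "adj_transp k \<circ> T \<notin> syt D"
  shows "\<bar>entry_content D T (Suc k) - entry_content D T k\<bar> = 1"
proof -
  let ?S = "adj_transp k \<circ> T"
  have zero: "?S x = 0" if "x \<notin> D" for x using syt_zero[OF T that] k by (simp add: adj_transp_eq)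
  have bij: "bij_betw ?S D {1..card D}" by (rule bij_adj_transp_comp[OF syt_bij[OF T] k])
  have bad: "T x = k \<and> T y = Suc k" if "T x < T y" "\<not> ?S x < ?S y" for x y
    using that by (auto simp: adj_transp_eq split: if_splits)
  have box: "inv_into D T (T x) = x" if "x \<in> D" for x
    using syt_inj[OF T] that by simp
  have "\<not> ((\<forall>i j j'. j < j' \<and> (i, j') \<in> D \<longrightarrow> ?S (i, j) < ?S (i, j')) \<and>
           (\<forall>i i' j. i < i' \<and> (i', j) \<in> D \<longrightarrow> ?S (i, j) < ?S (i', j)))"
    using nT bij zero unfolding syt_def by blast
  then consider i j j' where "j < j'" "(i, j') \<in> D" "\<not> ?S (i, j) < ?S (i, j')"
    | i i' j where "i < i'" "(i', j) \<in> D" "\<not> ?S (i, j) < ?S (i', j)" by blast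
  then show ?thesis
  proof cases
    case 1
    have in_D: "(i, j) \<in> D" "(i, Suc j) \<in> D" using young_diagramD[OF D 1(2)] 1(1) by auto
    have v: "T (i, j) = k" "T (i, j') = Suc k"
      using bad[OF syt_mono[OF D T 1(2), of i j] 1(3)] 1(1) by auto
    have "j' = Suc j"
    proof (rule ccontr)
      assume "j' \<noteq> Suc j"
      then have "T (i, j) < T (i, Suc j)" "T (i, Suc j) < T (i, j')"
        using syt_mono[OF D T in_D(2), of i j] syt_mono[OF D T 1(2), of i "Suc j"] 1(1) by auto
      then show False using v by simp
    qed
    then show ?thesis
      using box[OF in_D(1)] box[OF 1(2)] v by (simp add: entry_content_def content_def)
  next
    case 2
    have in_D: "(i, j) \<in> D" "(Suc i, j) \<in> D" using young_diagramD[OF D 2(2)] 2(1) by auto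
    have v: "T (i, j) = k" "T (i', j) = Suc k"
      using bad[OF syt_mono[OF D T 2(2), of i j] 2(3)] 2(1) by auto
    have "i' = Suc i"
    proof (rule ccontr)
      assume "i' \<noteq> Suc i"
      then have "T (i, j) < T (Suc i, j)" "T (Suc i, j) < T (i', j)"
        using syt_mono[OF D T in_D(2), of i j] syt_mono[OF D T 2(2), of "Suc i" j] 2(1) by auto
      then show False using v by simp
    qed
    then show ?thesis
      using box[OF in_D(1)] box[OF 2(2)] v by (simp add: entry_content_def content_def)
  qed
qed

text \<open>The action of a generator on functions on all fillings, standard or not: at a standard tableau
  the coefficient of a non-standard neighbour vanishes.\<close>

definition young_step :: "(nat \<times> nat) set \<Rightarrow> nat \<Rightarrow> (tableau \<Rightarrow> real) \<Rightarrow> tableau \<Rightarrow> real" where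
  "young_step D k F T =
     (let d = real_of_int (entry_content D T (Suc k) - entry_content D T k)
      in F T / d + sqrt (1 - 1 / d\<^sup>2) * F (adj_transp k \<circ> T))"

text \<open>A non-standard neighbour carries the coefficient 0, so only values at standard tableaux
  are read.\<close>

lemma young_step_cong:
  assumes D: "young_diagram D" and T: "T \<in> syt D" and k: "k \<in> {1..<card D}"
    and FG: "\<And>S. S \<in> syt D \<Longrightarrow> F S = G S"
  shows "young_step D k F T = young_step D k G T"
proof (cases "adj_transp k \<circ> T \<in> syt D")
  case True
  then show ?thesis using FG T by (simp add: young_step_def)
next
  case False
  let ?d = "entry_content D T (Suc k) - entry_content D T k"
  have "(real_of_int d)\<^sup>2 = 1" if "\<bar>d\<bar> = 1" for d :: int
  proof -
    have "d = 1 \<or> d = -1" using that by linarith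
    then show ?thesis by auto
  qed
  then have "(real_of_int ?d)\<^sup>2 = 1" using syt_transp_or_adjacent[OF D T k False] by blast
  then show ?thesis using FG[OF T] unfolding young_step_def Let_def by simp
qed

lemma sqrt_axial:
  fixes d :: int
  assumes "d \<noteq> 0"
  shows "sqrt (1 - 1 / (real_of_int d)\<^sup>2) * sqrt (1 - 1 / (real_of_int d)\<^sup>2) = 1 - 1 / (real_of_int d)\<^sup>2"
proof -
  have "1 \<le> \<bar>d\<bar>" using assms by linarith
  then have "1 \<le> \<bar>real_of_int d\<bar>" by linarith
  then have "1 \<le> (real_of_int d)\<^sup>2" by (metis abs_le_square_iff abs_one one_power2)
  then show ?thesis by (simp add: divide_le_eq)
qed

lemma young_step_involution:
  assumes D: "young_diagram D" and T: "T \<in> syt D" and k: "k \<in> {1..<card D}"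
  shows "young_step D k (young_step D k F) T = F T"
proof -
  let ?c = "entry_content D T"
  define d where "d = ?c (Suc k) - ?c k"
  define s where "s = sqrt (1 - 1 / (real_of_int d)\<^sup>2)"
  have d0: "d \<noteq> 0" using entry_content_neq[OF D T, of k "Suc k"] k by (auto simp: d_def)
  \<comment> \<open>The exchange reverses the sign of the axial distance, so the mixed terms cancel
    and 1 / d^2 plus the square of \<open>s\<close> remains.\<close>
  have dS: "entry_content D (adj_transp k \<circ> T) (Suc k) - entry_content D (adj_transp k \<circ> T) k = - d"
    using entry_content_transp[OF syt_bij[OF T] k, of k] entry_content_transp[OF syt_bij[OF T] k, of "Suc k"] k
    by (simp add: d_def)
  have "young_step D k (young_step D k F) T =
    (F T / d + s * F (adj_transp k \<circ> T)) / d + s * (F (adj_transp k \<circ> T) / (- d) + s * F T)"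
    unfolding young_step_def[of D k _ T] young_step_def[of D k F "adj_transp k \<circ> T"] Let_def dS d_def[symmetric]
    by (simp add: s_def)
  also have "\<dots> = F T * (1 / (real_of_int d)\<^sup>2 + s * s)"
    by (simp add: power2_eq_square algebra_simps add_divide_distrib)
  also have "s * s = 1 - 1 / (real_of_int d)\<^sup>2" unfolding s_def by (rule sqrt_axial[OF d0])
  finally show ?thesis by simp
qed

lemma adj_transp_commute:
  assumes "k + 2 \<le> j"
  shows "adj_transp j \<circ> (adj_transp k \<circ> T) = adj_transp k \<circ> (adj_transp j \<circ> T)"
  using assms by (auto simp: fun_eq_iff adj_transp_eq)

lemma adj_transp_braid:
  "adj_transp k \<circ> (adj_transp (Suc k) \<circ> (adj_transp k \<circ> T)) =
   adj_transp (Suc k) \<circ> (adj_transp k \<circ> (adj_transp (Suc k) \<circ> T))"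
  by (auto simp: fun_eq_iff adj_transp_eq)

lemma young_step_commute:
  assumes D: "young_diagram D" and T: "T \<in> syt D" and k: "k \<in> {1..<card D}"
    and j: "j \<in> {1..<card D}" and kj: "k + 2 \<le> j"
  shows "young_step D j (young_step D k F) T = young_step D k (young_step D j F) T"
proof -
  have "entry_content D (adj_transp k \<circ> T) j = entry_content D T j"
    "entry_content D (adj_transp k \<circ> T) (Suc j) = entry_content D T (Suc j)"
    "entry_content D (adj_transp j \<circ> T) k = entry_content D T k"
    "entry_content D (adj_transp j \<circ> T) (Suc k) = entry_content D T (Suc k)"
    using entry_content_transp[OF syt_bij[OF T] k] entry_content_transp[OF syt_bij[OF T] j] k j kj
    by auto
  then show ?thesis
    by (simp add: young_step_def Let_def adj_transp_commute[OF kj] algebra_simps add_divide_distrib)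
qed

text \<open>Here \<open>u\<close>, \<open>v\<close>, \<open>w\<close> stand for the inverse axial
  distances 1 / x, 1 / y, 1 / (x + y), which satisfy \<open>rel\<close>; \<alpha>, \<beta>, \<gamma>
  are the square roots attached to them, and \<open>f0\<close> to \<open>f121\<close> the values of
  a function at the six fillings that permute three consecutive entries.\<close>

lemma braid_identity:
  fixes u v w :: real
  assumes rel: "u * v = (u + v) * w" and \<alpha>: "\<alpha> * \<alpha> = 1 - u\<^sup>2" and \<beta>: "\<beta> * \<beta> = 1 - v\<^sup>2"
  shows "((f0 * u + \<alpha> * f1) * v + \<beta> * (f2 * w + \<gamma> * f12)) * u
       + \<alpha> * ((- f1 * u + \<alpha> * f0) * w + \<gamma> * (f21 * v + \<beta> * f121))
     = ((f0 * v + \<beta> * f2) * u + \<alpha> * (f1 * w + \<gamma> * f21)) * v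
       + \<beta> * ((- f2 * v + \<beta> * f0) * w + \<gamma> * (f12 * u + \<alpha> * f121))"
  using assms by algebra

lemma young_step_braid:
  assumes D: "young_diagram D" and T: "T \<in> syt D" and k: "k \<in> {1..<card D}" "Suc k \<in> {1..<card D}"
  shows "young_step D k (young_step D (Suc k) (young_step D k F)) T
       = young_step D (Suc k) (young_step D k (young_step D (Suc k) F)) T"
proof -
  let ?s = "adj_transp k" and ?t = "adj_transp (Suc k)" and ?c = "entry_content D"
  have m: "k \<in> {1..card D}" "Suc k \<in> {1..card D}" "Suc (Suc k) \<in> {1..card D}" using k by auto
  note b = syt_bij[OF T]
  note b1 = bij_adj_transp_comp[OF b k(1)] and b2 = bij_adj_transp_comp[OF b k(2)]
  note sw = entry_content_transp[OF b k(1)] entry_content_transp[OF b k(2)]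
    entry_content_transp[OF b1 k(2)] entry_content_transp[OF b2 k(1)]
  define x y where "x = real_of_int (?c T (Suc k) - ?c T k)"
    and "y = real_of_int (?c T (Suc (Suc k)) - ?c T (Suc k))"
  have z: "real_of_int (?c T (Suc (Suc k)) - ?c T k) = x + y" by (simp add: x_def y_def)
  have nz: "x \<noteq> 0" "y \<noteq> 0" "x + y \<noteq> 0"
    using entry_content_neq[OF D T m(1,2)] entry_content_neq[OF D T m(2,3)] entry_content_neq[OF D T m(1,3)]
    unfolding z[symmetric] by (auto simp: x_def y_def)
  define S where "S d = sqrt (1 - 1 / d\<^sup>2)" for d :: real
  have Sm: "S (- d) = S d" for d by (simp add: S_def)
  have Sx: "S x * S x = 1 - (1 / x)\<^sup>2" and Sy: "S y * S y = 1 - (1 / y)\<^sup>2"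
    using sqrt_axial[of "?c T (Suc k) - ?c T k"] sqrt_axial[of "?c T (Suc (Suc k)) - ?c T (Suc k)"] nz
    unfolding S_def x_def y_def by (auto simp: power_one_over)
  have rel: "(1 / x) * (1 / y) = (1 / x + 1 / y) * (1 / (x + y))" using nz by (simp add: field_simps)
  have step: "young_step D i G R = G R * (1 / d) + S d * G (adj_transp i \<circ> R)"
    if "real_of_int (?c R (Suc i) - ?c R i) = d" for i G R d
    using that by (simp add: young_step_def Let_def S_def)
  \<comment> \<open>The generators permute the contents of the three entries, so every axial
    distance below is x, y or x + y up to sign.\<close>
  have c1: "?c (?s \<circ> T) k = ?c T (Suc k)" "?c (?s \<circ> T) (Suc k) = ?c T k"
      "?c (?s \<circ> T) (Suc (Suc k)) = ?c T (Suc (Suc k))"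
    and c2: "?c (?t \<circ> T) k = ?c T k" "?c (?t \<circ> T) (Suc k) = ?c T (Suc (Suc k))"
      "?c (?t \<circ> T) (Suc (Suc k)) = ?c T (Suc k)"
    using sw(1,2) m by auto
  have c21: "?c (?t \<circ> (?s \<circ> T)) k = ?c T (Suc k)" "?c (?t \<circ> (?s \<circ> T)) (Suc k) = ?c T (Suc (Suc k))"
    and c12: "?c (?s \<circ> (?t \<circ> T)) (Suc k) = ?c T k" "?c (?s \<circ> (?t \<circ> T)) (Suc (Suc k)) = ?c T (Suc k)"
    using sw(3)[OF m(1)] sw(3)[OF m(2)] sw(4)[OF m(2)] sw(4)[OF m(3)] c1 c2 by auto
  have T1: "young_step D k G T = G T * (1 / x) + S x * G (?s \<circ> T)" for G
    by (rule step) (simp add: x_def)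
  have T2: "young_step D (Suc k) G T = G T * (1 / y) + S y * G (?t \<circ> T)" for G
    by (rule step) (simp add: y_def)
  have s1: "young_step D k G (?s \<circ> T) = - G (?s \<circ> T) * (1 / x) + S x * G T" for G
  proof -
    have "real_of_int (?c (?s \<circ> T) (Suc k) - ?c (?s \<circ> T) k) = - x" by (simp add: c1 x_def)
    from step[OF this, of G] show ?thesis by (simp add: Sm)
  qed
  have s2: "young_step D (Suc k) G (?s \<circ> T) = G (?s \<circ> T) * (1 / (x + y)) + S (x + y) * G (?t \<circ> (?s \<circ> T))" for G
  proof -
    have "real_of_int (?c (?s \<circ> T) (Suc (Suc k)) - ?c (?s \<circ> T) (Suc k)) = x + y" by (simp add: c1 x_def y_def)
    from step[OF this, of G] show ?thesis by (simp add: Sm)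
  qed
  have t1: "young_step D k G (?t \<circ> T) = G (?t \<circ> T) * (1 / (x + y)) + S (x + y) * G (?s \<circ> (?t \<circ> T))" for G
  proof -
    have "real_of_int (?c (?t \<circ> T) (Suc k) - ?c (?t \<circ> T) k) = x + y" by (simp add: c2 x_def y_def)
    from step[OF this, of G] show ?thesis by (simp add: Sm)
  qed
  have t2: "young_step D (Suc k) G (?t \<circ> T) = - G (?t \<circ> T) * (1 / y) + S y * G T" for G
  proof -
    have "real_of_int (?c (?t \<circ> T) (Suc (Suc k)) - ?c (?t \<circ> T) (Suc k)) = - y" by (simp add: c2 y_def)
    from step[OF this, of G] show ?thesis by (simp add: Sm)
  qed
  have ts1: "young_step D k G (?t \<circ> (?s \<circ> T)) = G (?t \<circ> (?s \<circ> T)) * (1 / y) + S y * G (?s \<circ> (?t \<circ> (?s \<circ> T)))" for G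
  proof -
    have "real_of_int (?c (?t \<circ> (?s \<circ> T)) (Suc k) - ?c (?t \<circ> (?s \<circ> T)) k) = y" by (simp add: c21 y_def)
    from step[OF this, of G] show ?thesis by (simp add: Sm)
  qed
  have st2: "young_step D (Suc k) G (?s \<circ> (?t \<circ> T)) = G (?s \<circ> (?t \<circ> T)) * (1 / x) + S x * G (?s \<circ> (?t \<circ> (?s \<circ> T)))" for G
  proof -
    have "real_of_int (?c (?s \<circ> (?t \<circ> T)) (Suc (Suc k)) - ?c (?s \<circ> (?t \<circ> T)) (Suc k)) = x" by (simp add: c12 x_def)
    from step[OF this, of G] show ?thesis by (simp add: Sm adj_transp_braid)
  qed
  show ?thesis
    unfolding T1 T2 s1 s2 t1 t2 ts1 st2 by (rule braid_identity[OF rel Sx Sy])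
qed

section \<open>Words and Coxeter relations\<close>

lemma axial_dist_eq:
  "axial_dist \<nu> T a b = entry_content (diagram \<nu>) T a - entry_content (diagram \<nu>) T b"
  by (simp add: axial_dist_def entry_content_def box_of_def)

lemma finite_Tab: "finite (Tab \<nu>)"
  by (simp add: Tab_eq_syt finite_syt finite_diagram)

lemma axial_dist_transp:
  assumes T: "T \<in> Tab \<nu>" and k: "k \<in> {1..<sum_list \<nu>}"
  shows "axial_dist \<nu> (adj_transp k \<circ> T) (Suc k) k = - axial_dist \<nu> T (Suc k) k"
proof -
  have b: "bij_betw T (diagram \<nu>) {1..card (diagram \<nu>)}" and k': "k \<in> {1..<card (diagram \<nu>)}"
    using T k syt_bij[of T "diagram \<nu>"] by (auto simp: Tab_eq_syt card_diagram)
  then show ?thesis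
    using entry_content_transp[OF b k', of k] entry_content_transp[OF b k', of "Suc k"]
    by (simp add: axial_dist_eq)
qed

lemma adj_transp_comp_neq:
  assumes "T \<in> Tab \<nu>" "k \<in> {1..<sum_list \<nu>}"
  shows "adj_transp k \<circ> T \<noteq> T"
proof
  assume eq: "adj_transp k \<circ> T = T"
  have "k \<in> T ` diagram \<nu>"
    using assms by (auto simp: Tab_def bij_betw_def)
  then obtain x where "T x = k" by auto
  then show False using fun_cong[OF eq, of x] by simp
qed

text \<open>Column \<open>T\<close> of the generator uses the distance in \<open>T\<close>, while
  \<open>young_step\<close> reads row \<open>S\<close>. The two agree because the exchange only
  changes the sign of the distance, which enters the off-diagonal entries squared.\<close>

lemma young_gen_comp:
  assumes D: "young_diagram (diagram \<nu>)" and k: "k \<in> {1..<sum_list \<nu>}"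
  shows "op_comp (Tab \<nu>) (young_gen \<nu> k) A S R =
    (if S \<in> Tab \<nu> then young_step (diagram \<nu>) k (\<lambda>T. A T R) S else 0)"
proof (cases "S \<in> Tab \<nu>")
  case False
  then show ?thesis by (simp add: op_comp_def young_gen_def)
next
  case S: True
  let ?s = "adj_transp k \<circ> S" and ?G = "\<lambda>T. young_gen \<nu> k S T * A T R"
  let ?d = "real_of_int (axial_dist \<nu> S (Suc k) k)"
  have ne: "?s \<noteq> S" by (rule adj_transp_comp_neq[OF S k])
  have zero: "?G T = 0" if "T \<in> Tab \<nu>" "T \<noteq> S" "T \<noteq> ?s" for T
  proof -
    have "S \<noteq> adj_transp k \<circ> T" using that by auto
    then show ?thesis using that by (simp add: young_gen_def Let_def)
  qed
  have gS: "?G S = A S R / ?d" using S by (simp add: young_gen_def)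
  have step: "young_step (diagram \<nu>) k (\<lambda>T. A T R) S = ?G S + sqrt (1 - 1 / ?d\<^sup>2) * A ?s R"
    by (simp add: young_step_def Let_def gS axial_dist_eq)
  show ?thesis
  proof (cases "?s \<in> Tab \<nu>")
    case True
    have "op_comp (Tab \<nu>) (young_gen \<nu> k) A S R = sum ?G {S, ?s}"
      unfolding op_comp_def using S True finite_Tab zero
      by (intro sum.mono_neutral_right) auto
    also have "\<dots> = ?G S + ?G ?s" using ne by simp
    also have "?G ?s = sqrt (1 - 1 / ?d\<^sup>2) * A ?s R"
      using S True ne axial_dist_transp[OF S k] by (simp add: young_gen_def)
    finally show ?thesis using step S by simp
  next
    case False
    have "op_comp (Tab \<nu>) (young_gen \<nu> k) A S R = sum ?G {S}"
      unfolding op_comp_def using S False finite_Tab zero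
      by (intro sum.mono_neutral_right) auto
    \<comment> \<open>A non-standard neighbour has no row in the matrix; giving it the value 0 is
      harmless by \<open>young_step_cong\<close>.\<close>
    also have "\<dots> = young_step (diagram \<nu>) k (\<lambda>T. if T = ?s then 0 else A T R) S"
      using ne by (simp add: young_step_def Let_def gS axial_dist_eq)
    also have "\<dots> = young_step (diagram \<nu>) k (\<lambda>T. A T R) S"
      using D S k False by (intro young_step_cong) (auto simp: Tab_eq_syt card_diagram)
    finally show ?thesis using S by simp
  qed
qed

lemma word_op_Cons: "word_op \<nu> (k # w) = op_comp (Tab \<nu>) (young_gen \<nu> k) (word_op \<nu> w)"
  by (simp add: word_op_def)

lemma word_op_Nil: "word_op \<nu> [] = op_scalar (Tab \<nu>) 1"
  by (simp add: word_op_def)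

text \<open>Vanishing outside the tableaux lets identities of operators be equalities of functions,
  which can be rewritten inside products.\<close>

lemma word_op_zero: "S \<notin> Tab \<nu> \<or> R \<notin> Tab \<nu> \<Longrightarrow> word_op \<nu> w S R = 0"
proof (induction w arbitrary: S)
  case Nil
  then show ?case by (auto simp: word_op_Nil op_scalar_def)
next
  case (Cons k w)
  then show ?case by (cases "R \<in> Tab \<nu>") (auto simp: word_op_Cons op_comp_def young_gen_def)
qed

lemma op_scalar_comp:
  assumes "finite X" "\<And>x y. x \<notin> X \<Longrightarrow> A x y = 0"
  shows "op_comp X (op_scalar X c) A = (\<lambda>x y. c * A x y)"
proof (intro ext)
  fix x y
  show "op_comp X (op_scalar X c) A x y = c * A x y"
    using assms(2)[of x y] op_comp_scalar_left[OF assms(1), of x c A y]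
    by (cases "x \<in> X") (auto simp: op_comp_def op_scalar_def intro!: sum.neutral)
qed

lemma op_comp_scalar:
  assumes "finite X" "\<And>x y. x \<notin> X \<Longrightarrow> A y x = 0"
  shows "op_comp X A (op_scalar X c) = (\<lambda>x y. c * A x y)"
proof -
  have "op_comp X A (op_scalar X c) = op_adj (op_comp X (op_scalar X c) (op_adj A))"
    by (simp add: op_adj_comp op_adj_scalar)
  also have "\<dots> = op_adj (\<lambda>x y. c * op_adj A x y)"
    using assms by (subst op_scalar_comp) (auto simp: op_adj_def)
  finally show ?thesis by (simp add: op_adj_def)
qed

lemma word_op_append: "word_op \<nu> (u @ w) = op_comp (Tab \<nu>) (word_op \<nu> u) (word_op \<nu> w)"
proof (induction u)
  case Nil
  then show ?case using op_scalar_comp[OF finite_Tab, of \<nu> "word_op \<nu> w" 1]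
    by (simp add: word_op_Nil word_op_zero)
qed (simp add: word_op_Cons op_comp_assoc)

lemma word_op_single: "word_op \<nu> [k] = young_gen \<nu> k"
  using op_comp_scalar[OF finite_Tab, of \<nu> "young_gen \<nu> k" 1]
  by (simp add: word_op_Cons word_op_Nil young_gen_def)

lemma op_adj_young_gen:
  assumes k: "k \<in> {1..<sum_list \<nu>}"
  shows "op_adj (young_gen \<nu> k) = young_gen \<nu> k"
proof (intro ext)
  fix S T :: tableau
  have "S = adj_transp k \<circ> T \<longleftrightarrow> T = adj_transp k \<circ> S" by (metis adj_transp_simps(4))
  then show "op_adj (young_gen \<nu> k) S T = young_gen \<nu> k S T"
    using axial_dist_transp[OF _ k, of T] by (auto simp: op_adj_def young_gen_def Let_def)
qed

lemma op_adj_word_op: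
  assumes "set w \<subseteq> {1..<sum_list \<nu>}"
  shows "op_adj (word_op \<nu> w) = word_op \<nu> (rev w)"
  using assms
proof (induction w)
  case Nil
  then show ?case by (simp add: word_op_Nil op_adj_scalar)
next
  case (Cons k w)
  then show ?case
    by (simp add: word_op_Cons[of \<nu> k w] op_adj_comp op_adj_young_gen word_op_append word_op_single)
qed

text \<open>Relates words instead of permutations, so that the words chosen inside
  \<open>young_rep\<close> can be rewritten. The relations carry a free right context
  \<open>w\<close>; left contexts arise letter by letter from \<open>Gen\<close>.\<close>

inductive coxeter_eq :: "nat \<Rightarrow> nat list \<Rightarrow> nat list \<Rightarrow> bool" for n where
  Refl: "coxeter_eq n w w"
| Sym: "coxeter_eq n u w \<Longrightarrow> coxeter_eq n w u"
| Trans: "coxeter_eq n u v \<Longrightarrow> coxeter_eq n v w \<Longrightarrow> coxeter_eq n u w"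
| Gen: "k \<in> {1..<n} \<Longrightarrow> coxeter_eq n u w \<Longrightarrow> coxeter_eq n (k # u) (k # w)"
| Square: "k \<in> {1..<n} \<Longrightarrow> coxeter_eq n (k # k # w) w"
| Commute: "k \<in> {1..<n} \<Longrightarrow> j \<in> {1..<n} \<Longrightarrow> k + 2 \<le> j \<Longrightarrow> coxeter_eq n (j # k # w) (k # j # w)"
| Braid: "k \<in> {1..<n} \<Longrightarrow> Suc k \<in> {1..<n} \<Longrightarrow>
    coxeter_eq n (k # Suc k # k # w) (Suc k # k # Suc k # w)"

declare coxeter_eq.Trans [trans]

lemma coxeter_eq_mono:
  assumes "coxeter_eq n u w" and le: "n \<le> m"
  shows "coxeter_eq m u w"
  using assms(1)
proof (induction rule: coxeter_eq.induct)
  case (Sym u w)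
  from Sym.IH show ?case by (rule coxeter_eq.Sym)
next
  case (Trans u v w)
  from Trans.IH show ?case by (rule coxeter_eq.Trans)
qed (use le in \<open>auto intro: coxeter_eq.Refl coxeter_eq.Gen coxeter_eq.Square coxeter_eq.Commute coxeter_eq.Braid\<close>)

lemma coxeter_eq_append: "coxeter_eq n u w \<Longrightarrow> coxeter_eq n (u @ v) (w @ v)"
proof (induction rule: coxeter_eq.induct)
  case (Sym u w)
  from Sym.IH show ?case by (rule coxeter_eq.Sym)
next
  case (Trans u v w)
  from Trans.IH show ?case by (rule coxeter_eq.Trans)
qed (auto intro: coxeter_eq.Refl coxeter_eq.Gen coxeter_eq.Square coxeter_eq.Commute coxeter_eq.Braid)

lemma coxeter_eq_prepend: "set v \<subseteq> {1..<n} \<Longrightarrow> coxeter_eq n u w \<Longrightarrow> coxeter_eq n (v @ u) (v @ w)"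
  by (induction v) (auto intro: coxeter_eq.Gen)

lemma coxeter_eq_shift:
  assumes "j \<in> {1..<n}" "set u \<subseteq> {1..<j - 1}"
  shows "coxeter_eq n (j # u @ w) (u @ j # w)"
  using assms(2)
proof (induction u)
  case Nil
  then show ?case by (simp add: coxeter_eq.Refl)
next
  case (Cons k u)
  then have k: "k \<in> {1..<n}" "k + 2 \<le> j" using assms(1) by auto
  have "coxeter_eq n (j # k # u @ w) (k # j # u @ w)"
    by (rule coxeter_eq.Commute[OF k(1) assms(1) k(2)])
  also have "coxeter_eq n (k # j # u @ w) (k # u @ j # w)"
    using Cons k(1) by (intro coxeter_eq.Gen) auto
  finally show ?case by simp
qed

text \<open>The two middle letters are equal and cancel, so reversal inverts a word.\<close>

lemma coxeter_rev: "set w \<subseteq> {1..<n} \<Longrightarrow> coxeter_eq n (rev w @ w) []"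
proof (induction w)
  case (Cons k w)
  have "coxeter_eq n (rev w @ (k # k # w)) (rev w @ w)"
    using Cons.prems by (intro coxeter_eq_prepend coxeter_eq.Square) auto
  also have "coxeter_eq n (rev w @ w) []" using Cons by simp
  finally show ?case by simp
qed (simp add: coxeter_eq.Refl)

text \<open>The decomposition of the symmetric group on \<open>{1..Suc n}\<close> into two double cosets of the
  stabilizer of \<open>Suc n\<close>, at the level of words.\<close>

lemma coxeter_double_coset:
  assumes "set w \<subseteq> {1..<Suc n}"
  shows "(\<exists>u. set u \<subseteq> {1..<n} \<and> coxeter_eq (Suc n) w u) \<or>
         (\<exists>u v. set u \<subseteq> {1..<n} \<and> set v \<subseteq> {1..<n} \<and> 1 \<le> n \<and> coxeter_eq (Suc n) w (u @ n # v))"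
  using assms
proof (induction n arbitrary: w)
  case 0
  then show ?case by (auto intro: coxeter_eq.Refl)
next
  case (Suc n)
  let ?N = "Suc (Suc n)"
  have N: "Suc n \<in> {1..<?N}" by auto
  show ?case using Suc.prems
  proof (induction w)
    case Nil
    then show ?case by (auto intro!: exI[of _ "[]"] coxeter_eq.Refl)
  next
    case (Cons k w)
    have k: "k \<in> {1..<?N}" and sub: "set w \<subseteq> {1..<?N}" using Cons.prems by auto
    show ?case
    proof (cases "k < Suc n")
      case True
      from Cons.IH[OF sub] show ?thesis
      proof (elim disjE exE conjE)
        fix u assume u: "set u \<subseteq> {1..<Suc n}" "coxeter_eq ?N w u"
        then have "set (k # u) \<subseteq> {1..<Suc n}" "coxeter_eq ?N (k # w) (k # u)"
          using k True by (auto intro: coxeter_eq.Gen)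
        then show ?thesis by blast
      next
        fix u v assume u: "set u \<subseteq> {1..<Suc n}" "set v \<subseteq> {1..<Suc n}" "coxeter_eq ?N w (u @ Suc n # v)"
        then have "set (k # u) \<subseteq> {1..<Suc n}" "coxeter_eq ?N (k # w) ((k # u) @ Suc n # v)"
          using k True by (auto intro: coxeter_eq.Gen)
        moreover have "1 \<le> Suc n" by simp
        ultimately show ?thesis using u(2) by blast
      qed
    next
      case False
      then have kn: "k = Suc n" using k by auto
      from Cons.IH[OF sub] show ?thesis
      proof (elim disjE exE conjE)
        fix u assume u: "set u \<subseteq> {1..<Suc n}" "coxeter_eq ?N w u"
        then have "coxeter_eq ?N (k # w) ([] @ Suc n # u)" using k kn by (auto intro: coxeter_eq.Gen)
        then show ?thesis using u(1) by (intro disjI2 exI[of _ "[]"] exI[of _ u]) auto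
      next
        fix u v assume u: "set u \<subseteq> {1..<Suc n}" "set v \<subseteq> {1..<Suc n}" "coxeter_eq ?N w (u @ Suc n # v)"
        have w: "coxeter_eq ?N (k # w) (Suc n # u @ Suc n # v)"
          unfolding kn by (rule coxeter_eq.Gen[OF N u(3)])
        \<comment> \<open>Two letters \<open>Suc n\<close> enclose \<open>u\<close>, and the outer
          induction hypothesis leaves at most one letter \<open>n\<close> in
          \<open>u\<close>.\<close>
        from Suc.IH[OF u(1)] show ?thesis
        proof (elim disjE exE conjE)
          \<comment> \<open>Without a letter \<open>n\<close>, the first \<open>Suc n\<close> passes
            \<open>u'\<close> and cancels the second.\<close>
          fix u' assume u': "set u' \<subseteq> {1..<n}" "coxeter_eq (Suc n) u u'"
          have sub': "set u' \<subseteq> {1..<?N}" using u' by auto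
          note w
          also have "coxeter_eq ?N (Suc n # u @ Suc n # v) (Suc n # u' @ Suc n # v)"
            using N u'(2) by (intro coxeter_eq.Gen coxeter_eq_append) (auto intro: coxeter_eq_mono)
          also have "coxeter_eq ?N (Suc n # u' @ Suc n # v) (u' @ Suc n # Suc n # v)"
            using coxeter_eq_shift[OF N] u'(1) by simp
          also have "coxeter_eq ?N (u' @ Suc n # Suc n # v) (u' @ v)"
            using sub' N by (intro coxeter_eq_prepend coxeter_eq.Square)
          finally have "coxeter_eq ?N (k # w) (u' @ v)" .
          moreover have "set (u' @ v) \<subseteq> {1..<Suc n}" using u' u by auto
          ultimately show ?thesis by blast
        next
          \<comment> \<open>With one letter \<open>n\<close>, both copies of \<open>Suc n\<close>
            move next to it, and the braid relation leaves a single \<open>Suc n\<close>.\<close>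
          fix u' v' assume u': "set u' \<subseteq> {1..<n}" "set v' \<subseteq> {1..<n}" "1 \<le> n"
            "coxeter_eq (Suc n) u (u' @ n # v')"
          have sub': "set u' \<subseteq> {1..<?N}" using u' by auto
          have n: "n \<in> {1..<?N}" using u' by auto
          note w
          also have "coxeter_eq ?N (Suc n # u @ Suc n # v) (Suc n # (u' @ n # v') @ Suc n # v)"
            using N u'(4) by (intro coxeter_eq.Gen coxeter_eq_append) (auto intro: coxeter_eq_mono)
          also have "coxeter_eq ?N (Suc n # (u' @ n # v') @ Suc n # v)
              (u' @ Suc n # (n # v' @ Suc n # v))"
            using coxeter_eq_shift[OF N, of u' "n # v' @ Suc n # v"] u'(1) by simp
          also have "coxeter_eq ?N (u' @ Suc n # (n # v' @ Suc n # v)) (u' @ Suc n # (n # Suc n # v' @ v))"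
          proof -
            have "coxeter_eq ?N (v' @ Suc n # v) (Suc n # v' @ v)"
              using coxeter_eq_shift[OF N, of v' v] u'(2) by (auto intro: coxeter_eq.Sym)
            then show ?thesis using sub' N n by (intro coxeter_eq_prepend coxeter_eq.Gen)
          qed
          also have "coxeter_eq ?N (u' @ Suc n # (n # Suc n # v' @ v)) (u' @ n # (Suc n # n # v' @ v))"
            using sub' N n by (intro coxeter_eq_prepend coxeter_eq.Sym[OF coxeter_eq.Braid])
          finally have "coxeter_eq ?N (k # w) (u' @ n # (Suc n # n # v' @ v))" .
          then have "coxeter_eq ?N (k # w) ((u' @ [n]) @ Suc n # (n # v' @ v))" by simp
          moreover have "set (u' @ [n]) \<subseteq> {1..<Suc n}" "set (n # v' @ v) \<subseteq> {1..<Suc n}" "1 \<le> Suc n"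
            using u' u by auto
          ultimately show ?thesis by blast
        qed
      qed
    qed
  qed
qed

section \<open>Permutations spelled by words, and operators of equivalent words\<close>

lemma word_perm_Cons: "word_perm (k # w) = adj_transp k \<circ> word_perm w"
  by (simp add: word_perm_def)

lemma word_perm_Nil: "word_perm [] = id"
  by (simp add: word_perm_def)

lemma word_perm_append: "word_perm (u @ w) = word_perm u \<circ> word_perm w"
  by (induction u) (auto simp: word_perm_Cons word_perm_Nil)

lemma word_perm_coxeter: "coxeter_eq n u w \<Longrightarrow> word_perm u = word_perm w"
  by (induction rule: coxeter_eq.induct)
     (auto simp: word_perm_Cons adj_transp_commute adj_transp_braid)

lemma word_perm_rev: "word_perm (rev w) (word_perm w m) = m"
  by (induction w arbitrary: m) (auto simp: word_perm_Cons word_perm_Nil word_perm_append)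

lemma word_perm_fix: "set w \<subseteq> {1..<n} \<Longrightarrow> n < m \<Longrightarrow> word_perm w m = m"
  by (induction w) (auto simp: word_perm_Cons word_perm_Nil adj_transp_eq)

lemma word_perm_permutes: "set w \<subseteq> {1..<n} \<Longrightarrow> word_perm w permutes {1..n}"
proof (induction w)
  case Nil
  show ?case unfolding word_perm_Nil by (rule permutes_id)
next
  case (Cons k w)
  have "adj_transp k permutes {1..n}"
    using Cons.prems by (auto simp: adj_transp_def intro: permutes_swap_id)
  then show ?case unfolding word_perm_Cons using Cons by (intro permutes_compose) auto
qed

lemma word_perm_upt: "k \<le> n \<Longrightarrow> word_perm [k..<n] n = k"
proof (induction "n - k" arbitrary: k)
  case 0
  then show ?case by (simp add: word_perm_Nil)
next
  case (Suc d)
  then have "[k..<n] = k # [Suc k..<n]" by (simp add: upt_conv_Cons)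
  then show ?case using Suc by (simp add: word_perm_Cons)
qed

text \<open>Composing with the inverse of the cycle spelled by \<open>[k..<Suc n]\<close>, where
  \<open>k\<close> is the image of \<open>Suc n\<close>, makes \<open>Suc n\<close> a fixed
  point.\<close>

lemma ex_word_perm:
  assumes "\<sigma> permutes {1..n}"
  shows "\<exists>w. set w \<subseteq> {1..<n} \<and> word_perm w = \<sigma>"
  using assms
proof (induction n arbitrary: \<sigma>)
  case 0
  then show ?case by (auto simp: word_perm_Nil)
next
  case (Suc n)
  let ?k = "\<sigma> (Suc n)"
  have k: "?k \<in> {1..Suc n}" using permutes_in_image[OF Suc.prems, of "Suc n"] by auto
  obtain v where sv: "set v \<subseteq> {1..<Suc n}" and v: "word_perm v (Suc n) = ?k"
    using word_perm_upt[of ?k "Suc n"] k by (intro that[of "[?k..<Suc n]"]) auto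
  define \<tau> where "\<tau> = word_perm (rev v) \<circ> \<sigma>"
  have \<tau>: "\<tau> permutes {1..Suc n}"
    unfolding \<tau>_def using sv by (intro permutes_compose[OF Suc.prems] word_perm_permutes) auto
  have "\<tau> (Suc n) = Suc n" using word_perm_rev[of v "Suc n"] v by (simp add: \<tau>_def)
  moreover have "x = Suc n" if "x \<in> {1..Suc n} - {1..n}" for x using that by auto
  ultimately have "\<tau> permutes {1..n}" using permutes_superset[OF \<tau>] by blast
  then obtain w where w: "set w \<subseteq> {1..<n}" "word_perm w = \<tau>" using Suc.IH by blast
  have "word_perm (v @ w) = \<sigma>"
    using word_perm_rev[of "rev v"] by (simp add: word_perm_append w \<tau>_def fun_eq_iff)
  moreover have "set (v @ w) \<subseteq> {1..<Suc n}" using sv w by auto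
  ultimately show ?case by blast
qed

lemma word_op_step:
  assumes D: "young_diagram (diagram \<nu>)" and k: "k \<in> {1..<sum_list \<nu>}" and S: "S \<in> Tab \<nu>"
    and w: "\<And>T. T \<in> Tab \<nu> \<Longrightarrow> word_op \<nu> w T R = F T"
  shows "word_op \<nu> (k # w) S R = young_step (diagram \<nu>) k F S"
proof -
  have "word_op \<nu> (k # w) S R = young_step (diagram \<nu>) k (\<lambda>T. word_op \<nu> w T R) S"
    using S by (simp add: word_op_Cons young_gen_comp[OF D k])
  also have "\<dots> = young_step (diagram \<nu>) k F S"
    using D S k w by (intro young_step_cong) (auto simp: Tab_eq_syt card_diagram)
  finally show ?thesis .
qed

text \<open>Each relation reduces to an identity for \<open>young_step\<close> at standard tableaux.
  Whatever word \<open>young_rep\<close> has chosen may now be replaced by an equivalent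
  one.\<close>

lemma word_op_coxeter:
  assumes "coxeter_eq n u w" and D: "young_diagram (diagram \<nu>)" and n: "sum_list \<nu> = n"
  shows "word_op \<nu> u = word_op \<nu> w"
  using assms(1)
proof (induction rule: coxeter_eq.induct)
  case square: (Square k w)
  show ?case
  proof (intro ext)
    fix S R
    show "word_op \<nu> (k # k # w) S R = word_op \<nu> w S R"
    proof (cases "S \<in> Tab \<nu>")
      case True
      have "word_op \<nu> (k # k # w) S R =
         young_step (diagram \<nu>) k (young_step (diagram \<nu>) k (\<lambda>T. word_op \<nu> w T R)) S"
        using D square n True by (intro word_op_step) auto
      then show ?thesis using young_step_involution[OF D] True square n
        by (simp add: Tab_eq_syt card_diagram)
    qed (simp add: word_op_zero)
  qed
next
  case commute: (Commute k j w)
  show ?case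
  proof (intro ext)
    fix S R
    let ?F = "\<lambda>T. word_op \<nu> w T R"
    show "word_op \<nu> (j # k # w) S R = word_op \<nu> (k # j # w) S R"
    proof (cases "S \<in> Tab \<nu>")
      case True
      have "word_op \<nu> (j # k # w) S R = young_step (diagram \<nu>) j (young_step (diagram \<nu>) k ?F) S"
        using D commute n True by (intro word_op_step) auto
      moreover have "word_op \<nu> (k # j # w) S R = young_step (diagram \<nu>) k (young_step (diagram \<nu>) j ?F) S"
        using D commute n True by (intro word_op_step) auto
      ultimately show ?thesis using young_step_commute[OF D, of S k j ?F] True commute n
        by (simp add: Tab_eq_syt card_diagram)
    qed (simp add: word_op_zero)
  qed
next
  case braid: (Braid k w)
  show ?case
  proof (intro ext)
    fix S R
    let ?F = "\<lambda>T. word_op \<nu> w T R" and ?A = "young_step (diagram \<nu>)"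
    show "word_op \<nu> (k # Suc k # k # w) S R = word_op \<nu> (Suc k # k # Suc k # w) S R"
    proof (cases "S \<in> Tab \<nu>")
      case True
      have "word_op \<nu> (k # Suc k # k # w) S R = ?A k (?A (Suc k) (?A k ?F)) S"
        using D braid n True by (intro word_op_step) auto
      moreover have "word_op \<nu> (Suc k # k # Suc k # w) S R = ?A (Suc k) (?A k (?A (Suc k) ?F)) S"
        using D braid n True by (intro word_op_step) auto
      ultimately show ?thesis using young_step_braid[OF D, of S k ?F] True braid n
        by (simp add: Tab_eq_syt card_diagram)
    qed (simp add: word_op_zero)
  qed
qed (simp_all add: word_op_Cons)

section \<open>Branching\<close>

definition added_box :: "nat list \<Rightarrow> nat list \<Rightarrow> nat \<times> nat" where
  "added_box \<nu> \<mu> = the_elem (diagram \<nu> - diagram \<mu>)"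

lemma up_setD:
  assumes "\<nu> \<in> up_set \<mu>"
  shows "diagram \<nu> = insert (added_box \<nu> \<mu>) (diagram \<mu>)" "added_box \<nu> \<mu> \<notin> diagram \<mu>"
    "sum_list \<nu> = Suc (sum_list \<mu>)" "young_diagram (diagram \<nu>)" "added_box \<nu> \<mu> \<in> addable (diagram \<mu>)"
proof -
  obtain x where x: "x \<notin> diagram \<mu>" "diagram \<nu> = insert x (diagram \<mu>)"
    and p: "partition_of (sum_list \<mu> + 1) \<nu>"
    using assms by (auto simp: up_set_def)
  have "diagram \<nu> - diagram \<mu> = {x}" using x by auto
  then have a: "added_box \<nu> \<mu> = x" by (simp add: added_box_def)
  show "diagram \<nu> = insert (added_box \<nu> \<mu>) (diagram \<mu>)" "added_box \<nu> \<mu> \<notin> diagram \<mu>"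
    using x a by auto
  show "sum_list \<nu> = Suc (sum_list \<mu>)" using p by (simp add: partition_of_def)
  show "young_diagram (diagram \<nu>)" using p by (rule young_diagram_diagram)
  then show "added_box \<nu> \<mu> \<in> addable (diagram \<mu>)" using x a by (auto simp: addable_def)
qed

text \<open>Parts are positive, so the first column of the diagram determines the length of the
  list.\<close>

lemma partition_eqI:
  assumes p: "partition_of n \<nu>" "partition_of m \<kappa>" and d: "diagram \<nu> = diagram \<kappa>"
  shows "\<nu> = \<kappa>"
proof -
  have len: "i < length \<rho> \<longleftrightarrow> (i, 0) \<in> diagram \<rho>" if "0 \<notin> set \<rho>" for \<rho> i
    using that by (auto simp: diagram_def) (metis gr0I nth_mem)
  have "i < length \<nu> \<longleftrightarrow> i < length \<kappa>" for i
    using len[of \<nu> i] len[of \<kappa> i] p d by (simp add: partition_of_def)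
  then have l: "length \<nu> = length \<kappa>" by (metis linorder_neqE_nat less_irrefl)
  show ?thesis
  proof (rule nth_equalityI[OF l])
    fix i assume i: "i < length \<nu>"
    have "j < \<nu> ! i \<longleftrightarrow> j < \<kappa> ! i" for j
    proof -
      have "(i, j) \<in> diagram \<nu> \<longleftrightarrow> (i, j) \<in> diagram \<kappa>" using d by simp
      then show ?thesis using i l by (simp add: diagram_def)
    qed
    then show "\<nu> ! i = \<kappa> ! i" by (metis linorder_neqE_nat less_irrefl)
  qed
qed

lemma inj_on_added_box: "inj_on (\<lambda>\<nu>. added_box \<nu> \<mu>) (up_set \<mu>)"
proof (rule inj_onI)
  fix \<nu> \<kappa> assume h: "\<nu> \<in> up_set \<mu>" "\<kappa> \<in> up_set \<mu>" "added_box \<nu> \<mu> = added_box \<kappa> \<mu>"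
  then have "diagram \<nu> = diagram \<kappa>" using up_setD(1) by metis
  then show "\<nu> = \<kappa>" using h by (auto simp: up_set_def intro: partition_eqI)
qed

lemma finite_up_set:
  assumes "young_diagram (diagram \<mu>)"
  shows "finite (up_set \<mu>)"
  using finite_addable[OF assms] inj_on_added_box[of \<mu>] up_setD(5)
  by (metis (no_types, lifting) finite_imageD finite_subset image_subsetI)

lemma down_closed_eq_lessThan:
  fixes A :: "nat set"
  assumes fin: "finite A" and down: "\<And>i j. i \<in> A \<Longrightarrow> j \<le> i \<Longrightarrow> j \<in> A"
  shows "A = {..<card A}"
proof -
  define l where "l = (LEAST i. i \<notin> A)"
  have "\<exists>i. i \<notin> A" using fin ex_new_if_finite infinite_UNIV_nat by blast
  then have l: "l \<notin> A" unfolding l_def by (rule LeastI_ex)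
  have "A = {..<l}"
  proof (intro equalityI subsetI)
    fix i assume "i \<in> A"
    then show "i \<in> {..<l}" using l down by (metis lessThan_iff not_less)
  next
    fix i assume "i \<in> {..<l}"
    then show "i \<in> A" unfolding l_def using not_less_Least by auto
  qed
  then show ?thesis by simp
qed

lemma ex_partition_of_diagram:
  assumes D: "young_diagram D"
  obtains \<nu> where "partition_of (card D) \<nu>" "diagram \<nu> = D"
proof -
  define r where "r i = card {j. (i, j) \<in> D}" for i
  define l where "l = card {i. (i, 0) \<in> D}"
  have fin: "finite D" by (rule young_diagram_finite[OF D])
  have fr: "finite {j. (i, j) \<in> D}" for i
    by (rule finite_subset[OF _ finite_imageI[OF fin, of snd]]) force
  have fl: "finite {i. (i, 0) \<in> D}"
    by (rule finite_subset[OF _ finite_imageI[OF fin, of fst]]) force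
  have "{j. (i, j) \<in> D} = {..<r i}" for i
    unfolding r_def using fr by (intro down_closed_eq_lessThan) (auto intro: young_diagramD[OF D])
  then have r: "(i, j) \<in> D \<longleftrightarrow> j < r i" for i j by blast
  have "{i. (i, 0) \<in> D} = {..<l}"
    unfolding l_def using fl by (intro down_closed_eq_lessThan) (auto intro: young_diagramD[OF D])
  then have l: "(i, 0) \<in> D \<longleftrightarrow> i < l" for i by blast
  have mono: "r i \<le> r i'" if "i' \<le> i" for i i'
    unfolding r_def using fr that by (intro card_mono) (auto intro: young_diagramD[OF D])
  let ?\<nu> = "map r [0..<l]"
  have d: "diagram ?\<nu> = D"
  proof (intro set_eqI)
    fix x :: "nat \<times> nat"
    obtain i j where x: "x = (i, j)" by force
    have "j < r i \<Longrightarrow> i < l" using r[of i j] l[of i] young_diagramD[OF D, of i j i 0] by auto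
    then show "x \<in> diagram ?\<nu> \<longleftrightarrow> x \<in> D" using r[of i j] by (auto simp: x diagram_def)
  qed
  have pos: "0 < r i" if "i < l" for i using that l r by blast
  have "sorted_wrt (\<ge>) ?\<nu>" using mono by (auto simp: sorted_wrt_iff_nth_less)
  moreover have "0 \<notin> set ?\<nu>" using pos by force
  moreover have "sum_list ?\<nu> = card D" using card_diagram[of ?\<nu>] d by simp
  ultimately show ?thesis using that[of ?\<nu>] d by (simp add: partition_of_def)
qed

text \<open>With \<open>inj_on_added_box\<close> this identifies \<open>up_set \<mu>\<close> with
  the addable corners, and sets \<open>L\<close> with sets of corners.\<close>

lemma ex_up_set:
  assumes D: "young_diagram (diagram \<mu>)" and x: "x \<in> addable (diagram \<mu>)"
  obtains \<nu> where "\<nu> \<in> up_set \<mu>" "added_box \<nu> \<mu> = x"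
proof -
  obtain \<nu> where \<nu>: "partition_of (card (insert x (diagram \<mu>))) \<nu>" "diagram \<nu> = insert x (diagram \<mu>)"
    using ex_partition_of_diagram[OF young_diagram_addable[OF x]] by blast
  have xn: "x \<notin> diagram \<mu>" using x by (simp add: addable_def)
  then have u: "\<nu> \<in> up_set \<mu>"
    unfolding up_set_def using \<nu> finite_diagram[of \<mu>]
    by (intro CollectI conjI exI[of _ x]) (auto simp: card_diagram)
  moreover have "diagram \<nu> - diagram \<mu> = {x}" using \<nu>(2) xn by auto
  ultimately show ?thesis using that by (simp add: added_box_def)
qed

lemma extend_tab_eq:
  assumes "\<nu> \<in> up_set \<mu>"
  shows "extend_tab \<nu> \<mu> R = R(added_box \<nu> \<mu> := Suc (sum_list \<mu>))"
  using up_setD[OF assms] by (auto simp: extend_tab_def fun_eq_iff)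

lemma extend_tab_in_Tab:
  assumes "\<nu> \<in> up_set \<mu>" "young_diagram (diagram \<mu>)" "R \<in> Tab \<mu>"
  shows "extend_tab \<nu> \<mu> R \<in> Tab \<nu>"
  using syt_extend[OF up_setD(5)[OF assms(1)] assms(2)] assms(3) up_setD(1)[OF assms(1)]
  by (simp add: extend_tab_eq[OF assms(1)] Tab_eq_syt card_diagram)

lemma extend_tab_inject:
  assumes "\<nu> \<in> up_set \<mu>" "R (added_box \<nu> \<mu>) = 0" "R' (added_box \<nu> \<mu>) = 0"
  shows "extend_tab \<nu> \<mu> R = extend_tab \<nu> \<mu> R' \<longleftrightarrow> R = R'"
  unfolding extend_tab_eq[OF assms(1)] using assms(2,3) by (metis fun_upd_triv fun_upd_upd)

lemma Tab_added_box_zero: "\<nu> \<in> up_set \<mu> \<Longrightarrow> R \<in> Tab \<mu> \<Longrightarrow> R (added_box \<nu> \<mu>) = 0"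
  using up_setD(2) syt_zero by (metis Tab_eq_syt)

lemma entry_content_extend:
  assumes \<nu>: "\<nu> \<in> up_set \<mu>" and D: "young_diagram (diagram \<mu>)" and R: "R \<in> Tab \<mu>"
  shows "m \<in> {1..sum_list \<mu>} \<Longrightarrow>
     entry_content (diagram \<nu>) (extend_tab \<nu> \<mu> R) m = entry_content (diagram \<mu>) R m"
    and "entry_content (diagram \<nu>) (extend_tab \<nu> \<mu> R) (Suc (sum_list \<mu>)) = content (added_box \<nu> \<mu>)"
proof -
  have inj: "inj_on (extend_tab \<nu> \<mu> R) (diagram \<nu>)"
    using extend_tab_in_Tab[OF \<nu> D R] by (simp add: Tab_eq_syt syt_inj)
  have "inv_into (diagram \<nu>) (extend_tab \<nu> \<mu> R) (Suc (sum_list \<mu>)) = added_box \<nu> \<mu>"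
    using inj up_setD[OF \<nu>] by (intro inv_into_f_eq) (auto simp: extend_tab_eq[OF \<nu>])
  then show "entry_content (diagram \<nu>) (extend_tab \<nu> \<mu> R) (Suc (sum_list \<mu>)) = content (added_box \<nu> \<mu>)"
    by (simp add: entry_content_def)
  assume m: "m \<in> {1..sum_list \<mu>}"
  have b: "inv_into (diagram \<mu>) R m \<in> diagram \<mu>" "R (inv_into (diagram \<mu>) R m) = m"
    using syt_box[of R "diagram \<mu>" m] R m by (auto simp: Tab_eq_syt card_diagram)
  have "inv_into (diagram \<nu>) (extend_tab \<nu> \<mu> R) m = inv_into (diagram \<mu>) R m"
    using inj up_setD[OF \<nu>] b by (intro inv_into_f_eq) (auto simp: extend_tab_eq[OF \<nu>])
  then show "entry_content (diagram \<nu>) (extend_tab \<nu> \<mu> R) m = entry_content (diagram \<mu>) R m"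
    by (simp add: entry_content_def)
qed

lemma op_comp_Psi1:
  assumes \<nu>: "\<nu> \<in> up_set \<mu>" and D: "young_diagram (diagram \<mu>)"
  shows "op_comp (Tab \<nu>) A (Psi1 \<nu> \<mu>) S R = (if R \<in> Tab \<mu> then A S (extend_tab \<nu> \<mu> R) else 0)"
proof (cases "R \<in> Tab \<mu>")
  case True
  have "op_comp (Tab \<nu>) A (Psi1 \<nu> \<mu>) S R = (\<Sum>T\<in>Tab \<nu>. if T = extend_tab \<nu> \<mu> R then A S T else 0)"
    unfolding op_comp_def Psi1_def using True by (intro sum.cong) auto
  then show ?thesis using True extend_tab_in_Tab[OF \<nu> D True] finite_Tab by simp
qed (simp add: op_comp_def Psi1_def)

lemma op_comp_adj_Psi1:
  assumes "\<nu> \<in> up_set \<mu>" "young_diagram (diagram \<mu>)"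
  shows "op_comp (Tab \<nu>) (op_adj (Psi1 \<nu> \<mu>)) B R x =
    (if R \<in> Tab \<mu> then B (extend_tab \<nu> \<mu> R) x else 0)"
  using op_comp_Psi1[OF assms, of "op_adj B" x R]
  by (simp add: op_comp_def op_adj_def mult.commute)

text \<open>The branching rule: these generators leave the largest entry of \<nu> in place and see
  the same axial distances as in \<mu>.\<close>

lemma Psi1_intertwines_gen:
  assumes \<nu>: "\<nu> \<in> up_set \<mu>" and D: "young_diagram (diagram \<mu>)" and k: "k \<in> {1..<sum_list \<mu>}"
  shows "op_comp (Tab \<nu>) (young_gen \<nu> k) (Psi1 \<nu> \<mu>) = op_comp (Tab \<mu>) (Psi1 \<nu> \<mu>) (young_gen \<mu> k)"
proof (intro ext)
  fix S R :: tableau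
  let ?E = "extend_tab \<nu> \<mu>" and ?x = "added_box \<nu> \<mu>"
  show "op_comp (Tab \<nu>) (young_gen \<nu> k) (Psi1 \<nu> \<mu>) S R = op_comp (Tab \<mu>) (Psi1 \<nu> \<mu>) (young_gen \<mu> k) S R"
  proof (cases "R \<in> Tab \<mu>")
    case False
    then show ?thesis by (simp add: op_comp_def young_gen_def Psi1_def)
  next
    case R: True
    have R0: "R ?x = 0" "(adj_transp k \<circ> R) ?x = 0"
      using Tab_added_box_zero[OF \<nu> R] k by (auto simp: adj_transp_eq)
    have sE: "adj_transp k \<circ> ?E R = ?E (adj_transp k \<circ> R)"
      using k by (auto simp: extend_tab_eq[OF \<nu>] fun_eq_iff adj_transp_eq)
    have dist: "axial_dist \<nu> (?E R) (Suc k) k = axial_dist \<mu> R (Suc k) k"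
      using entry_content_extend(1)[OF \<nu> D R] k by (simp add: axial_dist_eq)
    have L: "op_comp (Tab \<nu>) (young_gen \<nu> k) (Psi1 \<nu> \<mu>) S R = young_gen \<nu> k S (?E R)"
      using R by (simp add: op_comp_Psi1[OF \<nu> D])
    show ?thesis
    proof (cases "\<exists>R'\<in>Tab \<mu>. S = ?E R'")
      case True
      then obtain R' where R': "R' \<in> Tab \<mu>" "S = ?E R'" by blast
      have R'0: "R' ?x = 0" by (rule Tab_added_box_zero[OF \<nu> R'(1)])
      have inj: "?E R' = ?E Q \<longleftrightarrow> R' = Q" if "Q ?x = 0" for Q
        using R'0 that by (intro extend_tab_inject[OF \<nu>])
      have "op_comp (Tab \<mu>) (Psi1 \<nu> \<mu>) (young_gen \<mu> k) S R =
        (\<Sum>Q\<in>Tab \<mu>. if Q = R' then young_gen \<mu> k R' R else 0)"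
        unfolding op_comp_def Psi1_def R'(2)
        using inj Tab_added_box_zero[OF \<nu>] by (intro sum.cong) auto
      also have "\<dots> = young_gen \<mu> k R' R" using R'(1) finite_Tab by simp
      also have "\<dots> = young_gen \<nu> k S (?E R)"
        using extend_tab_in_Tab[OF \<nu> D] R R' inj[of R] inj[of "adj_transp k \<circ> R"] R0 dist
        unfolding young_gen_def sE Let_def by simp
      finally show ?thesis using L by simp
    next
      case False
      have "young_gen \<nu> k S (?E R) = 0"
      proof (rule ccontr)
        assume ne: "young_gen \<nu> k S (?E R) \<noteq> 0"
        then have S: "S \<in> Tab \<nu>" and "S = ?E R \<or> S = adj_transp k \<circ> ?E R"
          by (auto simp: young_gen_def Let_def split: if_splits)
        then have SE: "S = ?E (adj_transp k \<circ> R)" using False R sE by auto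
        \<comment> \<open>Deleting the largest entry of the standard \<open>S\<close> would make
          \<open>adj_transp k \<circ> R\<close> a standard tableau of \<mu>, contrary to the case
          assumption.\<close>
        have "S(?x := 0) \<in> syt (diagram \<nu> - {?x})"
          using S SE up_setD[OF \<nu>]
          by (intro syt_remove(2)) (auto simp: Tab_eq_syt card_diagram finite_diagram extend_tab_eq[OF \<nu>])
        moreover have "S(?x := 0) = adj_transp k \<circ> R"
          using R0(2) unfolding SE extend_tab_eq[OF \<nu>] by (metis fun_upd_triv fun_upd_upd)
        moreover have "diagram \<nu> - {?x} = diagram \<mu>" using up_setD[OF \<nu>] by auto
        ultimately have "adj_transp k \<circ> R \<in> Tab \<mu>" by (simp add: Tab_eq_syt)
        then show False using False SE by blast
      qed
      moreover have "op_comp (Tab \<mu>) (Psi1 \<nu> \<mu>) (young_gen \<mu> k) S R = 0"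
        unfolding op_comp_def Psi1_def using False by (intro sum.neutral) auto
      ultimately show ?thesis using L by simp
    qed
  qed
qed

lemma Psi1_zero:
  assumes "\<nu> \<in> up_set \<mu>" "young_diagram (diagram \<mu>)"
  shows "S \<notin> Tab \<nu> \<or> R \<notin> Tab \<mu> \<Longrightarrow> Psi1 \<nu> \<mu> S R = 0"
  using extend_tab_in_Tab[OF assms] by (auto simp: Psi1_def)

lemma Psi1_intertwines:
  assumes \<nu>: "\<nu> \<in> up_set \<mu>" and D: "young_diagram (diagram \<mu>)" and w: "set w \<subseteq> {1..<sum_list \<mu>}"
  shows "op_comp (Tab \<nu>) (word_op \<nu> w) (Psi1 \<nu> \<mu>) = op_comp (Tab \<mu>) (Psi1 \<nu> \<mu>) (word_op \<mu> w)"
  using w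
proof (induction w)
  case Nil
  have "op_comp (Tab \<nu>) (word_op \<nu> []) (Psi1 \<nu> \<mu>) = Psi1 \<nu> \<mu>"
    unfolding word_op_Nil using Psi1_zero[OF \<nu> D] finite_Tab by (subst op_scalar_comp) auto
  moreover have "op_comp (Tab \<mu>) (Psi1 \<nu> \<mu>) (word_op \<mu> []) = Psi1 \<nu> \<mu>"
    unfolding word_op_Nil using Psi1_zero[OF \<nu> D] finite_Tab by (subst op_comp_scalar) auto
  ultimately show ?case by simp
next
  case (Cons k w)
  have "op_comp (Tab \<nu>) (word_op \<nu> (k # w)) (Psi1 \<nu> \<mu>)
      = op_comp (Tab \<nu>) (young_gen \<nu> k) (op_comp (Tab \<mu>) (Psi1 \<nu> \<mu>) (word_op \<mu> w))"
    using Cons by (simp add: word_op_Cons op_comp_assoc)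
  also have "\<dots> = op_comp (Tab \<mu>) (op_comp (Tab \<mu>) (Psi1 \<nu> \<mu>) (young_gen \<mu> k)) (word_op \<mu> w)"
    using Cons.prems Psi1_intertwines_gen[OF \<nu> D, of k] by (simp add: op_comp_assoc[symmetric])
  finally show ?case by (simp add: word_op_Cons op_comp_assoc)
qed

lemma adj_Psi1_intertwines:
  assumes \<nu>: "\<nu> \<in> up_set \<mu>" and D: "young_diagram (diagram \<mu>)" and w: "set w \<subseteq> {1..<sum_list \<mu>}"
  shows "op_comp (Tab \<nu>) (op_adj (Psi1 \<nu> \<mu>)) (word_op \<nu> w)
       = op_comp (Tab \<mu>) (word_op \<mu> w) (op_adj (Psi1 \<nu> \<mu>))"
proof -
  have w': "set (rev w) \<subseteq> {1..<sum_list \<mu>}" "set (rev w) \<subseteq> {1..<sum_list \<nu>}"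
    using w up_setD(3)[OF \<nu>] by auto
  from arg_cong[OF Psi1_intertwines[OF \<nu> D w'(1)], of op_adj]
  show ?thesis using op_adj_word_op[OF w'(1)] op_adj_word_op[OF w'(2)] by (simp add: op_adj_comp)
qed

section \<open>Gram matrices of the orbit\<close>

text \<open>The diagonal entry of the cross-Gram matrix at a tableau of \<mu> whose largest entry
  has content \<open>c\<close>: inverse axial distances averaged with the squared weights of
  \<open>PsiL\<close>.\<close>

definition corner_coeff :: "nat list set \<Rightarrow> nat list \<Rightarrow> int \<Rightarrow> real" where
  "corner_coeff L \<mu> c =
     (\<Sum>\<nu>\<in>L. real (card (Tab \<nu>)) / real (dimL L) * (1 / real_of_int (content (added_box \<nu> \<mu>) - c)))"

lemma op_comp_adj_entry: "op_comp Y (op_adj A) B x z = (\<Sum>y\<in>Y. A y x * B y z)"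
  by (simp add: op_comp_def op_adj_def)

definition diag_op :: "'x set \<Rightarrow> ('x \<Rightarrow> real) \<Rightarrow> ('x, 'x) opr" where
  "diag_op X d = (\<lambda>y x. if x \<in> X \<and> y = x then d x else 0)"

lemma op_comp_diag: "finite X \<Longrightarrow> op_comp X (diag_op X d) B x y = (if x \<in> X then d x * B x y else 0)"
proof -
  assume fin: "finite X"
  have "op_comp X (diag_op X d) B x y = (\<Sum>z\<in>X. if z = x then d x * B x y else 0)"
    unfolding op_comp_def diag_op_def by (rule sum.cong) auto
  then show ?thesis using fin by simp
qed

lemma op_adj_diag: "op_adj (diag_op X d) = diag_op X d"
  by (auto simp: op_adj_def diag_op_def fun_eq_iff)

lemma op_comp_diag_diag: "finite X \<Longrightarrow> op_comp X (diag_op X d) (diag_op X d) = diag_op X (\<lambda>x. (d x)\<^sup>2)"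
  by (intro ext) (simp add: op_comp_diag, simp add: diag_op_def power2_eq_square)

text \<open>The compression of a word operator to the copy of the space of \<mu> inside that of
  \<nu>.\<close>

definition gram_block :: "nat list \<Rightarrow> nat list \<Rightarrow> nat list \<Rightarrow> (tableau, tableau) opr" where
  "gram_block \<nu> \<mu> w = op_comp (Tab \<nu>) (op_adj (Psi1 \<nu> \<mu>)) (op_comp (Tab \<nu>) (word_op \<nu> w) (Psi1 \<nu> \<mu>))"

lemma gram_block_Nil:
  assumes \<nu>: "\<nu> \<in> up_set \<mu>" and D: "young_diagram (diagram \<mu>)"
  shows "gram_block \<nu> \<mu> [] = op_scalar (Tab \<mu>) 1"
proof (intro ext)
  fix R R' :: tableau
  have "gram_block \<nu> \<mu> [] R R' =
      (if R \<in> Tab \<mu> \<and> R' \<in> Tab \<mu> then op_scalar (Tab \<nu>) 1 (extend_tab \<nu> \<mu> R) (extend_tab \<nu> \<mu> R') else 0)"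
    by (simp add: gram_block_def op_comp_adj_Psi1[OF \<nu> D] op_comp_Psi1[OF \<nu> D] word_op_Nil)
  also have "\<dots> = op_scalar (Tab \<mu>) 1 R R'"
    using extend_tab_in_Tab[OF \<nu> D] extend_tab_inject[OF \<nu>, of R R'] Tab_added_box_zero[OF \<nu>]
    by (auto simp: op_scalar_def)
  finally show "gram_block \<nu> \<mu> [] R R' = op_scalar (Tab \<mu>) 1 R R'" .
qed

text \<open>The off-diagonal part of the last generator moves the largest entry out of the added
  box, hence out of the image of \<open>Psi1\<close>. Only the diagonal part survives the
  compression.\<close>

lemma gram_block_last:
  assumes \<nu>: "\<nu> \<in> up_set \<mu>" and D: "young_diagram (diagram \<mu>)" and m: "sum_list \<mu> = m" "1 \<le> m"
  shows "gram_block \<nu> \<mu> [m] = diag_op (Tab \<mu>)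
    (\<lambda>R. 1 / real_of_int (content (added_box \<nu> \<mu>) - entry_content (diagram \<mu>) R m))"
proof (intro ext)
  fix R R' :: tableau
  let ?E = "extend_tab \<nu> \<mu>"
  have "gram_block \<nu> \<mu> [m] R R' =
      (if R \<in> Tab \<mu> \<and> R' \<in> Tab \<mu> then young_gen \<nu> m (?E R) (?E R') else 0)"
    by (simp add: gram_block_def op_comp_adj_Psi1[OF \<nu> D] op_comp_Psi1[OF \<nu> D] word_op_single)
  also have "\<dots> = diag_op (Tab \<mu>)
    (\<lambda>R. 1 / real_of_int (content (added_box \<nu> \<mu>) - entry_content (diagram \<mu>) R m)) R R'"
  proof (cases "R \<in> Tab \<mu> \<and> R' \<in> Tab \<mu>")
    case False
    then show ?thesis by (auto simp: diag_op_def)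
  next
    case True
    have E: "?E R \<in> Tab \<nu>" "?E R' \<in> Tab \<nu>" using True extend_tab_in_Tab[OF \<nu> D] by auto
    have eq: "?E R = ?E R' \<longleftrightarrow> R = R'"
      using True Tab_added_box_zero[OF \<nu>] by (intro extend_tab_inject[OF \<nu>]) auto
    have "?E R (added_box \<nu> \<mu>) \<noteq> (adj_transp m \<circ> ?E R') (added_box \<nu> \<mu>)"
      by (simp add: extend_tab_eq[OF \<nu>] m)
    then have ne: "?E R \<noteq> adj_transp m \<circ> ?E R'" by metis
    have "axial_dist \<nu> (?E R') (Suc m) m = content (added_box \<nu> \<mu>) - entry_content (diagram \<mu>) R' m"
      using entry_content_extend[OF \<nu> D, of R'] True m by (simp add: axial_dist_eq)
    then show ?thesis using True E eq ne by (simp add: young_gen_def diag_op_def)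
  qed
  finally show "gram_block \<nu> \<mu> [m] R R' = diag_op (Tab \<mu>)
    (\<lambda>R. 1 / real_of_int (content (added_box \<nu> \<mu>) - entry_content (diagram \<mu>) R m)) R R'" .
qed

text \<open>Words that fix the largest entry pass through \<open>Psi1\<close> and its adjoint, and
  so act on the space of \<mu> itself.\<close>

lemma gram_block_conj:
  assumes \<nu>: "\<nu> \<in> up_set \<mu>" and D: "young_diagram (diagram \<mu>)"
    and u: "set u \<subseteq> {1..<sum_list \<mu>}" and v: "set v \<subseteq> {1..<sum_list \<mu>}"
  shows "gram_block \<nu> \<mu> (u @ w @ v) =
    op_comp (Tab \<mu>) (word_op \<mu> u) (op_comp (Tab \<mu>) (gram_block \<nu> \<mu> w) (word_op \<mu> v))"
proof -
  have "gram_block \<nu> \<mu> (u @ w @ v) =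
    op_comp (Tab \<nu>) (op_comp (Tab \<nu>) (op_adj (Psi1 \<nu> \<mu>)) (word_op \<nu> u))
      (op_comp (Tab \<nu>) (word_op \<nu> w) (op_comp (Tab \<nu>) (word_op \<nu> v) (Psi1 \<nu> \<mu>)))"
    by (simp add: gram_block_def word_op_append op_comp_assoc)
  also have "\<dots> = op_comp (Tab \<nu>) (op_comp (Tab \<mu>) (word_op \<mu> u) (op_adj (Psi1 \<nu> \<mu>)))
      (op_comp (Tab \<nu>) (word_op \<nu> w) (op_comp (Tab \<mu>) (Psi1 \<nu> \<mu>) (word_op \<mu> v)))"
    by (simp only: Psi1_intertwines[OF \<nu> D v] adj_Psi1_intertwines[OF \<nu> D u])
  finally show ?thesis by (simp add: gram_block_def op_comp_assoc)
qed

section \<open>Isometries onto the orbit and their cross-Gram matrices\<close>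

definition orbit_isometry ::
  "nat list set \<Rightarrow> nat list \<Rightarrow> (nat \<Rightarrow> nat) \<Rightarrow> (nat list \<times> tableau, tableau) opr" where
  "orbit_isometry L \<mu> \<sigma> = op_comp (TabL L) (repL L \<sigma>) (PsiL L \<mu>)"

lemma op_image_orbit_isometry:
  "op_image (Tab \<mu>) (orbit_isometry L \<mu> (t k)) = orbitL L \<mu> t k"
  by (simp add: op_image_def orbitL_def subspL_def orbit_isometry_def op_apply_comp[abs_def] image_image)

lemma sum_TabL:
  assumes "finite L"
  shows "(\<Sum>p\<in>TabL L. g p) = (\<Sum>\<nu>\<in>L. \<Sum>S\<in>Tab \<nu>. g (\<nu>, S))"
  unfolding TabL_def using sum.Sigma[of L Tab "\<lambda>\<nu> S. g (\<nu>, S)"] assms finite_Tab by simp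

lemma orbit_isometry_entry:
  assumes "finite L" and \<nu>: "\<nu> \<in> L"
  shows "orbit_isometry L \<mu> \<sigma> (\<nu>, S) R =
    sqrt (real (card (Tab \<nu>)) / real (dimL L)) * op_comp (Tab \<nu>) (young_rep \<nu> \<sigma>) (Psi1 \<nu> \<mu>) S R"
proof -
  have "orbit_isometry L \<mu> \<sigma> (\<nu>, S) R =
     (\<Sum>\<kappa>\<in>L. if \<kappa> = \<nu> then
       \<Sum>T\<in>Tab \<nu>. young_rep \<nu> \<sigma> S T * (sqrt (real (card (Tab \<nu>)) / real (dimL L)) * Psi1 \<nu> \<mu> T R) else 0)"
    unfolding orbit_isometry_def op_comp_def sum_TabL[OF assms(1)]
    by (rule sum.cong) (use \<nu> in \<open>auto simp: repL_def PsiL_def\<close>)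
  then show ?thesis
    using assms by (simp add: op_comp_def sum_distrib_left mult.left_commute)
qed

text \<open>The conclusion \<open>u = v\<close> for equal permutations serves the isometry property,
  where \<open>rev u @ u\<close> must cancel.\<close>

lemma orbit_cross_gram:
  assumes L: "L \<subseteq> up_set \<mu>" "finite L"
    and \<sigma>: "\<sigma> permutes {1..Suc (sum_list \<mu>)}" and \<tau>: "\<tau> permutes {1..Suc (sum_list \<mu>)}"
  obtains u v where "set u \<subseteq> {1..<Suc (sum_list \<mu>)}" "set v \<subseteq> {1..<Suc (sum_list \<mu>)}"
    "word_perm u = \<sigma>" "word_perm v = \<tau>" "\<sigma> = \<tau> \<Longrightarrow> u = v"
    "op_comp (TabL L) (op_adj (orbit_isometry L \<mu> \<sigma>)) (orbit_isometry L \<mu> \<tau>) =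
     (\<lambda>R R'. \<Sum>\<nu>\<in>L. real (card (Tab \<nu>)) / real (dimL L) * gram_block \<nu> \<mu> (rev u @ v) R R')"
proof -
  \<comment> \<open>The choice in \<open>young_rep\<close> depends on \<nu> only through its size,
    so one word per permutation serves all of \<open>L\<close>.\<close>
  define W where "W \<sigma> = (SOME ks. set ks \<subseteq> {1..<Suc (sum_list \<mu>)} \<and> word_perm ks = \<sigma>)" for \<sigma>
  have w: "set (W \<rho>) \<subseteq> {1..<Suc (sum_list \<mu>)} \<and> word_perm (W \<rho>) = \<rho>"
    if "\<rho> permutes {1..Suc (sum_list \<mu>)}" for \<rho>
    unfolding W_def using someI_ex[OF ex_word_perm[OF that]] .
  have rep: "young_rep \<nu> \<rho> = word_op \<nu> (W \<rho>)" if "\<nu> \<in> L" for \<nu> \<rho>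
    using up_setD(3)[of \<nu> \<mu>] L(1) that by (auto simp: young_rep_def W_def)
  have "op_comp (TabL L) (op_adj (orbit_isometry L \<mu> \<sigma>)) (orbit_isometry L \<mu> \<tau>) =
     (\<lambda>R R'. \<Sum>\<nu>\<in>L. real (card (Tab \<nu>)) / real (dimL L) * gram_block \<nu> \<mu> (rev (W \<sigma>) @ W \<tau>) R R')"
  proof (intro ext)
    fix R R' :: tableau
    let ?V = "\<lambda>\<nu> \<rho>. op_comp (Tab \<nu>) (word_op \<nu> (W \<rho>)) (Psi1 \<nu> \<mu>)"
    have "op_comp (TabL L) (op_adj (orbit_isometry L \<mu> \<sigma>)) (orbit_isometry L \<mu> \<tau>) R R' =
      (\<Sum>\<nu>\<in>L. \<Sum>S\<in>Tab \<nu>. orbit_isometry L \<mu> \<sigma> (\<nu>, S) R * orbit_isometry L \<mu> \<tau> (\<nu>, S) R')"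
      by (simp add: op_comp_def op_adj_def sum_TabL[OF L(2)])
    also have "\<dots> = (\<Sum>\<nu>\<in>L. real (card (Tab \<nu>)) / real (dimL L) * gram_block \<nu> \<mu> (rev (W \<sigma>) @ W \<tau>) R R')"
    proof (rule sum.cong[OF refl])
      fix \<nu> assume \<nu>: "\<nu> \<in> L"
      let ?c = "real (card (Tab \<nu>)) / real (dimL L)"
      have "(\<Sum>S\<in>Tab \<nu>. orbit_isometry L \<mu> \<sigma> (\<nu>, S) R * orbit_isometry L \<mu> \<tau> (\<nu>, S) R')
         = (\<Sum>S\<in>Tab \<nu>. ?c * (?V \<nu> \<sigma> S R * ?V \<nu> \<tau> S R'))"
      proof (rule sum.cong[OF refl])
        fix S
        have "sqrt ?c * sqrt ?c = ?c" by simp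
        then show "orbit_isometry L \<mu> \<sigma> (\<nu>, S) R * orbit_isometry L \<mu> \<tau> (\<nu>, S) R'
           = ?c * (?V \<nu> \<sigma> S R * ?V \<nu> \<tau> S R')"
          unfolding orbit_isometry_entry[OF L(2) \<nu>] rep[OF \<nu>] by algebra
      qed
      also have "\<dots> = ?c * op_comp (Tab \<nu>) (op_adj (?V \<nu> \<sigma>)) (?V \<nu> \<tau>) R R'"
        unfolding op_comp_adj_entry sum_distrib_left ..
      also have "op_comp (Tab \<nu>) (op_adj (?V \<nu> \<sigma>)) (?V \<nu> \<tau>) = gram_block \<nu> \<mu> (rev (W \<sigma>) @ W \<tau>)"
      proof -
        have "sum_list \<nu> = Suc (sum_list \<mu>)" using up_setD(3) L(1) \<nu> by blast
        then have "set (W \<sigma>) \<subseteq> {1..<sum_list \<nu>}" using w[OF \<sigma>] by simp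
        then show ?thesis
          by (simp only: gram_block_def op_adj_comp op_adj_word_op word_op_append op_comp_assoc)
      qed
      finally show "(\<Sum>S\<in>Tab \<nu>. orbit_isometry L \<mu> \<sigma> (\<nu>, S) R * orbit_isometry L \<mu> \<tau> (\<nu>, S) R')
         = ?c * gram_block \<nu> \<mu> (rev (W \<sigma>) @ W \<tau>) R R'" .
    qed
    finally show "op_comp (TabL L) (op_adj (orbit_isometry L \<mu> \<sigma>)) (orbit_isometry L \<mu> \<tau>) R R' =
      (\<Sum>\<nu>\<in>L. real (card (Tab \<nu>)) / real (dimL L) * gram_block \<nu> \<mu> (rev (W \<sigma>) @ W \<tau>) R R')" .
  qed
  then show ?thesis using w[OF \<sigma>] w[OF \<tau>] by (intro that[of "W \<sigma>" "W \<tau>"]) auto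
qed

lemma card_Tab_pos: "young_diagram (diagram \<nu>) \<Longrightarrow> card (Tab \<nu>) > 0"
  using num_syt_pos by (simp add: num_syt_def Tab_eq_syt)

lemma dimL_pos:
  assumes "L \<subseteq> up_set \<mu>" "finite L" "L \<noteq> {}"
  shows "dimL L > 0"
  unfolding dimL_def using assms by (intro sum_pos card_Tab_pos) (auto intro: up_setD(4))

text \<open>The word of the Gram matrix cancels, each block is the identity, and the squared weights
  of \<open>PsiL\<close> add up to 1.\<close>

lemma orbit_isometry_is_isometry:
  assumes L: "L \<subseteq> up_set \<mu>" "finite L" "L \<noteq> {}" and D: "young_diagram (diagram \<mu>)"
    and \<sigma>: "\<sigma> permutes {1..Suc (sum_list \<mu>)}"
  shows "is_isometry (TabL L) (Tab \<mu>) (orbit_isometry L \<mu> \<sigma>)"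
proof -
  obtain u v where uv: "set u \<subseteq> {1..<Suc (sum_list \<mu>)}" "u = v"
    and C: "op_comp (TabL L) (op_adj (orbit_isometry L \<mu> \<sigma>)) (orbit_isometry L \<mu> \<sigma>) =
     (\<lambda>R R'. \<Sum>\<nu>\<in>L. real (card (Tab \<nu>)) / real (dimL L) * gram_block \<nu> \<mu> (rev u @ v) R R')"
    by (rule orbit_cross_gram[OF L(1,2) \<sigma> \<sigma>]) auto
  have "gram_block \<nu> \<mu> (rev u @ v) = op_scalar (Tab \<mu>) 1" if "\<nu> \<in> L" for \<nu>
  proof -
    have \<nu>: "\<nu> \<in> up_set \<mu>" using that L by auto
    have "word_op \<nu> (rev u @ v) = word_op \<nu> []"
      using coxeter_rev[OF uv(1)] uv(2) up_setD(3,4)[OF \<nu>] word_op_coxeter by metis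
    then show ?thesis using gram_block_Nil[OF \<nu> D] by (simp add: gram_block_def)
  qed
  then have "op_comp (TabL L) (op_adj (orbit_isometry L \<mu> \<sigma>)) (orbit_isometry L \<mu> \<sigma>) R R' =
     (\<Sum>\<nu>\<in>L. real (card (Tab \<nu>)) / real (dimL L)) * op_scalar (Tab \<mu>) 1 R R'" for R R'
    unfolding C by (simp add: sum_distrib_right cong: sum.cong)
  moreover have "(\<Sum>\<nu>\<in>L. real (card (Tab \<nu>)) / real (dimL L)) = 1"
  proof -
    have "(\<Sum>\<nu>\<in>L. real (card (Tab \<nu>))) = real (dimL L)" by (simp add: dimL_def)
    then show ?thesis using dimL_pos[OF L] by (simp add: sum_divide_distrib[symmetric])
  qed
  ultimately show ?thesis by (simp add: is_isometry_def op_eq_def)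
qed

text \<open>Word operators are orthogonal matrices, so the condition concerns the diagonal matrix of
  squares conjugated by \<open>word_op \<mu> v\<close>, and conjugation preserves scalar
  matrices.\<close>

lemma isoclinic_pair_conj_diag:
  assumes D: "young_diagram (diagram \<mu>)"
    and uv: "set u \<subseteq> {1..<sum_list \<mu>}" "set v \<subseteq> {1..<sum_list \<mu>}"
    and C: "op_comp Y (op_adj A) B =
      op_comp (Tab \<mu>) (word_op \<mu> u) (op_comp (Tab \<mu>) (diag_op (Tab \<mu>) d) (word_op \<mu> v))"
  shows "isoclinic_pair Y (Tab \<mu>) A B \<alpha> \<longleftrightarrow> (\<forall>R\<in>Tab \<mu>. (d R)\<^sup>2 = \<alpha>)"
proof -
  let ?X = "Tab \<mu>" and ?W = "word_op \<mu>" and ?M = "diag_op (Tab \<mu>) d"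
    and ?M2 = "diag_op (Tab \<mu>) (\<lambda>R. (d R)\<^sup>2)"
  have one: "op_comp ?X (?W (rev w)) (?W w) = op_scalar ?X 1" if "set w \<subseteq> {1..<sum_list \<mu>}" for w
    using word_op_coxeter[OF coxeter_rev[OF that] D refl] by (simp add: word_op_append word_op_Nil)
  have one': "op_comp ?X (?W w) (?W (rev w)) = op_scalar ?X 1" if "set w \<subseteq> {1..<sum_list \<mu>}" for w
    using one[of "rev w"] that by simp
  have cancel: "op_comp ?X (op_scalar ?X 1) A = A" if "\<And>x y. x \<notin> ?X \<Longrightarrow> A x y = 0" for A :: "(tableau, tableau) opr"
    using op_scalar_comp[OF finite_Tab, of \<mu> A 1] that by simp
  let ?C = "op_comp Y (op_adj A) B"
  have "op_comp ?X (op_adj ?C) ?C =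
     op_comp ?X (?W (rev v)) (op_comp ?X ?M (op_comp ?X (op_comp ?X (?W (rev u)) (?W u)) (op_comp ?X ?M (?W v))))"
    unfolding C by (simp add: op_adj_comp op_adj_word_op[OF uv(1)] op_adj_word_op[OF uv(2)] op_adj_diag op_comp_assoc)
  also have "\<dots> = op_comp ?X (?W (rev v)) (op_comp ?X ?M (op_comp ?X ?M (?W v)))"
    unfolding one[OF uv(1)] by (subst cancel) (auto simp: op_comp_diag[OF finite_Tab])
  also have "\<dots> = op_comp ?X (?W (rev v)) (op_comp ?X ?M2 (?W v))"
    by (simp add: op_comp_assoc[symmetric] op_comp_diag_diag[OF finite_Tab])
  finally have CC: "op_comp ?X (op_adj ?C) ?C = op_comp ?X (?W (rev v)) (op_comp ?X ?M2 (?W v))" .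
  show ?thesis
  proof
    assume "isoclinic_pair Y ?X A B \<alpha>"
    then have e: "op_comp ?X (op_adj ?C) ?C R R' = op_scalar ?X \<alpha> R R'" if "R \<in> ?X" "R' \<in> ?X" for R R'
      using that by (auto simp: isoclinic_pair_def op_eq_def Let_def)
    \<comment> \<open>Both sides vanish outside the tableaux, so this holds as an equality of
      functions and can be multiplied from both sides.\<close>
    have e': "op_comp ?X (?W (rev v)) (op_comp ?X ?M2 (?W v)) = op_scalar ?X \<alpha>"
    proof (intro ext)
      fix R R'
      show "op_comp ?X (?W (rev v)) (op_comp ?X ?M2 (?W v)) R R' = op_scalar ?X \<alpha> R R'"
      proof (cases "R \<in> ?X \<and> R' \<in> ?X")
        case True
        then show ?thesis using e CC by simp
      next
        case False
        then show ?thesis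
          by (auto simp: op_comp_def op_scalar_def word_op_zero intro!: sum.neutral)
      qed
    qed
    have "?M2 = op_comp ?X (op_comp ?X (?W v) (?W (rev v))) (op_comp ?X ?M2 (op_comp ?X (?W v) (?W (rev v))))"
      unfolding one'[OF uv(2)]
      by (subst op_comp_scalar, simp add: finite_Tab, simp add: diag_op_def, subst cancel) (auto simp: diag_op_def)
    also have "\<dots> = op_comp ?X (?W v) (op_comp ?X (op_comp ?X (?W (rev v)) (op_comp ?X ?M2 (?W v))) (?W (rev v)))"
      by (simp add: op_comp_assoc)
    also have "\<dots> = op_comp ?X (op_comp ?X (?W v) (op_scalar ?X \<alpha>)) (?W (rev v))"
      unfolding e' by (simp add: op_comp_assoc)
    also have "op_comp ?X (?W v) (op_scalar ?X \<alpha>) = (\<lambda>x y. \<alpha> * ?W v x y)"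
      by (rule op_comp_scalar[OF finite_Tab]) (simp add: word_op_zero)
    also have "op_comp ?X (\<lambda>x y. \<alpha> * ?W v x y) (?W (rev v)) = (\<lambda>x y. \<alpha> * op_comp ?X (?W v) (?W (rev v)) x y)"
      by (simp add: op_comp_def sum_distrib_left mult.assoc)
    finally have M2: "?M2 = (\<lambda>x y. \<alpha> * op_scalar ?X 1 x y)" using one'[OF uv(2)] by simp
    show "\<forall>R\<in>?X. (d R)\<^sup>2 = \<alpha>"
    proof
      fix R assume "R \<in> ?X"
      then show "(d R)\<^sup>2 = \<alpha>" using fun_cong[OF fun_cong[OF M2, of R], of R]
        by (simp add: diag_op_def op_scalar_def)
    qed
  next
    assume *: "\<forall>R\<in>?X. (d R)\<^sup>2 = \<alpha>"
    have "?M2 = op_scalar ?X \<alpha>" using * by (auto simp: diag_op_def op_scalar_def fun_eq_iff)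
    then have "op_comp ?X ?M2 (?W v) = (\<lambda>x y. \<alpha> * ?W v x y)"
      using op_scalar_comp[OF finite_Tab, of \<mu> "?W v" \<alpha>] by (simp add: word_op_zero)
    then have "op_comp ?X (op_adj ?C) ?C = (\<lambda>x y. \<alpha> * op_comp ?X (?W (rev v)) (?W v) x y)"
      unfolding CC by (simp add: op_comp_def sum_distrib_left mult.left_commute)
    then have "op_comp ?X (op_adj ?C) ?C = op_scalar ?X \<alpha>"
      unfolding one[OF uv(2)] by (auto simp: op_scalar_def fun_eq_iff)
    then show "isoclinic_pair Y ?X A B \<alpha>" by (simp add: isoclinic_pair_def op_eq_def)
  qed
qed

text \<open>The right side does not mention the permutations, so one condition serves all pairs of
  distinct members of the orbit.\<close>

lemma orbit_isoclinic_pair: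
  assumes L: "L \<subseteq> up_set \<mu>" "finite L" and D: "young_diagram (diagram \<mu>)" and m: "sum_list \<mu> = m"
    and \<sigma>: "\<sigma> permutes {1..Suc m}" and \<tau>: "\<tau> permutes {1..Suc m}" and ne: "\<sigma> (Suc m) \<noteq> \<tau> (Suc m)"
  shows "isoclinic_pair (TabL L) (Tab \<mu>) (orbit_isometry L \<mu> \<sigma>) (orbit_isometry L \<mu> \<tau>) \<alpha> \<longleftrightarrow>
    (\<forall>R\<in>Tab \<mu>. (corner_coeff L \<mu> (entry_content (diagram \<mu>) R m))\<^sup>2 = \<alpha>)"
proof -
  obtain a b where ab: "set a \<subseteq> {1..<Suc m}" "set b \<subseteq> {1..<Suc m}" "word_perm a = \<sigma>" "word_perm b = \<tau>"
    and C: "op_comp (TabL L) (op_adj (orbit_isometry L \<mu> \<sigma>)) (orbit_isometry L \<mu> \<tau>) =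
     (\<lambda>R R'. \<Sum>\<nu>\<in>L. real (card (Tab \<nu>)) / real (dimL L) * gram_block \<nu> \<mu> (rev a @ b) R R')"
    by (rule orbit_cross_gram[OF L, of \<sigma> \<tau>]) (use \<sigma> \<tau> m in auto)
  let ?w = "rev a @ b"
  \<comment> \<open>The word spells the inverse of \<sigma> after \<tau>, which moves
    \<open>Suc m\<close>; this puts it into the nontrivial double coset.\<close>
  have wn: "word_perm ?w (Suc m) \<noteq> Suc m"
  proof
    assume "word_perm ?w (Suc m) = Suc m"
    then have "word_perm (rev a) (\<tau> (Suc m)) = Suc m" using ab by (simp add: word_perm_append)
    then have "\<sigma> (Suc m) = \<tau> (Suc m)" using word_perm_rev[of "rev a" "\<tau> (Suc m)"] ab by simp
    then show False using ne by simp
  qed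
  have "\<not> (\<exists>u. set u \<subseteq> {1..<m} \<and> coxeter_eq (Suc m) ?w u)"
    using wn word_perm_coxeter word_perm_fix[of _ m "Suc m"] by (metis lessI)
  moreover have "set ?w \<subseteq> {1..<Suc m}" using ab by auto
  ultimately obtain u v where u: "set u \<subseteq> {1..<m}" and v: "set v \<subseteq> {1..<m}" and m1: "1 \<le> m"
    and w: "coxeter_eq (Suc m) ?w (u @ m # v)"
    using coxeter_double_coset by blast
  let ?X = "Tab \<mu>"
  let ?d = "\<lambda>\<nu> R. 1 / real_of_int (content (added_box \<nu> \<mu>) - entry_content (diagram \<mu>) R m)"
  have blk: "gram_block \<nu> \<mu> ?w = op_comp ?X (word_op \<mu> u) (op_comp ?X (diag_op ?X (?d \<nu>)) (word_op \<mu> v))"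
    if "\<nu> \<in> L" for \<nu>
  proof -
    have \<nu>: "\<nu> \<in> up_set \<mu>" using that L by auto
    have "word_op \<nu> ?w = word_op \<nu> (u @ [m] @ v)"
      using word_op_coxeter[OF w up_setD(4)[OF \<nu>]] up_setD(3)[OF \<nu>] m by simp
    then have "gram_block \<nu> \<mu> ?w = gram_block \<nu> \<mu> (u @ [m] @ v)" by (simp only: gram_block_def)
    then show ?thesis
      using gram_block_conj[OF \<nu> D, of u v "[m]"] u v m gram_block_last[OF \<nu> D m m1] by simp
  qed
  have "op_comp (TabL L) (op_adj (orbit_isometry L \<mu> \<sigma>)) (orbit_isometry L \<mu> \<tau>) =
    op_comp ?X (word_op \<mu> u) (op_comp ?X
      (diag_op ?X (\<lambda>R. corner_coeff L \<mu> (entry_content (diagram \<mu>) R m))) (word_op \<mu> v))"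
  proof (intro ext)
    fix R R'
    let ?c = "\<lambda>\<nu>. real (card (Tab \<nu>)) / real (dimL L)"
    have "(\<Sum>\<nu>\<in>L. ?c \<nu> * gram_block \<nu> \<mu> ?w R R') =
      (\<Sum>\<nu>\<in>L. \<Sum>Q\<in>?X. word_op \<mu> u R Q * (?c \<nu> * ?d \<nu> Q * word_op \<mu> v Q R'))"
    proof (rule sum.cong[OF refl])
      fix \<nu> assume "\<nu> \<in> L"
      show "?c \<nu> * gram_block \<nu> \<mu> ?w R R' =
        (\<Sum>Q\<in>?X. word_op \<mu> u R Q * (?c \<nu> * ?d \<nu> Q * word_op \<mu> v Q R'))"
        unfolding blk[OF \<open>\<nu> \<in> L\<close>] op_comp_def[of _ "word_op \<mu> u"] sum_distrib_left
        by (rule sum.cong) (auto simp: op_comp_diag[OF finite_Tab])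
    qed
    also have "\<dots> = (\<Sum>Q\<in>?X. \<Sum>\<nu>\<in>L. word_op \<mu> u R Q * (?c \<nu> * ?d \<nu> Q * word_op \<mu> v Q R'))"
      by (rule sum.swap)
    also have "\<dots> = (\<Sum>Q\<in>?X. word_op \<mu> u R Q *
        (corner_coeff L \<mu> (entry_content (diagram \<mu>) Q m) * word_op \<mu> v Q R'))"
      by (simp only: sum_distrib_left[symmetric] sum_distrib_right[symmetric] corner_coeff_def)
    also have "\<dots> = op_comp ?X (word_op \<mu> u) (op_comp ?X
      (diag_op ?X (\<lambda>R. corner_coeff L \<mu> (entry_content (diagram \<mu>) R m))) (word_op \<mu> v)) R R'"
      unfolding op_comp_def[of _ "word_op \<mu> u"] by (rule sum.cong) (auto simp: op_comp_diag[OF finite_Tab])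
    finally show "op_comp (TabL L) (op_adj (orbit_isometry L \<mu> \<sigma>)) (orbit_isometry L \<mu> \<tau>) R R' = \<dots>"
      unfolding C .
  qed
  then show ?thesis using isoclinic_pair_conj_diag[OF D] u v m by blast
qed

text \<open>Every removable corner holds the largest entry of some tableau, since the diagram
  without it has a standard filling by \<open>num_syt_pos\<close>.\<close>

lemma last_entry_removable:
  assumes D: "young_diagram (diagram \<mu>)" and m: "sum_list \<mu> = m" "1 \<le> m"
  shows "(\<forall>R\<in>Tab \<mu>. P (entry_content (diagram \<mu>) R m)) \<longleftrightarrow> (\<forall>x\<in>removable (diagram \<mu>). P (content x))"
proof
  assume *: "\<forall>R\<in>Tab \<mu>. P (entry_content (diagram \<mu>) R m)"
  show "\<forall>x\<in>removable (diagram \<mu>). P (content x)"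
  proof
    fix x assume x: "x \<in> removable (diagram \<mu>)"
    let ?E = "diagram \<mu> - {x}"
    have xD: "x \<in> diagram \<mu>" "insert x ?E = diagram \<mu>" using x by (auto simp: removable_def)
    obtain Q where Q: "Q \<in> syt ?E"
      using num_syt_pos[OF young_diagram_removable[OF x]] by (auto simp: num_syt_def card_gt_0_iff)
    have c: "Suc (card ?E) = m" using xD finite_diagram[of \<mu>] m by (simp add: card_diagram)
    have R: "Q(x := m) \<in> syt (diagram \<mu>)"
      using syt_extend[OF addable_Diff_removable[OF D x] young_diagram_removable[OF x] Q] xD c by simp
    have "inv_into (diagram \<mu>) (Q(x := m)) m = x"
      using syt_inj[OF R] xD by (intro inv_into_f_eq) auto
    then show "P (content x)" using * R by (metis Tab_eq_syt entry_content_def)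
  qed
next
  assume *: "\<forall>x\<in>removable (diagram \<mu>). P (content x)"
  show "\<forall>R\<in>Tab \<mu>. P (entry_content (diagram \<mu>) R m)"
  proof
    fix R assume R: "R \<in> Tab \<mu>"
    then have "inv_into (diagram \<mu>) R m \<in> removable (diagram \<mu>)"
      using syt_box[of R "diagram \<mu>" m] m
      by (intro syt_remove(1)[OF D, of R]) (auto simp: Tab_eq_syt card_diagram)
    then show "P (entry_content (diagram \<mu>) R m)" using * by (simp add: entry_content_def)
  qed
qed

theorem isoclinic_iff_corner_coeff:
  assumes p: "partition_of m \<mu>" and m1: "1 \<le> m"
  shows "isoclinic \<mu> \<longleftrightarrow> (\<exists>L \<alpha>. L \<noteq> {} \<and> L \<subset> up_set \<mu> \<and>
    (\<forall>x\<in>removable (diagram \<mu>). (corner_coeff L \<mu> (content x))\<^sup>2 = \<alpha>))"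
proof -
  have D: "young_diagram (diagram \<mu>)" by (rule young_diagram_diagram[OF p])
  have m: "sum_list \<mu> = m" using p by (simp add: partition_of_def)
  have key: "equi_isoclinic {1..Suc m} (TabL L) (orbitL L \<mu> t) \<longleftrightarrow>
      (\<exists>\<alpha>. \<forall>x\<in>removable (diagram \<mu>). (corner_coeff L \<mu> (content x))\<^sup>2 = \<alpha>)"
    if L: "L \<noteq> {}" "L \<subset> up_set \<mu>" and t: "coset_reps (Suc m) t" for L t
  proof -
    have L': "L \<subseteq> up_set \<mu>" "finite L" using L finite_up_set[OF D] finite_subset by auto
    have tk: "t k permutes {1..Suc m}" "t k (Suc m) = k" if "k \<in> {1..Suc m}" for k
      using t that by (auto simp: coset_reps_def)
    have "equi_isoclinic {1..Suc m} (TabL L) (orbitL L \<mu> t) \<longleftrightarrow>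
      (\<exists>\<alpha>. \<forall>k\<in>{1..Suc m}. \<forall>l\<in>{1..Suc m}. k \<noteq> l \<longrightarrow>
        isoclinic_pair (TabL L) (Tab \<mu>) (orbit_isometry L \<mu> (t k)) (orbit_isometry L \<mu> (t l)) \<alpha>)"
      using tk orbit_isometry_is_isometry[OF L' L(1) D] m
      by (intro equi_isoclinic_iff) (auto simp: finite_Tab op_image_orbit_isometry)
    also have "\<dots> \<longleftrightarrow> (\<exists>\<alpha>. \<forall>k\<in>{1..Suc m}. \<forall>l\<in>{1..Suc m}. k \<noteq> l \<longrightarrow>
       (\<forall>R\<in>Tab \<mu>. (corner_coeff L \<mu> (entry_content (diagram \<mu>) R m))\<^sup>2 = \<alpha>))"
      using orbit_isoclinic_pair[OF L' D m] tk by simp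
    also have "\<dots> \<longleftrightarrow> (\<exists>\<alpha>. \<forall>R\<in>Tab \<mu>. (corner_coeff L \<mu> (entry_content (diagram \<mu>) R m))\<^sup>2 = \<alpha>)"
    proof -
      \<comment> \<open>Two distinct indices exist, so the quantification over pairs is not
        vacuous.\<close>
      have "1 \<in> {1..Suc m}" "Suc m \<in> {1..Suc m}" "1 \<noteq> Suc m" using m1 by auto
      then show ?thesis by blast
    qed
    also have "\<dots> \<longleftrightarrow> (\<exists>\<alpha>. \<forall>x\<in>removable (diagram \<mu>). (corner_coeff L \<mu> (content x))\<^sup>2 = \<alpha>)"
      using last_entry_removable[OF D m m1, of "\<lambda>c. (corner_coeff L \<mu> c)\<^sup>2 = _"] by simp
    finally show ?thesis .
  qed
  \<comment> \<open>Coset representatives exist, so the quantification over \<open>t\<close> is not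
    vacuous.\<close>
  have "coset_reps (Suc m) (\<lambda>k. Transposition.transpose k (Suc m))"
    by (auto simp: coset_reps_def intro: permutes_swap_id)
  then have "(\<forall>t. coset_reps (Suc m) t \<longrightarrow> equi_isoclinic {1..Suc m} (TabL L) (orbitL L \<mu> t)) \<longleftrightarrow>
    (\<exists>\<alpha>. \<forall>x\<in>removable (diagram \<mu>). (corner_coeff L \<mu> (content x))\<^sup>2 = \<alpha>)"
    if "L \<noteq> {}" "L \<subset> up_set \<mu>" for L
    using key[OF that] by blast
  then show ?thesis unfolding isoclinic_def Let_def m by (simp cong: conj_cong)
qed

section \<open>The isoclinic condition at the corners\<close>

definition corner_sum :: "(nat \<times> nat) set \<Rightarrow> (nat \<times> nat) set \<Rightarrow> nat \<times> nat \<Rightarrow> real" where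
  "corner_sum D Z x =
     (\<Sum>z\<in>Z. real (num_syt (insert z D)) / (real_of_int (content z) - real_of_int (content x)))"

lemma corner_coeff_eq_corner_sum:
  assumes "L \<subseteq> up_set \<mu>"
  shows "corner_coeff L \<mu> (content x) =
    corner_sum (diagram \<mu>) ((\<lambda>\<nu>. added_box \<nu> \<mu>) ` L) x / real (dimL L)"
proof -
  have "card (Tab \<nu>) = num_syt (insert (added_box \<nu> \<mu>) (diagram \<mu>))" if "\<nu> \<in> L" for \<nu>
    using up_setD(1)[of \<nu> \<mu>] assms that by (auto simp: Tab_eq_syt num_syt_def)
  moreover have "inj_on (\<lambda>\<nu>. added_box \<nu> \<mu>) L" using inj_on_added_box assms inj_on_subset by blast
  ultimately show ?thesis
    by (simp add: corner_coeff_def corner_sum_def sum.reindex sum_divide_distrib mult.commute)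
qed

text \<open>The square of the positive number \<open>dimL L\<close> is absorbed into the constant
  \<alpha>.\<close>

theorem isoclinic_iff_corner_sum:
  assumes p: "partition_of m \<mu>" and m1: "1 \<le> m"
  shows "isoclinic \<mu> \<longleftrightarrow> (\<exists>Z \<alpha>. Z \<noteq> {} \<and> Z \<subset> addable (diagram \<mu>) \<and>
    (\<forall>x\<in>removable (diagram \<mu>). (corner_sum (diagram \<mu>) Z x)\<^sup>2 = \<alpha>))"
  unfolding isoclinic_iff_corner_coeff[OF assms]
proof
  have D: "young_diagram (diagram \<mu>)" by (rule young_diagram_diagram[OF p])
  let ?b = "\<lambda>\<nu>. added_box \<nu> \<mu>"
  {
    assume "\<exists>L \<alpha>. L \<noteq> {} \<and> L \<subset> up_set \<mu> \<and>
      (\<forall>x\<in>removable (diagram \<mu>). (corner_coeff L \<mu> (content x))\<^sup>2 = \<alpha>)"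
    then obtain L \<alpha> where L: "L \<noteq> {}" "L \<subset> up_set \<mu>"
      and \<alpha>: "\<And>x. x \<in> removable (diagram \<mu>) \<Longrightarrow> (corner_coeff L \<mu> (content x))\<^sup>2 = \<alpha>" by blast
    have fin: "finite L" using L finite_up_set[OF D] finite_subset by blast
    have d: "dimL L > 0" using dimL_pos[of L \<mu>] L fin by blast
    have "?b ` L \<noteq> addable (diagram \<mu>)"
    proof
      assume eq: "?b ` L = addable (diagram \<mu>)"
      obtain \<nu> where \<nu>: "\<nu> \<in> up_set \<mu>" "\<nu> \<notin> L" using L by blast
      then obtain \<kappa> where "\<kappa> \<in> L" "?b \<kappa> = ?b \<nu>" using up_setD(5)[OF \<nu>(1)] eq by (metis imageE)
      then show False using \<nu> L inj_onD[OF inj_on_added_box] by blast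
    qed
    then have "?b ` L \<subset> addable (diagram \<mu>)" using L up_setD(5) by blast
    moreover have "(corner_sum (diagram \<mu>) (?b ` L) x)\<^sup>2 = \<alpha> * (real (dimL L))\<^sup>2"
      if "x \<in> removable (diagram \<mu>)" for x
      using \<alpha>[OF that] corner_coeff_eq_corner_sum[of L \<mu> x] L d
      by (auto simp: power_divide)
    ultimately show "\<exists>Z \<alpha>. Z \<noteq> {} \<and> Z \<subset> addable (diagram \<mu>) \<and>
      (\<forall>x\<in>removable (diagram \<mu>). (corner_sum (diagram \<mu>) Z x)\<^sup>2 = \<alpha>)"
      using L(1) by (intro exI[of _ "?b ` L"] exI[of _ "\<alpha> * (real (dimL L))\<^sup>2"] conjI ballI) simp_all
  next
    assume "\<exists>Z \<alpha>. Z \<noteq> {} \<and> Z \<subset> addable (diagram \<mu>) \<and>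
      (\<forall>x\<in>removable (diagram \<mu>). (corner_sum (diagram \<mu>) Z x)\<^sup>2 = \<alpha>)"
    then obtain Z \<alpha> where Z: "Z \<noteq> {}" "Z \<subset> addable (diagram \<mu>)"
      and \<alpha>: "\<And>x. x \<in> removable (diagram \<mu>) \<Longrightarrow> (corner_sum (diagram \<mu>) Z x)\<^sup>2 = \<alpha>" by blast
    define L where "L = {\<nu> \<in> up_set \<mu>. ?b \<nu> \<in> Z}"
    have img: "?b ` L = Z"
    proof (intro equalityI subsetI)
      fix z assume "z \<in> Z"
      moreover obtain \<nu> where "\<nu> \<in> up_set \<mu>" "?b \<nu> = z"
        using ex_up_set[OF D, of z] Z \<open>z \<in> Z\<close> by blast
      ultimately show "z \<in> ?b ` L" by (auto simp: L_def)
    qed (auto simp: L_def)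
    have "L \<noteq> {}" using img Z(1) by auto
    moreover have "L \<subset> up_set \<mu>"
    proof -
      obtain z where "z \<in> addable (diagram \<mu>)" "z \<notin> Z" using Z by blast
      then obtain \<nu> where "\<nu> \<in> up_set \<mu>" "\<nu> \<notin> L" using ex_up_set[OF D, of z] by (auto simp: L_def)
      then show ?thesis by (auto simp: L_def)
    qed
    moreover have "(corner_coeff L \<mu> (content x))\<^sup>2 = \<alpha> / (real (dimL L))\<^sup>2"
      if "x \<in> removable (diagram \<mu>)" for x
      using \<alpha>[OF that] corner_coeff_eq_corner_sum[of L \<mu> x] \<open>L \<subset> up_set \<mu>\<close>
      by (auto simp: power_divide img)
    ultimately show "\<exists>L \<alpha>. L \<noteq> {} \<and> L \<subset> up_set \<mu> \<and>
      (\<forall>x\<in>removable (diagram \<mu>). (corner_coeff L \<mu> (content x))\<^sup>2 = \<alpha>)"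
      by (intro exI[of _ L] exI[of _ "\<alpha> / (real (dimL L))\<^sup>2"] conjI ballI) simp_all
  }
qed

text \<open>With \<open>z\<^sub>1 > r\<^sub>1 > z\<^sub>2 > r\<^sub>2 > z\<^sub>3 > r\<^sub>3 > z\<^sub>4\<close> the contents of the corners and \<open>d\<^sub>i\<close> the weights, the
  parameters stand for \<open>d\<^sub>i / \<bar>z\<^sub>i - r\<^sub>j\<bar>\<close>.\<close>

lemma interlacing_sign_pattern:
  fixes A1 A2 A3 B1 B2 B3 C1 C2 C3 E1 E2 E3 :: real
  assumes A: "A1 > A2" "A2 > A3" "A3 > 0" and B: "B2 > B3" "B3 > 0"
    and C: "C1 < C2" "C1 > 0" and E: "E1 < E2" "E2 < E3" "E1 > 0"
    and eqs: "A1 - B1 - C1 - E1 = 0" "A2 + B2 - C2 - E2 = 0" "A3 + B3 + C3 - E3 = 0"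
    and S: "S1 = (if p1 then A1 else 0) - (if p2 then B1 else 0) - (if p3 then C1 else 0) - (if p4 then E1 else 0)"
      "S2 = (if p1 then A2 else 0) + (if p2 then B2 else 0) - (if p3 then C2 else 0) - (if p4 then E2 else 0)"
      "S3 = (if p1 then A3 else 0) + (if p2 then B3 else 0) + (if p3 then C3 else 0) - (if p4 then E3 else 0)"
    and sq: "S1\<^sup>2 = S2\<^sup>2" "S2\<^sup>2 = S3\<^sup>2"
    and p: "p1 \<or> p2 \<or> p3 \<or> p4" "\<not> (p1 \<and> p2 \<and> p3 \<and> p4)"
  shows "p1 = p3 \<and> p2 = p4 \<and> p1 \<noteq> p2"
proof -
  \<comment> \<open>Finitely many sign choices and subsets remain, and each non-alternating one
    contradicts the linear constraints.\<close>
  have "S1 = S2 \<or> S1 = - S2" "S2 = S3 \<or> S2 = - S3" using sq by (auto simp: power2_eq_iff)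
  then show ?thesis
    using p A B C E eqs S by (smt (verit))
qed

text \<open>The hypotheses \<open>w1\<close> and \<open>w3\<close> are the product formula of
  \<open>cauchy_weights\<close> at z1 and z3 with signs cancelled. The scale \<open>K\<close> drops
  out because the three sums are homogeneous in the weights.\<close>

lemma isoclinic_equations:
  fixes a b c e f g w1 w3 K :: real
  assumes pos: "a > 0" "b > 0" "c > 0" "e > 0" "f > 0" "g > 0" "w1 > 0" "w3 > 0" and K: "K \<noteq> 0"
    and w1: "w1 * ((a + g) * (a + g + b + f) * (a + g + b + f + c + e)) = K * (a * (a + g + b) * (a + g + b + f + c))"
    and w3: "w3 * ((a + g + b + f) * (b + f) * (c + e)) = K * ((g + b + f) * f * c)"
  defines "S1 \<equiv> w1 / a - w3 / (g + b + f)" and "S2 \<equiv> w1 / (a + g + b) - w3 / f"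
    and "S3 \<equiv> w1 / (a + g + b + f + c) + w3 / c"
  shows "S1\<^sup>2 = S2\<^sup>2 \<and> S2\<^sup>2 = S3\<^sup>2 \<longleftrightarrow>
    c = 2 * a * f / (b + g) + f \<and> e = (a + g) * f / b - c"
proof -
  \<comment> \<open>These inequalities give S1 > S2, so equal squares force S1 = - S2 with S1
    positive, and then S1 = S3.\<close>
  have "w1 / (a + g + b) < w1 / a" "w3 / (g + b + f) < w3 / f"
    using pos by (auto intro!: divide_strict_left_mono mult_pos_pos)
  then have "S1 > S2" by (simp add: S1_def S2_def)
  moreover have "S3 > 0" using pos by (simp add: S3_def add_pos_pos)
  ultimately have "S1\<^sup>2 = S2\<^sup>2 \<and> S2\<^sup>2 = S3\<^sup>2 \<longleftrightarrow> S1 = - S2 \<and> S1 = S3"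
    by (auto simp: power2_eq_iff)
  moreover have 1: "S1 = S3 \<longleftrightarrow> b * (c + e) = (a + g) * f"
    and 2: "S1 = S3 \<Longrightarrow> S1 = - S2 \<longleftrightarrow> c * (b + g) = (2 * a + b + g) * f"
  proof -
    have clear: "(x / p - y / q) * (p * q) = x * q - y * p" if "p > 0" "q > 0" for x y p q :: real
      using that by (simp add: field_simps)
    let ?P1 = "(a + g) * (a + g + b + f) * (a + g + b + f + c + e)"
    let ?P3 = "(a + g + b + f) * (b + f) * (c + e)"
    let ?Q1 = "a * (a + g + b) * (a + g + b + f + c)" and ?Q3 = "(g + b + f) * f * c"
    let ?x = "w1 * (c * (g + b + f))" and ?y = "w3 * (a * (a + g + b + f + c))"
    have "(S1 - S3) * (a * (a + g + b + f + c) * (c * (g + b + f))) = (g + b + f + c) * (?x - ?y)"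
    proof -
      have "w1 / a - w1 / (a + g + b + f + c) = w1 * (g + b + f + c) / (a * (a + g + b + f + c))"
        using pos by (simp add: field_simps)
      moreover have "w3 / (g + b + f) + w3 / c = w3 * (g + b + f + c) / (c * (g + b + f))"
        using pos by (simp add: field_simps)
      ultimately have "S1 - S3 = w1 * (g + b + f + c) / (a * (a + g + b + f + c))
          - w3 * (g + b + f + c) / (c * (g + b + f))"
        by (simp add: S1_def S3_def)
      then have "(S1 - S3) * (a * (a + g + b + f + c) * (c * (g + b + f))) =
          w1 * (g + b + f + c) * (c * (g + b + f)) - w3 * (g + b + f + c) * (a * (a + g + b + f + c))"
        using pos clear[of "a * (a + g + b + f + c)" "c * (g + b + f)"] by simp
      then show ?thesis by algebra
    qed
    moreover have "a * (a + g + b + f + c) * (c * (g + b + f)) > 0" "g + b + f + c > 0" using pos by auto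
    ultimately have S13: "S1 = S3 \<longleftrightarrow> ?x = ?y"
      by (metis eq_iff_diff_eq_0 less_irrefl mult_eq_0_iff)
    \<comment> \<open>The factors \<open>?P1\<close> and \<open>?P3\<close> allow the weights to be
      replaced by \<open>?Q1\<close> and \<open>?Q3\<close>; then b (c + e) - (a + g) f splits off,
      and the cofactor is nonzero.\<close>
    have "(?x - ?y) * (?P1 * ?P3) = (w1 * ?P1) * (?P3 * (c * (g + b + f))) - (w3 * ?P3) * (?P1 * (a * (a + g + b + f + c)))"
      by algebra
    also have "\<dots> = K * (?Q1 * (?P3 * (c * (g + b + f))) - ?Q3 * (?P1 * (a * (a + g + b + f + c))))"
      unfolding w1 w3 by (simp add: right_diff_distrib mult.assoc)
    also have "\<dots> = K * (a * c * (g + b + f) * (a + g + b + f + c) * (a + g + b + f) * (a + g + b + f))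
        * (b * (c + e) - (a + g) * f)"
      by algebra
    finally have "(?x - ?y) * (?P1 * ?P3) = K * (a * c * (g + b + f) * (a + g + b + f + c) * (a + g + b + f) * (a + g + b + f))
        * (b * (c + e) - (a + g) * f)" .
    moreover have "?P1 * ?P3 > 0" using pos by auto
    moreover have "a * c * (g + b + f) * (a + g + b + f + c) * (a + g + b + f) * (a + g + b + f) > 0" using pos by auto
    ultimately have "?x = ?y \<longleftrightarrow> b * (c + e) = (a + g) * f"
      using K by (metis eq_iff_diff_eq_0 less_irrefl mult_eq_0_iff)
    then show "S1 = S3 \<longleftrightarrow> b * (c + e) = (a + g) * f" using S13 by simp
    assume "S1 = S3"
    then have xy: "?x = ?y" using S13 by simp
    have "(S1 + S2) * (a * (a + g + b) * (f * (g + b + f))) =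
       w1 * (2 * a + g + b) * (f * (g + b + f)) - w3 * (g + b + 2 * f) * (a * (a + g + b))"
    proof -
      have "w1 / a + w1 / (a + g + b) = w1 * (2 * a + g + b) / (a * (a + g + b))"
        using pos by (simp add: field_simps)
      moreover have "w3 / (g + b + f) + w3 / f = w3 * (g + b + 2 * f) / (f * (g + b + f))"
        using pos by (simp add: field_simps)
      ultimately have "S1 + S2 = w1 * (2 * a + g + b) / (a * (a + g + b)) - w3 * (g + b + 2 * f) / (f * (g + b + f))"
        by (simp add: S1_def S2_def)
      then show ?thesis
        using pos clear[of "a * (a + g + b)" "f * (g + b + f)"] by simp
    qed
    then have "(S1 + S2) * (a * (a + g + b) * (f * (g + b + f))) * c =
       ?x * ((2 * a + g + b) * f) - w3 * (g + b + 2 * f) * (a * (a + g + b)) * c"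
      by algebra
    \<comment> \<open>\<open>xy\<close> eliminates \<open>w1\<close>, leaving \<open>w3\<close> as a
      positive factor.\<close>
    also have "\<dots> = w3 * a * (a + g + b + f) * ((2 * a + b + g) * f - c * (b + g))"
      unfolding xy by algebra
    finally have "(S1 + S2) * (a * (a + g + b) * (f * (g + b + f)) * c) =
       w3 * a * (a + g + b + f) * ((2 * a + b + g) * f - c * (b + g))"
      by (simp add: mult.assoc)
    moreover have "a * (a + g + b) * (f * (g + b + f)) * c > 0" "w3 * a * (a + g + b + f) > 0"
      using pos by auto
    ultimately have "S1 + S2 = 0 \<longleftrightarrow> (2 * a + b + g) * f - c * (b + g) = 0"
      by (metis less_irrefl mult_eq_0_iff)
    then show "S1 = - S2 \<longleftrightarrow> c * (b + g) = (2 * a + b + g) * f" by auto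
  qed
  moreover have "c * (b + g) = (2 * a + b + g) * f \<longleftrightarrow> c = 2 * a * f / (b + g) + f"
    using pos by (simp add: field_simps)
  moreover have "b * (c + e) = (a + g) * f \<longleftrightarrow> e = (a + g) * f / b - c"
    using pos by (simp add: field_simps)
  ultimately show ?thesis by blast
qed

section \<open>The three-step partition and its corners\<close>

lemma three_step_diagram:
  "(i, j) \<in> diagram (three_step a b c e f g) \<longleftrightarrow>
    i < a \<and> j < e + f + g \<or> a \<le> i \<and> i < a + b \<and> j < e + f \<or> a + b \<le> i \<and> i < a + b + c \<and> j < e"
  by (auto simp: diagram_def three_step_def nth_append)

lemma three_step_corners:
  fixes a b c e f g :: nat
  assumes pos: "a > 0" "b > 0" "c > 0" "e > 0" "f > 0" "g > 0"
  defines "D \<equiv> diagram (three_step a b c e f g)"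
  shows "removable D = {(a - 1, e + f + g - 1), (a + b - 1, e + f - 1), (a + b + c - 1, e - 1)}"
    and "addable D = {(0, e + f + g), (a, e + f), (a + b, e), (a + b + c, 0)}"
proof -
  have D: "young_diagram D"
    unfolding D_def using pos by (intro young_diagram_diagram[OF partition_of_three_step])
  note mem = three_step_diagram[of _ _ a b c e f g, folded D_def]
  show R: "removable D = {(a - 1, e + f + g - 1), (a + b - 1, e + f - 1), (a + b + c - 1, e - 1)}"
  proof (intro equalityI subsetI)
    fix x assume x: "x \<in> removable D"
    obtain i j where ij: "x = (i, j)" by force
    have h: "(i, j) \<in> D" "(Suc i, j) \<notin> D" "(i, Suc j) \<notin> D"
      using x removable_iff[OF D, of i j] ij by auto
    consider "i < a" | "a \<le> i" "i < a + b" | "a + b \<le> i" by linarith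
    then show "x \<in> {(a - 1, e + f + g - 1), (a + b - 1, e + f - 1), (a + b + c - 1, e - 1)}"
    proof cases
      case 1
      then have "j = e + f + g - 1" "i = a - 1" using h unfolding mem by linarith+
      then show ?thesis using ij by simp
    next
      case 2
      then have "j = e + f - 1" "i = a + b - 1" using h unfolding mem by linarith+
      then show ?thesis using ij by simp
    next
      case 3
      then have "j = e - 1" "i = a + b + c - 1" using h unfolding mem by linarith+
      then show ?thesis using ij by simp
    qed
  next
    fix x assume "x \<in> {(a - 1, e + f + g - 1), (a + b - 1, e + f - 1), (a + b + c - 1, e - 1)}"
    then show "x \<in> removable D"
      using pos by (auto simp: removable_iff[OF D] mem)
  qed
  \<comment> \<open>Exhibiting four addable corners is enough, because \<open>card_addable\<close>
    leaves no room for more.\<close>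
  have "a - 1 < a + b - 1" "a + b - 1 < a + b + c - 1" using pos by linarith+
  then have "card (removable D) = 3" unfolding R by auto
  then have "card (addable D) = 4" using card_addable[OF D] by simp
  moreover have "card {(0, e + f + g), (a, e + f), (a + b, e), (a + b + c, 0)} = 4" using pos by auto
  moreover have "{(0, e + f + g), (a, e + f), (a + b, e), (a + b + c, 0)} \<subseteq> addable D"
    using pos by (auto simp: addable_iff[OF D] mem)
  ultimately show "addable D = {(0, e + f + g), (a, e + f), (a + b, e), (a + b + c, 0)}"
    using card_subset_eq[OF finite_addable[OF D]] by metis
qed

theorem theorem6p10:
  fixes a b c e f g :: nat
  assumes "a > 0" and "b > 0" and "c > 0" and "e > 0" and "f > 0" and "g > 0"
  shows "isoclinic (three_step a b c e f g) \<longleftrightarrow>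
           real c = 2 * real a * real f / (real b + real g) + real f \<and>
           real e = (real a + real g) * real f / real b - real c"
proof -
  define \<mu> where "\<mu> = three_step a b c e f g"
  define D where "D = diagram \<mu>"
  \<comment> \<open>Listed from the top row downwards, so the contents decrease in the order z1, r1,
    z2, r2, z3, r3, z4.\<close>
  define z1 z2 z3 z4 where z: "z1 = (0 :: nat, e + f + g)" "z2 = (a, e + f)" "z3 = (a + b, e)" "z4 = (a + b + c, 0 :: nat)"
  define r1 r2 r3 where r: "r1 = (a - 1, e + f + g - 1)" "r2 = (a + b - 1, e + f - 1)"
    "r3 = (a + b + c - 1, e - 1)"
  have p: "partition_of (a * (e + f + g) + b * (e + f) + c * e) \<mu>"
    unfolding \<mu>_def by (rule partition_of_three_step[OF assms(4)])
  have D: "young_diagram D" unfolding D_def by (rule young_diagram_diagram[OF p])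
  have add: "addable D = {z1, z2, z3, z4}" and rem: "removable D = {r1, r2, r3}"
    unfolding D_def \<mu>_def z r by (rule three_step_corners[OF assms])+
  have dz: "z1 \<noteq> z2" "z1 \<noteq> z3" "z1 \<noteq> z4" "z2 \<noteq> z3" "z2 \<noteq> z4" "z3 \<noteq> z4"
    using assms by (auto simp: z)
  have "a - 1 < a + b - 1" "a + b - 1 < a + b + c - 1" using assms by linarith+
  then have dr: "r1 \<noteq> r2" "r1 \<noteq> r3" "r2 \<noteq> r3" by (auto simp: r)
  define u where "u x = real_of_int (content x)" for x
  have uz: "u z1 = real e + real f + real g" "u z2 = real e + real f - real a"
      "u z3 = real e - real a - real b" "u z4 = - real a - real b - real c"
    by (simp_all add: u_def content_def z)
  have ur: "u r1 = real e + real f + real g - real a" "u r2 = real e + real f - real a - real b"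
      "u r3 = real e - real a - real b - real c"
    using assms by (simp_all add: u_def content_def r of_nat_diff)
  define w where "w x = real (num_syt (insert x D))" for x
  have wpos: "w z1 > 0" "w z2 > 0" "w z3 > 0" "w z4 > 0"
    using num_syt_pos[OF young_diagram_addable, of _ D] by (auto simp: w_def add)
  have cs: "corner_sum D Z x =
      (if z1 \<in> Z then w z1 / (u z1 - u x) else 0) + (if z2 \<in> Z then w z2 / (u z2 - u x) else 0)
    + (if z3 \<in> Z then w z3 / (u z3 - u x) else 0) + (if z4 \<in> Z then w z4 / (u z4 - u x) else 0)"
    if "Z \<subseteq> addable D" for Z x
  proof -
    have "corner_sum D Z x = (\<Sum>y\<in>addable D \<inter> Z. w y / (u y - u x))"
      using that by (simp add: corner_sum_def w_def u_def Int_absorb1)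
    also have "\<dots> = (\<Sum>y\<in>addable D. if y \<in> Z then w y / (u y - u x) else 0)"
      by (rule sum.inter_restrict[OF finite_addable[OF D]])
    finally show ?thesis unfolding add using dz by simp
  qed
  \<comment> \<open>Absolute values of the summands: the letter stands for the addable corner, the
    digit for the removable one.\<close>
  let ?A1 = "w z1 / a" and ?A2 = "w z1 / (a + g + b)" and ?A3 = "w z1 / (a + g + b + f + c)"
  let ?B1 = "w z2 / g" and ?B2 = "w z2 / b" and ?B3 = "w z2 / (b + f + c)"
  let ?C1 = "w z3 / (g + b + f)" and ?C2 = "w z3 / f" and ?C3 = "w z3 / c"
  let ?E1 = "w z4 / (g + b + f + c + e)" and ?E2 = "w z4 / (f + c + e)" and ?E3 = "w z4 / e"
  have neg: "v / (- t) = - (v / t)" for v t :: real by simp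
  have diff: "u z1 - u r1 = a" "u z2 - u r1 = - real g" "u z3 - u r1 = - real (g + b + f)"
    "u z4 - u r1 = - real (g + b + f + c + e)"
    "u z1 - u r2 = a + g + b" "u z2 - u r2 = b" "u z3 - u r2 = - real f" "u z4 - u r2 = - real (f + c + e)"
    "u z1 - u r3 = a + g + b + f + c" "u z2 - u r3 = b + f + c" "u z3 - u r3 = c" "u z4 - u r3 = - real e"
    by (simp_all add: uz ur)
  have cs1: "corner_sum D Z r1 = (if z1 \<in> Z then ?A1 else 0) - (if z2 \<in> Z then ?B1 else 0)
      - (if z3 \<in> Z then ?C1 else 0) - (if z4 \<in> Z then ?E1 else 0)"
    and cs2: "corner_sum D Z r2 = (if z1 \<in> Z then ?A2 else 0) + (if z2 \<in> Z then ?B2 else 0)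
      - (if z3 \<in> Z then ?C2 else 0) - (if z4 \<in> Z then ?E2 else 0)"
    and cs3: "corner_sum D Z r3 = (if z1 \<in> Z then ?A3 else 0) + (if z2 \<in> Z then ?B3 else 0)
      + (if z3 \<in> Z then ?C3 else 0) - (if z4 \<in> Z then ?E3 else 0)"
    if "Z \<subseteq> addable D" for Z
    unfolding cs[OF that] diff neg by auto
  have orth: "corner_sum D (addable D) x = 0" if "x \<in> removable D" for x
    using transition_weights_orthogonal[OF D that] by (simp add: corner_sum_def)
  have eqs: "?A1 - ?B1 - ?C1 - ?E1 = 0" "?A2 + ?B2 - ?C2 - ?E2 = 0" "?A3 + ?B3 + ?C3 - ?E3 = 0"
    using orth[of r1] orth[of r2] orth[of r3] cs1[OF order_refl] cs2[OF order_refl] cs3[OF order_refl]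
    by (simp_all add: add rem)
  have ineqs: "?A1 > ?A2" "?A2 > ?A3" "?A3 > 0" "?B2 > ?B3" "?B3 > 0" "?C1 < ?C2" "?C1 > 0"
      "?E1 < ?E2" "?E2 < ?E3" "?E1 > 0"
    using assms wpos by (auto intro!: divide_strict_left_mono mult_pos_pos)
  have inj: "inj_on u (addable D \<union> removable D)"
    using inj_on_content_corners[OF D] by (simp add: inj_on_def u_def)
  obtain K where K: "\<And>x. x \<in> addable D \<Longrightarrow>
      w x * (\<Prod>y\<in>addable D - {x}. u x - u y) = K * (\<Prod>y\<in>removable D. u x - u y)"
    using cauchy_weights[OF finite_addable[OF D] finite_removable[OF D] card_addable[OF D] inj
        addable_removable_disjoint, of w]
      transition_weights_orthogonal[OF D] by (auto simp: w_def u_def)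
  have "addable D - {z1} = {z2, z3, z4}" "addable D - {z3} = {z1, z2, z4}" using dz by (auto simp: add)
  then have K1: "w z1 * ((u z1 - u z2) * (u z1 - u z3) * (u z1 - u z4)) =
      K * ((u z1 - u r1) * (u z1 - u r2) * (u z1 - u r3))"
    and K3: "w z3 * ((u z3 - u z1) * (u z3 - u z2) * (u z3 - u z4)) =
      K * ((u z3 - u r1) * (u z3 - u r2) * (u z3 - u r3))"
    using K[of z1] K[of z3] dz dr by (simp_all add: add rem mult.assoc)
  have w1: "w z1 * ((real a + g) * (real a + g + b + f) * (real a + g + b + f + c + e)) =
      K * (real a * (real a + g + b) * (real a + g + b + f + c))"
    using K1 unfolding uz ur by (simp add: algebra_simps)
  \<comment> \<open>At z3 two factors on each side are negative, so no sign is left.\<close>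
  have w3: "w z3 * ((real a + g + b + f) * (real b + f) * (real c + e)) = K * ((real g + b + f) * f * c)"
    using K3 unfolding uz ur by (simp add: algebra_simps)
  have "K \<noteq> 0" using w1 wpos assms by auto
  then have main: "(?A1 - ?C1)\<^sup>2 = (?A2 - ?C2)\<^sup>2 \<and> (?A2 - ?C2)\<^sup>2 = (?A3 + ?C3)\<^sup>2 \<longleftrightarrow>
      real c = 2 * real a * real f / (real b + real g) + real f \<and>
      real e = (real a + real g) * real f / real b - real c"
    using isoclinic_equations[of a b c e f g "w z1" "w z3" K] assms wpos w1 w3 by simp
  have "isoclinic \<mu> \<longleftrightarrow> (\<exists>Z \<alpha>. Z \<noteq> {} \<and> Z \<subset> addable D \<and>
      (\<forall>x\<in>removable D. (corner_sum D Z x)\<^sup>2 = \<alpha>))"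
    unfolding D_def using assms by (intro isoclinic_iff_corner_sum[OF p]) (simp add: Suc_le_eq)
  also have "\<dots> \<longleftrightarrow> (?A1 - ?C1)\<^sup>2 = (?A2 - ?C2)\<^sup>2 \<and> (?A2 - ?C2)\<^sup>2 = (?A3 + ?C3)\<^sup>2"
  proof
    assume "\<exists>Z \<alpha>. Z \<noteq> {} \<and> Z \<subset> addable D \<and> (\<forall>x\<in>removable D. (corner_sum D Z x)\<^sup>2 = \<alpha>)"
    then obtain Z \<alpha> where Z: "Z \<noteq> {}" "Z \<subset> addable D" and \<alpha>: "\<forall>x\<in>removable D. (corner_sum D Z x)\<^sup>2 = \<alpha>"
      by blast
    have sub: "Z \<subseteq> addable D" using Z by blast
    have sq: "(corner_sum D Z r1)\<^sup>2 = (corner_sum D Z r2)\<^sup>2" "(corner_sum D Z r2)\<^sup>2 = (corner_sum D Z r3)\<^sup>2"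
      using \<alpha> by (auto simp: rem)
    have "(z1 \<in> Z) = (z3 \<in> Z) \<and> (z2 \<in> Z) = (z4 \<in> Z) \<and> (z1 \<in> Z) \<noteq> (z2 \<in> Z)"
    proof (rule interlacing_sign_pattern[OF ineqs eqs cs1[OF sub] cs2[OF sub] cs3[OF sub] sq])
      show "z1 \<in> Z \<or> z2 \<in> Z \<or> z3 \<in> Z \<or> z4 \<in> Z" using Z by (auto simp: add)
      show "\<not> (z1 \<in> Z \<and> z2 \<in> Z \<and> z3 \<in> Z \<and> z4 \<in> Z)" using Z by (auto simp: add)
    qed
    then consider "z1 \<in> Z" "z3 \<in> Z" "z2 \<notin> Z" "z4 \<notin> Z" | "z1 \<notin> Z" "z3 \<notin> Z" "z2 \<in> Z" "z4 \<in> Z" by blast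
    then show "(?A1 - ?C1)\<^sup>2 = (?A2 - ?C2)\<^sup>2 \<and> (?A2 - ?C2)\<^sup>2 = (?A3 + ?C3)\<^sup>2"
    proof cases
      case 1
      then show ?thesis using sq unfolding cs1[OF sub] cs2[OF sub] cs3[OF sub] by simp
    next
      case 2
      \<comment> \<open>The sums over {z1, z3} and {z2, z4} add up to the full sums, which vanish by
        \<open>eqs\<close>.\<close>
      have "?A1 - ?C1 = - corner_sum D Z r1" "?A2 - ?C2 = - corner_sum D Z r2" "?A3 + ?C3 = - corner_sum D Z r3"
        using 2 eqs unfolding cs1[OF sub] cs2[OF sub] cs3[OF sub] by simp_all
      then show ?thesis using sq by (simp only: power2_minus)
    qed
  next
    assume sq: "(?A1 - ?C1)\<^sup>2 = (?A2 - ?C2)\<^sup>2 \<and> (?A2 - ?C2)\<^sup>2 = (?A3 + ?C3)\<^sup>2"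
    have sub: "{z1, z3} \<subseteq> addable D" "{z1, z3} \<subset> addable D" using dz by (auto simp: add)
    have "corner_sum D {z1, z3} r1 = ?A1 - ?C1" "corner_sum D {z1, z3} r2 = ?A2 - ?C2"
      "corner_sum D {z1, z3} r3 = ?A3 + ?C3"
      unfolding cs1[OF sub(1)] cs2[OF sub(1)] cs3[OF sub(1)] using dz by auto
    then have "\<forall>x\<in>removable D. (corner_sum D {z1, z3} x)\<^sup>2 = (?A1 - ?C1)\<^sup>2"
      using sq by (simp add: rem)
    then show "\<exists>Z \<alpha>. Z \<noteq> {} \<and> Z \<subset> addable D \<and> (\<forall>x\<in>removable D. (corner_sum D Z x)\<^sup>2 = \<alpha>)"
      using sub(2) by (intro exI[of _ "{z1, z3}"] exI[of _ "(?A1 - ?C1)\<^sup>2"] conjI) simp_all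
  qed
  finally show ?thesis using main unfolding \<mu>_def by blast
qed

end
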